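(* There is a polynomial-time algorithm (based on dynamic programming) which, given a maximal outerplanar graph $G$, computes a $2$-coloring of the vertices of $G$ (not necessarily proper) such that the maximum number of vertices of a monochromatic connected component is minimized over all $2$-colorings of $G$; in particular, it determines $mcc_2(G)$.
   Context: For a graph $G$ and a positive integer $t$, a $t$-coloring of $G$ is an arbitrary assignment of one of $t$ colors to each vertex (adjacent vertices may receive the same color). A monochromatic connected component is a connected component of the subgraph induced by the vertices of one color. $mcc_t(G)$ denotes the smallest integer $m$ such that there is a $t$-coloring of $G$ in which every monochromatic connected component has at most $m$ vertices. An outerplanar graph is a planar graph admitting a planar embedding with all vertices on the outer face; it is maximal outerplanar if no edge can be added while preserving outerplanarity. *)

theory Defs
  imports "HOL-Analysis.Analysis" "HOL-Computational_Algebra.Polynomial"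
begin

section \<open>Finite simple graphs\<close>

definition simple_graph :: "'a set \<Rightarrow> 'a set set \<Rightarrow> bool" where
  "simple_graph V E \<longleftrightarrow> finite V \<and> (\<forall>e\<in>E. e \<subseteq> V \<and> card e = 2)"

definition induced_edges :: "'a set set \<Rightarrow> 'a set \<Rightarrow> 'a set set" where
  "induced_edges E S = {e \<in> E. e \<subseteq> S}"

definition graph_components :: "'a set \<Rightarrow> 'a set set \<Rightarrow> 'a set set" where
  "graph_components V E = {{w \<in> V. (v, w) \<in> {(x, y). {x, y} \<in> E}\<^sup>*} | v. v \<in> V}"

section \<open>Colorings and monochromatic components\<close>

definition is_coloring :: "nat \<Rightarrow> 'a set \<Rightarrow> ('a \<Rightarrow> nat) \<Rightarrow> bool" where
  "is_coloring t V f \<longleftrightarrow> (\<forall>v\<in>V. f v < t)"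

definition mono_components :: "'a set \<Rightarrow> 'a set set \<Rightarrow> ('a \<Rightarrow> nat) \<Rightarrow> 'a set set" where
  "mono_components V E f =
     (\<Union>c. let S = {v \<in> V. f v = c} in graph_components S (induced_edges E S))"

text \<open>The inserted \<open>0\<close> only matters for the graph without vertices.\<close>

definition max_mono_size :: "'a set \<Rightarrow> 'a set set \<Rightarrow> ('a \<Rightarrow> nat) \<Rightarrow> nat" where
  "max_mono_size V E f = Max (insert 0 (card ` mono_components V E f))"

definition mcc :: "nat \<Rightarrow> 'a set \<Rightarrow> 'a set set \<Rightarrow> nat" where
  "mcc t V E = (LEAST m. \<exists>f. is_coloring t V f \<and> (\<forall>C \<in> mono_components V E f. card C \<le> m))"

section \<open>Outerplanar graphs\<close>

definition planar_embedding ::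
    "'a set \<Rightarrow> 'a set set \<Rightarrow> ('a \<Rightarrow> complex) \<Rightarrow> ('a set \<Rightarrow> real \<Rightarrow> complex) \<Rightarrow> bool" where
  "planar_embedding V E p \<gamma> \<longleftrightarrow>
     inj_on p V \<and>
     (\<forall>e\<in>E. arc (\<gamma> e) \<and> {pathstart (\<gamma> e), pathfinish (\<gamma> e)} = p ` e \<and>
             path_image (\<gamma> e) \<inter> p ` V = p ` e) \<and>
     (\<forall>e\<in>E. \<forall>e'\<in>E. e \<noteq> e' \<longrightarrow> path_image (\<gamma> e) \<inter> path_image (\<gamma> e') = p ` (e \<inter> e'))"

definition drawing ::
    "'a set \<Rightarrow> 'a set set \<Rightarrow> ('a \<Rightarrow> complex) \<Rightarrow> ('a set \<Rightarrow> real \<Rightarrow> complex) \<Rightarrow> complex set" where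
  "drawing V E p \<gamma> = p ` V \<union> (\<Union>e\<in>E. path_image (\<gamma> e))"

text \<open>A drawing of a finite graph is compact, so the \<open>outside\<close> of it is the unique unbounded
  connected component of its complement, i.e. the outer face.\<close>

definition outerplanar :: "'a set \<Rightarrow> 'a set set \<Rightarrow> bool" where
  "outerplanar V E \<longleftrightarrow> simple_graph V E \<and>
     (\<exists>p \<gamma>. planar_embedding V E p \<gamma> \<and> p ` V \<subseteq> frontier (outside (drawing V E p \<gamma>)))"

definition maximal_outerplanar :: "'a set \<Rightarrow> 'a set set \<Rightarrow> bool" where
  "maximal_outerplanar V E \<longleftrightarrow> outerplanar V E \<and>
     (\<forall>e. e \<subseteq> V \<and> card e = 2 \<and> e \<notin> E \<longrightarrow> \<not> outerplanar V (insert e E))"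

section \<open>Random access machines\<close>

text \<open>Registers and memory cells hold natural numbers; a program mentions finitely many registers
  and reaches the memory through addresses computed in registers. Every instruction takes one time
  unit. There is no multiplication, so a run of \<open>t\<close> steps increases the bit length of the numbers
  involved by \<open>O(t)\<close> only, and polynomial time on this machine coincides with polynomial time on
  Turing machines. Subtraction is truncated at \<open>0\<close>.\<close>

datatype instr =
    Const nat nat
  | Add nat nat nat
  | Sub nat nat nat
  | Load nat nat
  | Store nat nat
  | Jump nat
  | JumpZero nat nat

type_synonym config = "nat \<times> (nat \<Rightarrow> nat) \<times> (nat \<Rightarrow> nat)"

fun exec_instr :: "instr \<Rightarrow> config \<Rightarrow> config" where
  "exec_instr (Const i c) (pc, R, M) = (Suc pc, R(i := c), M)"
| "exec_instr (Add i j k) (pc, R, M) = (Suc pc, R(i := R j + R k), M)"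
| "exec_instr (Sub i j k) (pc, R, M) = (Suc pc, R(i := R j - R k), M)"
| "exec_instr (Load i j) (pc, R, M) = (Suc pc, R(i := M (R j)), M)"
| "exec_instr (Store i j) (pc, R, M) = (Suc pc, R, M(R i := R j))"
| "exec_instr (Jump l) (pc, R, M) = (l, R, M)"
| "exec_instr (JumpZero i l) (pc, R, M) = (if R i = 0 then l else Suc pc, R, M)"

definition halted :: "instr list \<Rightarrow> config \<Rightarrow> bool" where
  "halted P s \<longleftrightarrow> length P \<le> fst s"

definition ram_step :: "instr list \<Rightarrow> config \<Rightarrow> config" where
  "ram_step P s = (if halted P s then s else exec_instr (P ! fst s) s)"

definition halts_within :: "instr list \<Rightarrow> config \<Rightarrow> nat \<Rightarrow> config \<Rightarrow> bool" where
  "halts_within P s t s' \<longleftrightarrow> (\<exists>k\<le>t. (ram_step P ^^ k) s = s' \<and> halted P s')"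

text \<open>A graph on the vertex set \<open>{..<n}\<close> is given to a machine by \<open>n\<close> in register \<open>0\<close> and by its
  adjacency matrix, stored row by row from memory address \<open>0\<close>.\<close>

definition graph_input :: "nat \<Rightarrow> nat set set \<Rightarrow> config" where
  "graph_input n E =
     (0, (\<lambda>i. if i = 0 then n else 0),
      (\<lambda>a. if a < n * n \<and> {a div n, a mod n} \<in> E then 1 else 0))"

end

theory Submission imports Defs begin

text \<open>A vertex of a drawing that lies on the outer face cannot lie inside a closed curve of the drawing.
  By the theta curve theorem, this excludes a cycle with two crossing chords. In a graph of minimum
  degree three, a longest path whose first vertex has a chord of minimal length yields such a cycle;
  hence an outerplanar graph has a vertex of degree at most two. Eliminating such a vertex and joining
  its two neighbours keeps the graph outerplanar, so all vertices can be eliminated in this way.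

  The dynamic program follows such an elimination order. For every pair of remaining vertices it keeps
  the table of all ways in which the eliminated vertices behind this pair can contribute: the colours
  of the two vertices, whether they are connected, and how many eliminated vertices are attached to
  each of them. The tables decide whether a partial colouring extends to one with components of size
  at most \<open>m\<close>; minimising \<open>m\<close> and then fixing the colours one vertex at a time gives an optimal
  colouring. On the machine, all of this is a fixed nesting of loops over \<open>{0..<n + 2}\<close> around
  first-order formulas, so the running time is a polynomial that can be read off the program.\<close>

section \<open>Theta curves\<close>

text \<open>Two consequences of the topological definition carry everything: some vertex has degree
  at most two, and suppressing a vertex between two neighbours leaves an outerplanar graph. The edge
  created by a suppression need not belong to the graph; it is a fill edge, and it is where the
  table of its pair lives. Hence the vertex to be eliminated occurs in at most two nontrivial pair
  tables. The entries stay small: in a solution every weight is bounded by that of its class, hence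
  by \<open>m\<close>. With \<open>N = n + 2\<close>, the vertices, the extra vertex
  \<open>n\<close>, the sizes up to \<open>n\<close>, and the colours and connection flags 0 and 1
  are all below \<open>N\<close>, also for \<open>n = 0\<close>. A table row together with its pair
  is a tuple of seven such numbers, whence the common arity 7. A tuple is stored at the address
  whose trailing base-\<open>N\<close> digits it forms; since the machine cannot multiply, addresses
  are computed by Horner's scheme with loops of \<open>N\<close> additions.\<close>

definition arc_between :: "complex set \<Rightarrow> complex \<Rightarrow> complex \<Rightarrow> bool" where
  "arc_between A a b \<longleftrightarrow> (\<exists>g. arc g \<and> path_image g = A \<and> pathstart g = a \<and> pathfinish g = b)"

lemma arc_between_sym: "arc_between A a b \<Longrightarrow> arc_between A b a"
  unfolding arc_between_def
  by (metis arc_reversepath path_image_reversepath pathfinish_reversepath pathstart_reversepath)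

lemma arc_between_join:
  assumes "arc_between A a b" "arc_between B b c" "A \<inter> B = {b}"
  shows "arc_between (A \<union> B) a c"
proof -
  obtain g where g: "arc g" "path_image g = A" "pathstart g = a" "pathfinish g = b"
    using assms(1) by (auto simp: arc_between_def)
  obtain h where h: "arc h" "path_image h = B" "pathstart h = b" "pathfinish h = c"
    using assms(2) by (auto simp: arc_between_def)
  have "arc (g +++ h)" using g h assms(3) by (intro arc_join) auto
  then show ?thesis unfolding arc_between_def
    using g h by (intro exI[of _ "g +++ h"]) (auto simp: path_image_join)
qed

lemma arc_between_ends: "arc_between A a b \<Longrightarrow> a \<in> A \<and> b \<in> A \<and> a \<noteq> b"
  unfolding arc_between_def using arc_distinct_ends pathstart_in_path_image pathfinish_in_path_image
  by metis

lemma arc_between_compact: "arc_between A a b \<Longrightarrow> compact A"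
  unfolding arc_between_def using compact_arc_image by blast

lemma arc_between_connected: "arc_between A a b \<Longrightarrow> connected A"
  unfolding arc_between_def using connected_arc_image by blast

text \<open>The closure statement locates the ends of an arc: if the open arc lies in a region, they
  lie in the closure of that region.\<close>

lemma arc_between_endless:
  assumes "arc_between A a b"
  shows "connected (A - {a, b})" "A - {a, b} \<noteq> {}" "A \<subseteq> closure (A - {a, b})"
proof -
  obtain g where g: "arc g" "path_image g = A" "pathstart g = a" "pathfinish g = b"
    using assms(1) by (auto simp: arc_between_def)
  show "connected (A - {a, b})"
    using connected_simple_path_endless[OF arc_imp_simple_path[OF g(1)]] g by simp
  show ne: "A - {a, b} \<noteq> {}"
    using nonempty_simple_path_endless[OF arc_imp_simple_path[OF g(1)]] g by simp
  have eq: "A - {a, b} = g ` {0<..<1}"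
    using simple_path_endless[OF arc_imp_simple_path[OF g(1)]] g by simp
  have "g ` closure {0<..<1} \<subseteq> closure (g ` {0<..<1})"
    using g(1) by (intro image_closure_subset) (auto simp: arc_def path_def closure_subset)
  then show "A \<subseteq> closure (A - {a, b})"
    unfolding eq using g(2) by (simp add: path_image_def)
qed

lemma closed_curve_facts:
  assumes "arc_between A a b" "arc_between B a b" "A \<inter> B = {a, b}"
  shows "inside (A \<union> B) \<noteq> {}" "connected (inside (A \<union> B))" "connected (outside (A \<union> B))"
    "frontier (inside (A \<union> B)) = A \<union> B"
proof -
  obtain g where g: "arc g" "path_image g = A" "pathstart g = a" "pathfinish g = b"
    using assms(1) by (auto simp: arc_between_def)
  obtain h where h: "arc h" "path_image h = B" "pathstart h = b" "pathfinish h = a"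
    using assms(2)[THEN arc_between_sym] by (auto simp: arc_between_def)
  have sp: "simple_path (g +++ h)"
    using g h assms(3) by (intro simple_path_join_loop) auto
  have pi: "path_image (g +++ h) = A \<union> B" using g h by (simp add: path_image_join)
  have lp: "pathfinish (g +++ h) = pathstart (g +++ h)" using g h by simp
  show "inside (A \<union> B) \<noteq> {}" "connected (inside (A \<union> B))" "connected (outside (A \<union> B))"
    "frontier (inside (A \<union> B)) = A \<union> B"
    using Jordan_inside_outside[OF sp lp] unfolding pi by auto
qed

text \<open>\<open>S\<close> lies in a single connected component of the complement of
  \<open>K\<close>, and \<open>inside K\<close> is a union of such components. An open arc off
  \<open>K\<close> is therefore placed by any one of its points.\<close>

lemma connected_meets_inside:
  assumes "connected S" "S \<inter> K = {}" "u \<in> S" "u \<in> inside K"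
  shows "S \<subseteq> inside K"
proof
  fix y assume "y \<in> S"
  then have "connected_component (- K) u y"
    using assms unfolding connected_component_def by blast
  then show "y \<in> inside K" using assms(4) by (rule inside_same_component)
qed

text \<open>One of three arcs with common ends runs inside the closed curve of the other two. The
  points \<open>x\<close> and \<open>y\<close> say that neither \<open>A\<close> nor
  \<open>B\<close> is that arc, so it is \<open>C\<close>.\<close>

lemma theta_curve_inside:
  assumes A: "arc_between A a b" and B: "arc_between B a b" and C: "arc_between C a b"
    and AB: "A \<inter> B = {a, b}" and AC: "A \<inter> C = {a, b}" and BC: "B \<inter> C = {a, b}"
    and x: "x \<in> A" "x \<notin> {a, b}" "x \<notin> inside (B \<union> C)"
    and y: "y \<in> B" "y \<notin> {a, b}" "y \<notin> inside (A \<union> C)"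
  shows "C - {a, b} \<subseteq> inside (A \<union> B)"
proof (cases "C \<inter> inside (A \<union> B) = {}")
  case False
  then obtain u where "u \<in> C" "u \<in> inside (A \<union> B)" by blast
  moreover from this have "u \<notin> {a, b}" using AB inside_no_overlap[of "A \<union> B"] by blast
  moreover have "(C - {a, b}) \<inter> (A \<union> B) = {}" using AC BC by blast
  ultimately show ?thesis
    by (intro connected_meets_inside[OF arc_between_endless(1)[OF C], of _ u]) simp_all
next
  case True
  note cl = arc_between_compact[OF A] arc_between_compact[OF B] arc_between_compact[OF C]
  obtain u where u: "u \<in> inside (A \<union> B)" using closed_curve_facts(1)[OF A B AB] by blast
  have uABC: "u \<notin> A" "u \<notin> B" "u \<notin> C" using u True inside_no_overlap[of "A \<union> B"] by blast+
  have Ao: "(A - {a, b}) \<inter> inside (B \<union> C) = {}"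
  proof (rule ccontr)
    assume "\<not> ?thesis"
    then obtain w where w: "w \<in> A - {a, b}" "w \<in> inside (B \<union> C)" by blast
    have "(A - {a, b}) \<inter> (B \<union> C) = {}" using AB AC by blast
    from connected_meets_inside[OF arc_between_endless(1)[OF A] this w] x show False by blast
  qed
  have Bo: "(B - {a, b}) \<inter> inside (A \<union> C) = {}"
  proof (rule ccontr)
    assume "\<not> ?thesis"
    then obtain w where w: "w \<in> B - {a, b}" "w \<in> inside (A \<union> C)" by blast
    have "(B - {a, b}) \<inter> (A \<union> C) = {}" using AB BC by blast
    from connected_meets_inside[OF arc_between_endless(1)[OF B] this w] y show False by blast
  qed
  have ab: "a \<in> A" "a \<in> B" "a \<in> C" "b \<in> A" "b \<in> B" "b \<in> C" using AB AC by blast+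
  \<comment> \<open>The open arc \<open>B' - {a, b}\<close> avoids
    \<open>inside (A' \<union> C)\<close>, so this region lies in
    \<open>inside (A' \<union> B')\<close>. Its frontier contains \<open>C\<close>, which is
    therefore in the closure of the larger region. The names \<open>A'\<close>, \<open>B'\<close>
    allow the roles of \<open>A\<close> and \<open>B\<close> to be exchanged below.\<close>
  have key: "C - {a, b} \<subseteq> inside (A' \<union> B')"
    if A': "arc_between A' a b" and B': "arc_between B' a b"
      and AC': "A' \<inter> C = {a, b}" and BC': "B' \<inter> C = {a, b}" and ab': "a \<in> B'" "b \<in> B'"
      and Bo': "(B' - {a, b}) \<inter> inside (A' \<union> C) = {}"
      and u1: "u \<in> inside (A' \<union> C)" and u2: "u \<in> inside (A' \<union> B')" for A' B'
  proof -
    have aA: "{a,b} \<subseteq> A'" using AC' by blast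
    have no: "inside (A' \<union> C) \<inter> (A' \<union> B') = {}"
      using Bo' inside_no_overlap[of "A' \<union> C"] aA by blast
    have "inside (A' \<union> C) \<subseteq> inside (A' \<union> B')"
      by (rule connected_meets_inside[OF closed_curve_facts(2)[OF A' C AC'] no u1 u2])
    then have "closure (inside (A' \<union> C)) \<subseteq> closure (inside (A' \<union> B'))" by (rule closure_mono)
    moreover have "C \<subseteq> closure (inside (A' \<union> C))"
      using closed_curve_facts(4)[OF A' C AC'] unfolding frontier_def by blast
    moreover have "closure (inside (A' \<union> B')) \<subseteq> A' \<union> B' \<union> inside (A' \<union> B')"
      using arc_between_compact[OF A'] arc_between_compact[OF B']
      by (intro closure_inside_subset) (simp add: compact_imp_closed closed_Un)
    ultimately show ?thesis using AC' BC' by blast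
  qed
  \<comment> \<open>If \<open>u\<close> were outside both closed curves through \<open>C\<close>, it
    could be joined to a far point \<open>w\<close> off each of them. The two curves intersect in
    the connected arc \<open>C\<close>, so Janiszewski's theorem joins \<open>u\<close> to
    \<open>w\<close> off their union, which contradicts
    \<open>u \<in> inside (A \<union> B)\<close>.\<close>
  have "u \<in> inside (A \<union> C) \<or> u \<in> inside (B \<union> C)"
  proof (rule ccontr)
    assume "\<not> ?thesis"
    then have uo: "u \<in> outside (A \<union> C)" "u \<in> outside (B \<union> C)"
      using uABC inside_Un_outside[of "A \<union> C"] inside_Un_outside[of "B \<union> C"] by blast+
    have "bounded (A \<union> B \<union> C)" using cl by (simp add: compact_imp_bounded)
    then obtain w where w: "w \<in> outside (A \<union> B \<union> C)"
      using outside_bounded_nonempty by blast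
    have wo: "w \<in> outside (A \<union> C)" "w \<in> outside (B \<union> C)" "w \<in> outside (A \<union> B)"
      using w outside_mono[of "A \<union> C" "A \<union> B \<union> C"] outside_mono[of "B \<union> C" "A \<union> B \<union> C"]
        outside_mono[of "A \<union> B" "A \<union> B \<union> C"] by blast+
    have "connected_component (- (A \<union> C)) u w"
      using closed_curve_facts(3)[OF A C AC] uo wo outside_no_overlap[of "A \<union> C"]
      unfolding connected_component_def by (intro exI[of _ "outside (A \<union> C)"]) blast
    moreover have "connected_component (- (B \<union> C)) u w"
      using closed_curve_facts(3)[OF B C BC] uo wo outside_no_overlap[of "B \<union> C"]
      unfolding connected_component_def by (intro exI[of _ "outside (B \<union> C)"]) blast
    moreover have "A \<inter> B \<subseteq> C" using AB ab by simp
    then have "(A \<union> C) \<inter> (B \<union> C) = C" by blast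
    moreover have "compact (A \<union> C)" "closed (B \<union> C)"
      using cl by (auto simp: compact_Un compact_imp_closed closed_Un)
    ultimately have "connected_component (- ((A \<union> C) \<union> (B \<union> C))) u w"
      using arc_between_connected[OF C] Janiszewski[of "A \<union> C" "B \<union> C" u w] by metis
    then have "connected_component (- (A \<union> B)) u w"
      by (rule connected_component_of_subset) blast
    then have "w \<in> inside (A \<union> B)" using u by (rule inside_same_component)
    then show False using wo(3) inside_Int_outside[of "A \<union> B"] by blast
  qed
  then show ?thesis
  proof
    assume "u \<in> inside (A \<union> C)"
    then show ?thesis using key[OF A B AC BC _ _ Bo] ab u by blast
  next
    assume "u \<in> inside (B \<union> C)"
    then show ?thesis using key[OF B A BC AC _ _ Ao] ab u by (simp add: Un_commute)
  qed
qed

text \<open>The open set \<open>inside X\<close> would meet \<open>outside D\<close>, because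
  \<open>x\<close> is in the closure of the latter; but
  \<open>outside D \<subseteq> outside X\<close>.\<close>

lemma outer_not_inside:
  fixes x :: complex
  assumes "x \<in> frontier (outside D)" "X \<subseteq> D" "closed X"
  shows "x \<notin> inside X"
proof
  assume "x \<in> inside X"
  moreover have "open (inside X)" using assms(3) by (simp add: open_inside)
  moreover have "x \<in> closure (outside D)" using assms(1) by (simp add: frontier_def)
  ultimately have "inside X \<inter> outside D \<noteq> {}"
    by (metis disjoint_iff open_Int_closure_eq_empty)
  then show False using outside_mono[OF assms(2)] inside_Int_outside[of X] by blast
qed

text \<open>The same closed curve is cut at \<open>a\<close>, \<open>c\<close> into
  \<open>J1\<close>, \<open>J2\<close> and at \<open>b\<close>, \<open>d\<close> into
  \<open>K1\<close>, \<open>K2\<close>. Both chords run inside it by the theta curve lemma, since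
  the four points are on the outer face. The chord \<open>A\<close> splits the inside into two
  regions, and the open chord \<open>B\<close> stays in one of them; but the boundary of each region
  misses one end of \<open>B\<close>, and that end then lies inside a closed curve of the
  drawing.\<close>

lemma no_crossing_chords:
  assumes J1: "arc_between J1 a c" and J2: "arc_between J2 a c"
    and K1: "arc_between K1 b d" and K2: "arc_between K2 b d"
    and A: "arc_between A a c" and B: "arc_between B b d"
    and J: "J1 \<inter> J2 = {a, c}" "J1 \<inter> A = {a, c}" "J2 \<inter> A = {a, c}"
    and K: "K1 \<inter> K2 = {b, d}" "K1 \<inter> B = {b, d}" "K2 \<inter> B = {b, d}"
    and JK: "J1 \<union> J2 = K1 \<union> K2" and AB: "A \<inter> B = {}"
    and m: "b \<in> J1" "d \<in> J2" "c \<in> K1" "a \<in> K2" and dist: "b \<notin> {a, c}" "d \<notin> {a, c}"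
    and sub: "J1 \<union> J2 \<union> A \<union> B \<subseteq> D"
    and fr: "{a, b, c, d} \<subseteq> frontier (outside D)"
  shows False
proof -
  note cl = arc_between_compact[OF J1, THEN compact_imp_closed] arc_between_compact[OF J2, THEN compact_imp_closed]
    arc_between_compact[OF K1, THEN compact_imp_closed] arc_between_compact[OF K2, THEN compact_imp_closed]
    arc_between_compact[OF A, THEN compact_imp_closed] arc_between_compact[OF B, THEN compact_imp_closed]
  have out: "x \<notin> inside X" if "x \<in> {a, b, c, d}" "X \<subseteq> D" "closed X" for x X
    using outer_not_inside[OF _ that(2,3)] fr that(1) by blast
  have Ai: "A - {a, c} \<subseteq> inside (J1 \<union> J2)"
  proof (rule theta_curve_inside[OF J1 J2 A J, of b d])
    show "b \<notin> inside (J2 \<union> A)" "d \<notin> inside (J1 \<union> A)"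
      by (rule out; use sub cl in auto)+
  qed (use m dist in auto)
  have Bi: "B - {b, d} \<subseteq> inside (K1 \<union> K2)"
  proof (rule theta_curve_inside[OF K1 K2 B K, of c a])
    show "c \<notin> inside (K2 \<union> B)" "a \<notin> inside (K1 \<union> B)"
      by (rule out; use sub cl JK in auto)+
  qed (use m dist in auto)
  obtain g1 where g1: "arc g1" "path_image g1 = J1" "pathstart g1 = a" "pathfinish g1 = c"
    using J1 by (auto simp: arc_between_def)
  obtain g2 where g2: "arc g2" "path_image g2 = J2" "pathstart g2 = a" "pathfinish g2 = c"
    using J2 by (auto simp: arc_between_def)
  obtain g where g: "arc g" "path_image g = A" "pathstart g = a" "pathfinish g = c"
    using A by (auto simp: arc_between_def)
  have split: "inside (J1 \<union> A) \<union> inside (J2 \<union> A) \<union> (A - {a, c}) = inside (J1 \<union> J2)"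
    using split_inside_simple_closed_curve[OF arc_imp_simple_path[OF g1(1)] g1(3,4)
        arc_imp_simple_path[OF g2(1)] g2(3,4) arc_imp_simple_path[OF g(1)] g(3,4)]
      J Ai arc_between_endless(2)[OF A] arc_between_ends[OF A] unfolding g1 g2 g by (metis Diff_subset Int_greatest subset_empty)
  obtain u where u: "u \<in> B - {b, d}" using arc_between_endless(2)[OF B] by blast
  have Bd: "(B - {b, d}) \<inter> (J1 \<union> J2 \<union> A) = {}" using AB K JK by blast
  \<comment> \<open>\<open>X\<close> stands for the boundary of the region that contains the open
    chord \<open>B\<close>, and \<open>z\<close> for an end of \<open>B\<close> off
    \<open>X\<close>: it is in the closure of the inside but not on \<open>X\<close>, hence
    inside.\<close>
  have key: False if X: "closed X" "X \<subseteq> J1 \<union> J2 \<union> A" "u \<in> inside X" "z \<in> {b, d}" "z \<notin> X" for X z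
  proof -
    have "B - {b, d} \<subseteq> inside X"
      using connected_meets_inside[OF arc_between_endless(1)[OF B] _ u X(3)] Bd X(2) by blast
    then have "closure (B - {b, d}) \<subseteq> closure (inside X)" by (rule closure_mono)
    then have "z \<in> closure (inside X)" using arc_between_endless(3)[OF B] arc_between_ends[OF B] X(4) by blast
    then have "z \<in> inside X" using closure_inside_subset[OF X(1)] X(5) by blast
    moreover have "z \<notin> inside X" by (rule out) (use X sub in auto)
    ultimately show False by blast
  qed
  have "u \<in> inside (J1 \<union> A) \<or> u \<in> inside (J2 \<union> A)"
  proof -
    have "u \<in> inside (J1 \<union> J2)" using u Bi unfolding JK by (rule subsetD[rotated])
    moreover have "u \<notin> A" using u AB by blast
    ultimately show ?thesis unfolding split[symmetric] by simp
  qed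
  moreover have "b \<in> B" "d \<in> B" using arc_between_ends[OF B] by simp_all
  then have "b \<notin> A" "d \<notin> A" using AB by blast+
  moreover have "b \<notin> J2" using m(1) dist(1) J(1) by blast
  moreover have "d \<notin> J1" using m(2) dist(2) J(1) by blast
  ultimately show False
    using key[of "J1 \<union> A" d] key[of "J2 \<union> A" b] cl by auto
qed

section \<open>Outerplanar graphs have a vertex of degree at most two\<close>

fun path_edges :: "'a list \<Rightarrow> 'a set set" where
  "path_edges (x # y # zs) = insert {x, y} (path_edges (y # zs))"
| "path_edges _ = {}"

lemma path_edges_append:
  "xs \<noteq> [] \<Longrightarrow> ys \<noteq> [] \<Longrightarrow>
   path_edges (xs @ ys) = path_edges xs \<union> {{last xs, hd ys}} \<union> path_edges ys"
  by (induction xs rule: path_edges.induct) (auto simp: neq_Nil_conv)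

lemma path_edges_glue:
  "xs \<noteq> [] \<Longrightarrow> ys \<noteq> [] \<Longrightarrow> last xs = hd ys \<Longrightarrow>
   path_edges (xs @ tl ys) = path_edges xs \<union> path_edges ys"
  by (cases ys; cases "tl ys") (auto simp: path_edges_append)

lemma path_edges_rev: "path_edges (rev xs) = path_edges xs"
proof (induction xs rule: path_edges.induct)
  case (1 x y zs)
  have "path_edges (rev (y # zs) @ [x]) = path_edges (rev (y # zs)) \<union> {{y, x}}"
    by (subst path_edges_append) auto
  then show ?case using 1 by (auto simp: insert_commute)
qed auto

lemma path_edges_nth: "Suc i < length xs \<Longrightarrow> {xs ! i, xs ! Suc i} \<in> path_edges xs"
proof (induction xs arbitrary: i rule: path_edges.induct)
  case (1 x y zs)
  then show ?case by (cases i) auto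
qed auto

lemma path_edges_take: "path_edges (take k xs) \<subseteq> path_edges xs"
proof (induction xs arbitrary: k rule: path_edges.induct)
  case (1 x y zs)
  show ?case
  proof (cases k)
    case (Suc k')
    then show ?thesis using 1[of k'] by (cases k') auto
  qed simp
qed (auto simp: take_Cons split: nat.splits)

lemma path_edges_drop: "path_edges (drop k xs) \<subseteq> path_edges xs"
proof (cases "k \<le> length xs")
  case True
  then show ?thesis
    using path_edges_take[of "length xs - k" "rev xs"] by (simp add: path_edges_rev take_rev)
qed simp

lemma path_edges_subset_set: "e \<in> path_edges xs \<Longrightarrow> e \<subseteq> set xs"
  by (induction xs rule: path_edges.induct) auto

lemma Union_path_edges: "2 \<le> length xs \<Longrightarrow> \<Union>(path_edges xs) = set xs"
proof (induction xs rule: path_edges.induct)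
  case (1 x y zs)
  then show ?case by (cases zs) auto
qed auto

lemma path_edges_not_ends:
  assumes "distinct xs" "3 \<le> length xs" shows "{hd xs, last xs} \<notin> path_edges xs"
proof -
  obtain x y zs where xs: "xs = x # y # zs" "zs \<noteq> []"
    using assms(2) by (cases xs; cases "tl xs"; cases "tl (tl xs)") auto
  have "{x, last zs} \<noteq> {x, y}" using assms(1) xs by (metis distinct.simps(2) doubleton_eq_iff last_in_set)
  moreover have "{x, last zs} \<notin> path_edges (y # zs)"
    using path_edges_subset_set[of "{x, last zs}" "y # zs"] assms(1) xs by auto
  ultimately show ?thesis using xs by simp
qed

text \<open>A common edge would consist of two shared vertices and hence join the two ends of
  \<open>xs\<close>; a path with at least three distinct vertices has no such edge.\<close>

lemma disjoint_path_edges: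
  assumes "distinct xs" "3 \<le> length xs" "set xs \<inter> set ys \<subseteq> {hd xs, last xs}"
    and "\<forall>e\<in>path_edges xs. card e = 2"
  shows "path_edges xs \<inter> path_edges ys = {}"
proof (rule ccontr)
  assume "\<not> ?thesis"
  then obtain e where e: "e \<in> path_edges xs" "e \<in> path_edges ys" by blast
  then have "e \<subseteq> {hd xs, last xs}" using path_edges_subset_set assms(3) by blast
  moreover have "card e = 2" using assms(4) e by blast
  ultimately have "e = {hd xs, last xs}"
    by (intro card_seteq) (auto simp: card_insert_if)
  then show False using path_edges_not_ends assms(1,2) e by blast
qed

section \<open>Paths and cycles in a plane graph\<close>

locale plane_graph =
  fixes V :: "'a set" and E :: "'a set set" and p :: "'a \<Rightarrow> complex" and \<gamma>
  assumes simple: "simple_graph V E" and emb: "planar_embedding V E p \<gamma>"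
begin

definition img :: "'a set set \<Rightarrow> complex set" where "img A = (\<Union>e\<in>A. path_image (\<gamma> e))"

lemma edge_card: "e \<in> E \<Longrightarrow> card e = 2" and edge_sub: "e \<in> E \<Longrightarrow> e \<subseteq> V"
  using simple by (auto simp: simple_graph_def)

lemma edge_ends: "e \<in> E \<Longrightarrow> p ` e \<subseteq> path_image (\<gamma> e)"
  using emb unfolding planar_embedding_def by blast

text \<open>Translates the intersection conditions on arcs into conditions on vertices: distinct
  edges of an embedding meet only in the points of common vertices.\<close>

lemma img_Int:
  assumes "A \<subseteq> E" "B \<subseteq> E" "A \<inter> B = {}"
  shows "img A \<inter> img B = p ` (\<Union>A \<inter> \<Union>B)"
proof
  show "img A \<inter> img B \<subseteq> p ` (\<Union>A \<inter> \<Union>B)"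
  proof
    fix x assume "x \<in> img A \<inter> img B"
    then obtain e f where ef: "e \<in> A" "f \<in> B" "x \<in> path_image (\<gamma> e) \<inter> path_image (\<gamma> f)"
      by (auto simp: img_def)
    then have "e \<noteq> f" "e \<in> E" "f \<in> E" using assms by auto
    then have "x \<in> p ` (e \<inter> f)" using emb ef(3) unfolding planar_embedding_def by blast
    then show "x \<in> p ` (\<Union>A \<inter> \<Union>B)" using ef by auto
  qed
next
  show "p ` (\<Union>A \<inter> \<Union>B) \<subseteq> img A \<inter> img B"
  proof
    fix x assume "x \<in> p ` (\<Union>A \<inter> \<Union>B)"
    then obtain v e f where v: "x = p v" "e \<in> A" "v \<in> e" "f \<in> B" "v \<in> f" by auto
    then have "p v \<in> path_image (\<gamma> e)" "p v \<in> path_image (\<gamma> f)"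
      using edge_ends[of e] edge_ends[of f] assms(1,2) by auto
    then show "x \<in> img A \<inter> img B" using v unfolding img_def by auto
  qed
qed

lemma img_Un: "img (A \<union> B) = img A \<union> img B" by (auto simp: img_def)

lemma edge_arc:
  assumes "{x, y} \<in> E" shows "arc_between (path_image (\<gamma> {x, y})) (p x) (p y)"
proof -
  have "arc (\<gamma> {x, y})" "{pathstart (\<gamma> {x, y}), pathfinish (\<gamma> {x, y})} = {p x, p y}"
    using emb assms unfolding planar_embedding_def by auto
  then show ?thesis
    by (metis arc_between_def arc_between_sym doubleton_eq_iff)
qed

lemma path_arc:
  assumes "distinct xs" "2 \<le> length xs" "path_edges xs \<subseteq> E"
  shows "arc_between (img (path_edges xs)) (p (hd xs)) (p (last xs))"
  using assms
proof (induction xs rule: path_edges.induct)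
  case (1 x y zs)
  show ?case
  proof (cases "zs = []")
    case True
    then show ?thesis using edge_arc[of x y] 1(4) by (simp add: img_def)
  next
    case False
    have IH: "arc_between (img (path_edges (y # zs))) (p y) (p (last zs))"
      using 1 False by (cases zs) auto
    have e: "arc_between (img {{x, y}}) (p x) (p y)" using edge_arc[of x y] 1(4) by (simp add: img_def)
    have "{x, y} \<notin> path_edges (y # zs)" using path_edges_subset_set[of "{x,y}" "y # zs"] 1(2) by auto
    then have "img {{x, y}} \<inter> img (path_edges (y # zs)) = p ` (\<Union>{{x, y}} \<inter> \<Union>(path_edges (y # zs)))"
      using 1(4) by (intro img_Int) auto
    also have "\<Union>(path_edges (y # zs)) = set (y # zs)"
      using False by (intro Union_path_edges) (cases zs, auto)
    also have "p ` (\<Union>{{x, y}} \<inter> set (y # zs)) = {p y}" using 1(2) by auto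
    finally show ?thesis
      using arc_between_join[OF e IH] False by (simp add: img_Un[symmetric])
  qed
qed auto

lemma img_path_Int:
  assumes "path_edges xs \<subseteq> E" "path_edges ys \<subseteq> E" "2 \<le> length xs" "2 \<le> length ys"
    "distinct xs" "3 \<le> length xs" "set xs \<inter> set ys = {hd xs, last xs}"
  shows "img (path_edges xs) \<inter> img (path_edges ys) = {p (hd xs), p (last xs)}"
proof -
  have "path_edges xs \<inter> path_edges ys = {}"
    using assms edge_card by (intro disjoint_path_edges) auto
  then have "img (path_edges xs) \<inter> img (path_edges ys) = p ` (set xs \<inter> set ys)"
    using img_Int[OF assms(1,2)] assms(3,4) by (simp add: Union_path_edges)
  then show ?thesis using assms(7) by simp
qed

text \<open>The cycle consists of \<open>as\<close>, the edge \<open>{b, c}\<close>,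
  \<open>cs\<close>, and \<open>es\<close> back to \<open>a\<close>. Here \<open>es\<close> shares
  its ends with \<open>cs\<close> and \<open>as\<close>, so that it may be a single edge, whereas
  \<open>as\<close> and \<open>cs\<close> are disjoint.\<close>

lemma no_crossing_chords_of_cycle:
  assumes outer: "p ` V \<subseteq> frontier (outside (drawing V E p \<gamma>))"
    and as: "2 \<le> length as" "hd as = a" "last as = b"
    and cs: "2 \<le> length cs" "hd cs = c" "last cs = d"
    and es: "2 \<le> length es" "hd es = d" "last es = a"
    and dist: "distinct (butlast es @ as)" "distinct (cs @ tl es)" "set as \<inter> set cs = {}"
    and E: "path_edges as \<subseteq> E" "path_edges cs \<subseteq> E" "path_edges es \<subseteq> E" "{b, c} \<in> E"
    and chords: "{a, c} \<in> E" "{b, d} \<in> E"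
  shows False
proof -
  have ne: "as \<noteq> []" "cs \<noteq> []" "es \<noteq> []" using as cs es by auto
  obtain as' where as': "as = a # as'" "as' \<noteq> []" using as by (cases as; cases "tl as") auto
  obtain cs' where cs': "cs = c # cs'" "cs' \<noteq> []" using cs by (cases cs; cases "tl cs") auto
  obtain es' where es': "es = d # es'" "es' \<noteq> []" using es by (cases es; cases "tl es") auto
  obtain es'' where es'': "es = es'' @ [a]" "es'' \<noteq> []" using es ne
    by (cases es rule: rev_cases) (auto simp: Suc_le_eq)
  have m: "a \<in> set as" "b \<in> set as" "c \<in> set cs" "d \<in> set cs" "a \<in> set es" "d \<in> set es"
    using as cs es ne by (metis hd_in_set last_in_set)+
  have das: "distinct as" "distinct cs" "distinct es" "set es'' \<inter> set as = {}" "set cs \<inter> set es' = {}"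
  proof -
    have "butlast es = es''" unfolding es''(1) by simp
    have "tl es = es'" using es' by simp
    note this \<open>butlast es = es''\<close>
    then show "distinct as" "distinct cs" "set es'' \<inter> set as = {}" "set cs \<inter> set es' = {}"
      using dist(1,2) by auto
    show "distinct es" using dist es' \<open>butlast es = es''\<close> \<open>tl es = es'\<close> m(4) by auto
  qed
  have ab: "a \<noteq> b" using as' as das by (metis distinct.simps(2) last_ConsR last_in_set)
  have cd: "c \<noteq> d" using cs' cs das by (metis distinct.simps(2) last_ConsR last_in_set)
  have acd: "a \<noteq> c" "a \<noteq> d" "b \<noteq> c" "b \<noteq> d" using m dist(3) by auto
  have es_as: "set es \<inter> set as = {a}" using es'' das m by auto
  have es_cs: "set es \<inter> set cs = {d}" using es' das m by auto
  \<comment> \<open>\<open>J1\<close>, \<open>J2\<close> are the halves of the cycle between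
    \<open>a\<close> and \<open>c\<close>, and \<open>K1\<close>, \<open>K2\<close> those between
    \<open>b\<close> and \<open>d\<close>. The vertex that \<open>es\<close> shares with the
    adjoining list is dropped once.\<close>
  define J1 where "J1 = as @ [c]"
  define J2 where "J2 = cs @ tl es"
  define K1 where "K1 = b # cs"
  define K2 where "K2 = butlast es @ as"
  have eJ1: "path_edges J1 = path_edges as \<union> {{b, c}}"
    using path_edges_append[of as "[c]"] as ne by (simp add: J1_def)
  have eJ2: "path_edges J2 = path_edges cs \<union> path_edges es"
    using path_edges_glue[of cs es] ne cs es by (simp add: J2_def)
  have eK1: "path_edges K1 = {{b, c}} \<union> path_edges cs"
    using path_edges_append[of "[b]" cs] cs ne by (simp add: K1_def)
  have eK2: "path_edges K2 = path_edges es \<union> path_edges as"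
    using path_edges_glue[of es as] ne as es es'' as' by (simp add: K2_def)
  have dJ: "distinct J1" "distinct J2" "distinct K1" "distinct K2"
    using dist das m unfolding J1_def J2_def K1_def K2_def by auto
  have lJ: "3 \<le> length J1" "3 \<le> length J2" "3 \<le> length K1" "3 \<le> length K2"
    using as cs es unfolding J1_def J2_def K1_def K2_def by auto
  have hJ: "hd J1 = a" "last J1 = c" "hd J2 = c" "last J2 = a" "hd K1 = b" "last K1 = d" "hd K2 = d" "last K2 = b"
    using as cs es as' cs' es' es'' unfolding J1_def J2_def K1_def K2_def by auto
  have EJ: "path_edges J1 \<subseteq> E" "path_edges J2 \<subseteq> E" "path_edges K1 \<subseteq> E" "path_edges K2 \<subseteq> E"
    "path_edges [a, c] \<subseteq> E" "path_edges [b, d] \<subseteq> E"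
    using E chords eJ1 eJ2 eK1 eK2 by auto
  have se: "set es = insert d (set es')" "set es = insert a (set es'')"
    "butlast es = es''" "tl es = es'"
    subgoal using es'(1) by simp
    subgoal by (simp add: es''(1))
    subgoal by (simp add: es''(1))
    subgoal using es'(1) by simp
    done
  have sJ: "set J1 = insert c (set as)" "set J2 = set cs \<union> set es" "set K1 = insert b (set cs)"
    by (use m se(1) in \<open>auto simp: J1_def J2_def K1_def se(4)\<close>)
  have sK2: "set K2 = set es \<union> set as"
    using m by (auto simp: K2_def se(2,3))
  note sJ = sJ sK2
  have arcs: "arc_between (img (path_edges J1)) (p a) (p c)" "arc_between (img (path_edges J2)) (p a) (p c)"
     "arc_between (img (path_edges K1)) (p b) (p d)" "arc_between (img (path_edges K2)) (p b) (p d)"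
     "arc_between (img (path_edges [a, c])) (p a) (p c)" "arc_between (img (path_edges [b, d])) (p b) (p d)"
    using path_arc[OF dJ(1) _ EJ(1)] path_arc[OF dJ(2) _ EJ(2), THEN arc_between_sym]
      path_arc[OF dJ(3) _ EJ(3)] path_arc[OF dJ(4) _ EJ(4), THEN arc_between_sym]
      path_arc[OF _ _ EJ(5)] path_arc[OF _ _ EJ(6)] lJ acd unfolding hJ by auto
  have ints: "set J1 \<inter> set J2 = {a, c}" "set J1 \<inter> set [a, c] = {a, c}" "set J2 \<inter> set [a, c] = {c, a}"
    "set K1 \<inter> set K2 = {b, d}" "set K1 \<inter> set [b, d] = {b, d}" "set K2 \<inter> set [b, d] = {d, b}"
    using dist(3) m es_as es_cs unfolding sJ by auto
  have l2: "2 \<le> length J1" "2 \<le> length J2" "2 \<le> length K1" "2 \<le> length K2"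
    "2 \<le> length [a, c]" "2 \<le> length [b, d]" using lJ by auto
  have I: "img (path_edges J1) \<inter> img (path_edges J2) = {p a, p c}"
     "img (path_edges J1) \<inter> img (path_edges [a, c]) = {p a, p c}"
     "img (path_edges J2) \<inter> img (path_edges [a, c]) = {p a, p c}"
     "img (path_edges K1) \<inter> img (path_edges K2) = {p b, p d}"
     "img (path_edges K1) \<inter> img (path_edges [b, d]) = {p b, p d}"
     "img (path_edges K2) \<inter> img (path_edges [b, d]) = {p b, p d}"
    using img_path_Int[OF EJ(1,2) l2(1,2) dJ(1) lJ(1)] img_path_Int[OF EJ(1,5) l2(1,5) dJ(1) lJ(1)]
      img_path_Int[OF EJ(2,5) l2(2,5) dJ(2) lJ(2)] img_path_Int[OF EJ(3,4) l2(3,4) dJ(3) lJ(3)]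
      img_path_Int[OF EJ(3,6) l2(3,6) dJ(3) lJ(3)] img_path_Int[OF EJ(4,6) l2(4,6) dJ(4) lJ(4)]
    unfolding hJ ints by (simp_all only: insert_commute simp_thms)
  have AB: "img (path_edges [a, c]) \<inter> img (path_edges [b, d]) = {}"
  proof -
    have "path_edges [a, c] \<inter> path_edges [b, d] = {}" using ab acd by (auto simp: doubleton_eq_iff)
    from img_Int[OF EJ(5,6) this] show ?thesis using ab acd cd by auto
  qed
  have JK: "img (path_edges J1) \<union> img (path_edges J2) = img (path_edges K1) \<union> img (path_edges K2)"
    unfolding eJ1 eJ2 eK1 eK2 img_Un by blast
  have injp: "inj_on p V" using emb by (simp add: planar_embedding_def)
  have V: "a \<in> V" "b \<in> V" "c \<in> V" "d \<in> V" using chords edge_sub by auto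
  have pin: "p x \<in> img (path_edges xs)" if x: "x \<in> set xs" "2 \<le> length xs" "path_edges xs \<subseteq> E" for x xs
  proof -
    obtain e where "e \<in> path_edges xs" "x \<in> e" using Union_path_edges[OF x(2)] x(1) by blast
    then show ?thesis using edge_ends x(3) unfolding img_def by blast
  qed
  show False
  proof (rule no_crossing_chords[OF arcs I JK AB, where D = "drawing V E p \<gamma>"])
    show "p b \<in> img (path_edges J1)" "p d \<in> img (path_edges J2)"
      "p c \<in> img (path_edges K1)" "p a \<in> img (path_edges K2)"
      using m by (intro pin EJ l2; simp add: sJ)+
    show "p b \<notin> {p a, p c}" "p d \<notin> {p a, p c}"
      using injp V ab cd acd by (auto simp: inj_on_def)
    show "img (path_edges J1) \<union> img (path_edges J2) \<union> img (path_edges [a, c]) \<union> img (path_edges [b, d])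
       \<subseteq> drawing V E p \<gamma>"
      using EJ unfolding img_def drawing_def by blast
    show "{p a, p b, p c, p d} \<subseteq> frontier (outside (drawing V E p \<gamma>))" using outer V by auto
  qed
qed

end

lemma path_edges_map_upt:
  assumes "\<And>t. u \<le> t \<Longrightarrow> Suc t < w \<Longrightarrow> {f t, f (Suc t)} \<in> E"
  shows "path_edges (map f [u..<w]) \<subseteq> E"
  using assms
proof (induction w)
  case (Suc w)
  have IH: "path_edges (map f [u..<w]) \<subseteq> E" using Suc by auto
  show ?case
  proof (cases "u < w")
    case True
    then have "path_edges (map f [u..<w] @ [f w]) = path_edges (map f [u..<w]) \<union> {{f (w - 1), f w}}"
      by (subst path_edges_append) (auto simp: last_map)
    moreover have "{f (w - 1), f w} \<in> E" using Suc.prems[of "w - 1"] True by simp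
    ultimately show ?thesis using IH True by simp
  next
    case False
    then show ?thesis by (cases "u = w") auto
  qed
qed auto

text \<open>The edge between positions \<open>0\<close> and \<open>j\<close> closes an initial
  segment of the path to a cycle. Since \<open>0 < i - 1 < i < l\<close>, the chords
  \<open>0\<close>, \<open>i\<close> and \<open>i - 1\<close>, \<open>l\<close> cross on it. For
  \<open>l = j\<close> the part of the cycle behind \<open>l\<close> is the closing edge
  alone.\<close>

lemma (in plane_graph) no_crossing_chords_of_path:
  assumes outer: "p ` V \<subseteq> frontier (outside (drawing V E p \<gamma>))"
    and xs: "distinct xs" "path_edges xs \<subseteq> E"
    and idx: "2 \<le> i" "i < l" "l \<le> j" "j < length xs"
    and ch: "{xs ! 0, xs ! i} \<in> E" "{xs ! 0, xs ! j} \<in> E" "{xs ! (i - 1), xs ! l} \<in> E"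
  shows False
proof -
  let ?f = "(!) xs"
  have step: "{?f t, ?f (Suc t)} \<in> E" if "Suc t < length xs" for t
    using path_edges_nth[OF that] xs(2) by blast
  have inj: "?f s = ?f t \<longleftrightarrow> s = t" if "s < length xs" "t < length xs" for s t
    using nth_eq_iff_index_eq[OF xs(1)] that by blast
  have inj0: "?f 0 = ?f t \<longleftrightarrow> t = 0" "?f t = ?f 0 \<longleftrightarrow> t = 0" if "t < length xs" for t
    using inj[of 0 t] inj[of t 0] that by (cases xs; auto)+
  have seg: "path_edges (map ?f [u..<w]) \<subseteq> E" if "w \<le> length xs" for u w
    using that step by (intro path_edges_map_upt) auto
  define as where "as = map ?f [0..<i]"
  define cs where "cs = map ?f [i..<Suc l]"
  define es where "es = map ?f [l..<Suc j] @ [?f 0]"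
  show False
  proof (rule no_crossing_chords_of_cycle[OF outer])
    show "2 \<le> length as" "2 \<le> length cs" "2 \<le> length es"
      using idx by (auto simp: as_def cs_def es_def)
    show "hd as = ?f 0" "hd cs = ?f i" "hd es = ?f l" "last as = ?f (i - 1)" "last cs = ?f l" "last es = ?f 0"
      using idx by (auto simp: as_def cs_def es_def hd_map last_map hd_append)
    show "path_edges as \<subseteq> E" "path_edges cs \<subseteq> E"
      unfolding as_def cs_def using idx by (intro seg; simp)+
    have "path_edges es = path_edges (map ?f [l..<Suc j]) \<union> {{?f j, ?f 0}}"
      unfolding es_def using idx by (subst path_edges_append) (auto simp: last_map)
    then show "path_edges es \<subseteq> E" using seg[of "Suc j" l] idx ch(2) by (auto simp: insert_commute)
    show "{?f (i - 1), ?f i} \<in> E" using step[of "i - 1"] idx by simp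
    show "{?f 0, ?f i} \<in> E" "{?f (i - 1), ?f l} \<in> E" by fact+
    have "butlast es = map ?f [l..<Suc j]" by (simp add: es_def)
    then show "distinct (butlast es @ as)"
      using idx inj by (auto simp: as_def distinct_map inj_on_def)
    have "tl es = map ?f [Suc l..<Suc j] @ [?f 0]"
      using idx by (simp add: es_def upt_rec[of l])
    then show "distinct (cs @ tl es)"
      using idx inj by (auto simp: cs_def distinct_map inj_on_def inj0)
    show "set as \<inter> set cs = {}"
      using idx inj by (auto simp: as_def cs_def)
  qed
qed

text \<open>A rotation argument for longest paths. All neighbours of the first vertex lie on the
  path, so degree three gives two chords at this vertex. With the shortest chord over all longest
  paths fixed, the path and its rotation at this chord both have a further, longer chord; together
  these cross.\<close>

lemma outerplanar_degree_le_2: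
  assumes "outerplanar V E" "V \<noteq> {}"
  shows "\<exists>v\<in>V. card {u. {v, u} \<in> E} \<le> 2"
proof (rule ccontr)
  assume "\<not> ?thesis"
  then have deg: "card {u. {v, u} \<in> E} \<ge> 3" if "v \<in> V" for v using that by force
  obtain p \<gamma> where "planar_embedding V E p \<gamma>" and outer: "p ` V \<subseteq> frontier (outside (drawing V E p \<gamma>))"
    and simple: "simple_graph V E" using assms(1) unfolding outerplanar_def by blast
  then interpret plane_graph V E p \<gamma> by unfold_locales
  have fin: "finite V" using simple by (simp add: simple_graph_def)
  define gp where "gp xs \<longleftrightarrow> distinct xs \<and> xs \<noteq> [] \<and> set xs \<subseteq> V \<and> path_edges xs \<subseteq> E" for xs
  obtain v0 where "v0 \<in> V" using assms(2) by blast
  then have "gp [v0]" by (simp add: gp_def)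
  moreover have "\<forall>xs. gp xs \<longrightarrow> length xs < Suc (card V)"
    using fin by (auto simp: gp_def less_Suc_eq_le distinct_card[symmetric] intro: card_mono)
  ultimately obtain xs0 where xs0: "gp xs0" "\<forall>ys. gp ys \<longrightarrow> length ys \<le> length xs0"
    using ex_has_greatest_nat[of gp _ length] by blast
  define longest where "longest xs \<longleftrightarrow> gp xs \<and> length xs = length xs0" for xs
  \<comment> \<open>Positions 1 and \<open>i\<close> account for at most two neighbours, so another
    one remains. It lies on the path, which could be prolonged otherwise, and not at position 0,
    since edges have two elements.\<close>
  have third: "\<exists>t. 2 \<le> t \<and> t < length xs \<and> t \<noteq> i \<and> {xs ! 0, xs ! t} \<in> E" if xs: "longest xs" for xs i
  proof -
    have gp: "gp xs" and len: "length xs = length xs0" using xs by (auto simp: longest_def)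
    then have ne: "xs \<noteq> []" and hd: "xs ! 0 = hd xs" by (auto simp: gp_def hd_conv_nth)
    then have hdV: "xs ! 0 \<in> V" using gp by (auto simp: gp_def)
    have "\<not> {u. {xs ! 0, u} \<in> E} \<subseteq> {xs ! 1, xs ! i}"
    proof
      assume "{u. {xs ! 0, u} \<in> E} \<subseteq> {xs ! 1, xs ! i}"
      then have "card {u. {xs ! 0, u} \<in> E} \<le> card {xs ! 1, xs ! i}" by (intro card_mono) auto
      also have "\<dots> \<le> 2" by (simp add: card_insert_if)
      finally show False using deg[OF hdV] by simp
    qed
    then obtain u where u: "{xs ! 0, u} \<in> E" "u \<noteq> xs ! 1" "u \<noteq> xs ! i" by blast
    have "u \<in> set xs"
    proof (rule ccontr)
      assume "u \<notin> set xs"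
      moreover have "u \<in> V" using u(1) edge_sub by blast
      moreover have "path_edges (u # xs) \<subseteq> E"
        using gp u(1) ne hd by (cases xs) (auto simp: gp_def insert_commute)
      ultimately have "gp (u # xs)" using gp by (auto simp: gp_def)
      then show False using xs0(2) len by fastforce
    qed
    then obtain t where t: "t < length xs" "u = xs ! t" by (metis in_set_conv_nth)
    have "t \<noteq> 0" using edge_card[OF u(1)] t by (metis card_1_singleton_iff insert_absorb2 numeral_eq_one_iff semiring_norm(85) One_nat_def)
    then show ?thesis using t u by (intro exI[of _ t]) (auto simp: numeral_2_eq_2 Suc_le_eq intro: Suc_lessI)
  qed
  define Q where "Q i \<longleftrightarrow> 2 \<le> i \<and> (\<exists>xs. longest xs \<and> i < length xs \<and> {xs ! 0, xs ! i} \<in> E)" for i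
  have "longest xs0" using xs0 by (simp add: longest_def)
  from third[OF this] have "\<exists>i. Q i" using \<open>longest xs0\<close> unfolding Q_def by blast
  define i where "i = (LEAST i. Q i)"
  have Qi: "Q i" unfolding i_def using \<open>\<exists>i. Q i\<close> by (rule LeastI_ex)
  have Qmin: "i \<le> t" if "Q t" for t unfolding i_def using that by (rule Least_le)
  obtain xs where xs: "longest xs" "i < length xs" "{xs ! 0, xs ! i} \<in> E" and i2: "2 \<le> i"
    using Qi unfolding Q_def by blast
  obtain j where j: "2 \<le> j" "j < length xs" "j \<noteq> i" "{xs ! 0, xs ! j} \<in> E" using third[OF xs(1)] by blast
  then have ij: "i < j" using Qmin[of j] xs(1) unfolding Q_def by force
  \<comment> \<open>Rotation: the chord from \<open>xs ! 0\<close> to \<open>xs ! i\<close> replaces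
    the edge from \<open>xs ! (i - 1)\<close> to \<open>xs ! i\<close>. Positions from
    \<open>i\<close> on keep their vertices.\<close>
  define ys where "ys = rev (take i xs) @ drop i xs"
  have gx: "distinct xs" "xs \<noteq> []" "set xs \<subseteq> V" "path_edges xs \<subseteq> E" using xs(1) by (auto simp: longest_def gp_def)
  have ly: "length ys = length xs" using xs(2) by (simp add: ys_def)
  have "set ys = set xs" unfolding ys_def by (metis append_take_drop_id set_append set_rev)
  moreover have "distinct ys"
    unfolding ys_def using gx(1) by (simp add: set_take_disj_set_drop_if_distinct)
  moreover have "path_edges ys \<subseteq> E"
  proof -
    have "last (rev (take i xs)) = xs ! 0" using i2 gx(2) by (simp add: last_rev hd_conv_nth)
    moreover have "hd (drop i xs) = xs ! i" using xs(2) by (simp add: hd_drop_conv_nth)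
    ultimately have "path_edges ys = path_edges (take i xs) \<union> {{xs ! 0, xs ! i}} \<union> path_edges (drop i xs)"
      unfolding ys_def using xs(2) i2 gx(2) by (subst path_edges_append) (auto simp: path_edges_rev)
    then show ?thesis using path_edges_take[of i xs] path_edges_drop[of i xs] gx(4) xs(3) by blast
  qed
  ultimately have gy: "longest ys" "distinct ys" "path_edges ys \<subseteq> E"
    using xs(1) ly gx(2) by (auto simp: longest_def gp_def)
  have y1: "ys ! t = xs ! (i - 1 - t)" if "t < i" for t
    using that xs(2) by (simp add: ys_def nth_append rev_nth)
  have y2: "ys ! t = xs ! t" if "i \<le> t" for t
    using that xs(2) by (simp add: ys_def nth_append)
  obtain l where l: "2 \<le> l" "l < length ys" "l \<noteq> i" "{ys ! 0, ys ! l} \<in> E" using third[OF gy(1)] by blast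
  then have il: "i < l" using Qmin[of l] gy(1) unfolding Q_def by force
  have e0: "ys ! 0 = xs ! (i - 1)" "ys ! (i - 1) = xs ! 0" using y1[of 0] y1[of "i - 1"] i2 by auto
  have eb: "{xs ! (i - 1), xs ! i} \<in> E" using path_edges_nth[of "i - 1" xs] gx(4) xs(2) i2 by auto
  \<comment> \<open>The larger of \<open>l\<close> and \<open>j\<close> closes the cycle. For
    \<open>l \<le> j\<close> the cycle is taken on \<open>xs\<close>; otherwise it is taken on
    \<open>ys\<close>, where the replaced edge \<open>{xs ! (i - 1), xs ! i}\<close> serves as a
    chord.\<close>
  show False
  proof (cases "l \<le> j")
    case True
    show False
      by (rule no_crossing_chords_of_path[OF outer gx(1,4) i2 il True j(2) xs(3) j(4)])
        (use l(4) e0 y2 il in simp)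
  next
    case False
    show False
      by (rule no_crossing_chords_of_path[OF outer gy(2,3) i2 ij _ l(2) _ l(4)])
        (use False e0 eb y2 ij j in simp_all)
  qed
qed

section \<open>Outerplanarity under deletion and suppression\<close>

lemma outerplanar_from_subdrawing:
  assumes "p ` V \<subseteq> frontier (outside (drawing V E p \<gamma>))" "V' \<subseteq> V" "simple_graph V' E'"
    "planar_embedding V' E' p \<gamma>'" "drawing V' E' p \<gamma>' \<subseteq> drawing V E p \<gamma>"
  shows "outerplanar V' E'"
proof -
  \<comment> \<open>A smaller drawing has a larger outside, so the points of \<open>V'\<close> stay
    in its closure; being on the drawing, they are not in its interior.\<close>
  have "p ` V' \<subseteq> frontier (outside (drawing V' E' p \<gamma>'))"
  proof
    fix x assume x: "x \<in> p ` V'"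
    then have "x \<in> closure (outside (drawing V E p \<gamma>))" using assms(1,2) by (auto simp: frontier_def)
    then have "x \<in> closure (outside (drawing V' E' p \<gamma>'))"
      using closure_mono[OF outside_mono[OF assms(5)]] by blast
    moreover have "x \<in> drawing V' E' p \<gamma>'" using x by (auto simp: drawing_def)
    then have "x \<notin> outside (drawing V' E' p \<gamma>')"
      using outside_no_overlap[of "drawing V' E' p \<gamma>'"] by blast
    then have "x \<notin> interior (outside (drawing V' E' p \<gamma>'))" using interior_subset by blast
    ultimately show "x \<in> frontier (outside (drawing V' E' p \<gamma>'))" by (simp add: frontier_def)
  qed
  then show ?thesis using assms(3,4) unfolding outerplanar_def by blast
qed

lemma outerplanar_subgraph:
  assumes "outerplanar V E" "V' \<subseteq> V" "E' \<subseteq> E" "\<And>e. e \<in> E' \<Longrightarrow> e \<subseteq> V'"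
  shows "outerplanar V' E'"
proof -
  obtain p \<gamma> where emb: "planar_embedding V E p \<gamma>" and outer: "p ` V \<subseteq> frontier (outside (drawing V E p \<gamma>))"
    and simple: "simple_graph V E" using assms(1) unfolding outerplanar_def by blast
  show ?thesis
  proof (rule outerplanar_from_subdrawing[OF outer assms(2)])
    show "simple_graph V' E'"
      using simple finite_subset[OF assms(2)] assms(4) subsetD[OF assms(3)] unfolding simple_graph_def by simp
    show "drawing V' E' p \<gamma> \<subseteq> drawing V E p \<gamma>"
      unfolding drawing_def by (intro Un_mono image_mono UN_mono assms(2,3)) simp
    show "planar_embedding V' E' p \<gamma>"
      unfolding planar_embedding_def
    proof (intro conjI ballI impI)
      show "inj_on p V'" using emb assms(2) unfolding planar_embedding_def by (blast intro: inj_on_subset)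
      fix e assume e': "e \<in> E'"
      then have e: "e \<in> E" using assms(3) by blast
      show "arc (\<gamma> e)" "{pathstart (\<gamma> e), pathfinish (\<gamma> e)} = p ` e"
        using emb e unfolding planar_embedding_def by blast+
      have "path_image (\<gamma> e) \<inter> p ` V = p ` e" using emb e unfolding planar_embedding_def by blast
      moreover have "p ` e \<subseteq> p ` V'" by (rule image_mono[OF assms(4)[OF e']])
      moreover have "p ` V' \<subseteq> p ` V" by (rule image_mono[OF assms(2)])
      moreover have "A \<inter> C = X" if "A \<inter> B = X" "X \<subseteq> C" "C \<subseteq> B" for A B C X :: "complex set"
        using that by blast
      ultimately show "path_image (\<gamma> e) \<inter> p ` V' = p ` e" by metis
      fix f assume "f \<in> E'" "e \<noteq> f"
      then have "f \<in> E" "e \<noteq> f" using assms(3) by blast+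
      then show "path_image (\<gamma> e) \<inter> path_image (\<gamma> f) = p ` (e \<inter> f)"
        using emb e unfolding planar_embedding_def by blast
    qed
  qed
qed

text \<open>The curves of \<open>{a, v}\<close> and \<open>{v, b}\<close> are joined at
  \<open>v\<close> and draw the edge \<open>{a, b}\<close>. If \<open>{a, b}\<close> is already an
  edge, it keeps its own curve and \<open>v\<close> is merely deleted.\<close>

lemma outerplanar_suppress:
  assumes out: "outerplanar V E" and av: "{a, v} \<in> E" and vb: "{v, b} \<in> E" and "a \<noteq> b"
  shows "outerplanar (V - {v}) (insert {a, b} {e \<in> E. v \<notin> e})"
proof (cases "{a, b} \<in> E")
  case True
  obtain "simple_graph V E" using out unfolding outerplanar_def by blast
  then have "card {a, v} = 2" "card {v, b} = 2" "\<And>e. e \<in> E \<Longrightarrow> e \<subseteq> V" using av vb by (auto simp: simple_graph_def)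
  then have "v \<noteq> a" "v \<noteq> b" "\<And>e. e \<in> E \<Longrightarrow> e \<subseteq> V" by (auto simp: card_insert_if split: if_splits)
  then show ?thesis using True by (intro outerplanar_subgraph[OF out]) auto
next
  case False
  obtain p \<gamma> where emb: "planar_embedding V E p \<gamma>" and outer: "p ` V \<subseteq> frontier (outside (drawing V E p \<gamma>))"
    and simple: "simple_graph V E" using out unfolding outerplanar_def by blast
  then interpret plane_graph V E p \<gamma> by unfold_locales
  have ne: "v \<noteq> a" "v \<noteq> b" using edge_card[OF av] edge_card[OF vb] by (auto simp: card_insert_if split: if_splits)
  have V: "a \<in> V" "b \<in> V" "v \<in> V" using edge_sub[OF av] edge_sub[OF vb] by auto
  have inj: "p x = p y \<longleftrightarrow> x = y" if "x \<in> V" "y \<in> V" for x y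
    using emb that unfolding planar_embedding_def inj_on_def by blast
  have meet: "path_image (\<gamma> e) \<inter> path_image (\<gamma> e') = p ` (e \<inter> e')" if "e \<in> E" "e' \<in> E" "e \<noteq> e'" for e e'
    using emb that unfolding planar_embedding_def by blast
  have meetV: "path_image (\<gamma> e) \<inter> p ` V = p ` e" if "e \<in> E" for e
    using emb that unfolding planar_embedding_def by blast
  have dif: "{a, v} \<noteq> {v, b}" using assms(4) ne by (auto simp: doubleton_eq_iff)
  have "arc_between (path_image (\<gamma> {a, v}) \<union> path_image (\<gamma> {v, b})) (p a) (p b)"
  proof (rule arc_between_join[OF edge_arc[OF av] edge_arc[OF vb]])
    have "{a, v} \<inter> {v, b} = {v}" using assms(4) ne by auto
    then have "p ` ({a, v} \<inter> {v, b}) = {p v}" by (simp only: image_insert image_empty)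
    with meet[OF av vb dif] show "path_image (\<gamma> {a, v}) \<inter> path_image (\<gamma> {v, b}) = {p v}" by (rule trans)
  qed
  then obtain g where g: "arc g" "path_image g = path_image (\<gamma> {a, v}) \<union> path_image (\<gamma> {v, b})"
    "pathstart g = p a" "pathfinish g = p b" unfolding arc_between_def by blast
  define \<gamma>' where "\<gamma>' = \<gamma>({a, b} := g)"
  let ?E = "{e \<in> E. v \<notin> e}"
  have same: "\<gamma>' e = \<gamma> e" if "e \<in> ?E" for e using that False by (auto simp: \<gamma>'_def)
  have new: "\<gamma>' {a, b} = g" by (simp add: \<gamma>'_def)
  have gV: "path_image g \<inter> p ` (V - {v}) = p ` {a, b}"
  proof -
    have "path_image g \<inter> p ` V = p ` {a, v, b}" using meetV[OF av] meetV[OF vb] g(2) by auto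
    moreover have "p ` (V - {v}) = p ` V - {p v}" using inj V by auto
    moreover have "p ` {a, v, b} - {p v} = p ` {a, b}" using inj V ne by auto
    ultimately show ?thesis by (metis Int_Diff)
  qed
  have ge: "path_image g \<inter> path_image (\<gamma> e) = p ` ({a, b} \<inter> e)" if e: "e \<in> ?E" for e
  proof -
    have "path_image (\<gamma> {a, v}) \<inter> path_image (\<gamma> e) = p ` ({a, v} \<inter> e)"
      "path_image (\<gamma> {v, b}) \<inter> path_image (\<gamma> e) = p ` ({v, b} \<inter> e)"
      using e av vb by (intro meet; auto)+
    moreover have "{a, v} \<inter> e \<union> {v, b} \<inter> e = {a, b} \<inter> e" using e by auto
    ultimately show ?thesis unfolding g(2) by (metis Int_Un_distrib2 image_Un)
  qed
  have oldV: "path_image (\<gamma> e) \<inter> p ` (V - {v}) = p ` e" if e: "e \<in> ?E" for e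
  proof -
    have "p ` (V - {v}) = p ` V - {p v}" using inj V by auto
    moreover have "p v \<notin> p ` e" using e inj V edge_sub by auto
    ultimately show ?thesis using meetV[of e] e by (simp add: Int_Diff[symmetric])
  qed
  show ?thesis
  proof (rule outerplanar_from_subdrawing[OF outer])
    show "V - {v} \<subseteq> V" by blast
    show "simple_graph (V - {v}) (insert {a, b} ?E)"
      using simple V ne assms(4) unfolding simple_graph_def by auto
    show "drawing (V - {v}) (insert {a, b} ?E) p \<gamma>' \<subseteq> drawing V E p \<gamma>"
      using same new g(2) av vb unfolding drawing_def by auto
    show "planar_embedding (V - {v}) (insert {a, b} ?E) p \<gamma>'"
      unfolding planar_embedding_def
    proof (intro conjI ballI impI)
      show "inj_on p (V - {v})" using inj by (auto simp: inj_on_def)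
      fix e assume e: "e \<in> insert {a, b} ?E"
      show "arc (\<gamma>' e)" "{pathstart (\<gamma>' e), pathfinish (\<gamma>' e)} = p ` e"
        "path_image (\<gamma>' e) \<inter> p ` (V - {v}) = p ` e"
      proof -
        have "arc (\<gamma> e) \<and> {pathstart (\<gamma> e), pathfinish (\<gamma> e)} = p ` e" if "e \<in> E"
          using emb that unfolding planar_embedding_def by blast
        then show "arc (\<gamma>' e)" "{pathstart (\<gamma>' e), pathfinish (\<gamma>' e)} = p ` e"
          "path_image (\<gamma>' e) \<inter> p ` (V - {v}) = p ` e"
          using e same[of e] new g(1,3,4) gV oldV[of e] by (cases "e = {a, b}"; simp)+
      qed
      fix e' assume e': "e' \<in> insert {a, b} ?E" "e \<noteq> e'"
      show "path_image (\<gamma>' e) \<inter> path_image (\<gamma>' e') = p ` (e \<inter> e')"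
        using e e' same[of e] same[of e'] new ge[of e] ge[of e'] meet[of e e']
        by (cases "e = {a, b}"; cases "e' = {a, b}") (simp_all add: Int_commute)
    qed
  qed
qed

section \<open>Elimination of a vertex with at most two neighbours\<close>

text \<open>The function \<open>s\<close> is not symmetric: \<open>s y z\<close> is the part of the
  weight behind the pair of \<open>y\<close> and \<open>z\<close> that is charged to
  \<open>y\<close>.\<close>

definition vertex_weight :: "nat set \<Rightarrow> (nat \<Rightarrow> nat) \<Rightarrow> (nat \<Rightarrow> nat \<Rightarrow> nat) \<Rightarrow> nat \<Rightarrow> nat" where
  "vertex_weight W u s y = u y + (\<Sum>z\<in>W - {y}. s y z)"

definition class_weight :: "nat set \<Rightarrow> (nat \<Rightarrow> nat) \<Rightarrow> nat \<Rightarrow> (nat \<Rightarrow> nat) \<Rightarrow> nat" where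
  "class_weight W L l w = (\<Sum>y\<in>W. if L y = l then w y else 0)"

type_synonym pair_table = "nat \<Rightarrow> nat \<Rightarrow> nat \<Rightarrow> nat \<Rightarrow> nat \<Rightarrow> nat \<Rightarrow> nat \<Rightarrow> bool"
type_synonym vertex_table = "nat \<Rightarrow> nat \<Rightarrow> nat \<Rightarrow> bool"

text \<open>A row \<open>(c, c', k, s, s')\<close> of the table of the pair \<open>(x, y)\<close> stands for a colouring of the eliminated
  vertices behind this pair: \<open>c\<close>, \<open>c'\<close> are the colours of \<open>x\<close>, \<open>y\<close>, \<open>k \<noteq> 0\<close> means that it connects
  \<open>x\<close> with \<open>y\<close>, and \<open>s\<close>, \<open>s'\<close> count the vertices attached to \<open>x\<close>, \<open>y\<close>. A row \<open>(c, s)\<close> of the table of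
  a vertex counts the vertex itself and those attached to it alone. In a solution, the labelling \<open>L\<close>
  may merge components; this replaces reasoning about connectivity, and loses nothing because the
  components themselves form the finest labelling.\<close>

definition solution ::
  "nat \<Rightarrow> nat set \<Rightarrow> pair_table \<Rightarrow> vertex_table \<Rightarrow> (nat \<Rightarrow> nat) \<Rightarrow> (nat \<Rightarrow> nat) \<Rightarrow>
   (nat \<Rightarrow> nat \<Rightarrow> nat) \<Rightarrow> (nat \<Rightarrow> nat \<Rightarrow> nat) \<Rightarrow> (nat \<Rightarrow> nat) \<Rightarrow> bool" where
  "solution m W T U col u k s L \<longleftrightarrow>
     (\<forall>x\<in>W. U x (col x) (u x)) \<and>
     (\<forall>x\<in>W. \<forall>y\<in>W. x \<noteq> y \<longrightarrow>
        T x y (col x) (col y) (k x y) (s x y) (s y x) \<and> (k x y \<noteq> 0 \<longrightarrow> L x = L y)) \<and>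
     (\<forall>l. class_weight W L l (vertex_weight W u s) \<le> m)"

definition feasible :: "nat \<Rightarrow> nat set \<Rightarrow> pair_table \<Rightarrow> vertex_table \<Rightarrow> bool" where
  "feasible m W T U \<longleftrightarrow> (\<exists>col u k s L. solution m W T U col u k s L)"

text \<open>The table of a pair that carries no edge and behind which nothing has been eliminated.
  It admits all colours below \<open>N\<close>; restrictions on the colour of a single vertex come
  from its vertex table.\<close>

definition trivial_pair :: "nat \<Rightarrow> pair_table \<Rightarrow> nat \<Rightarrow> nat \<Rightarrow> bool" where
  "trivial_pair N T x y \<longleftrightarrow>
     (\<forall>c c' k s s'. T x y c c' k s s' \<longleftrightarrow> c < N \<and> c' < N \<and> k = 0 \<and> s = 0 \<and> s' = 0)"

definition tables_bounded :: "nat \<Rightarrow> pair_table \<Rightarrow> vertex_table \<Rightarrow> bool" where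
  "tables_bounded N T U \<longleftrightarrow>
     (\<forall>x y c c' k s s'. T x y c c' k s s' \<longrightarrow> c < N \<and> c' < N \<and> k < N \<and> s < N \<and> s' < N) \<and>
     (\<forall>x c s. U x c s \<longrightarrow> c < N \<and> s < N)"

definition sym_table :: "pair_table \<Rightarrow> bool" where
  "sym_table T \<longleftrightarrow> (\<forall>x y c c' k s s'. T x y c c' k s s' \<longleftrightarrow> T y x c' c k s' s)"

text \<open>If \<open>v\<close> is not connected to \<open>a\<close>, its component is complete once
  \<open>v\<close> is eliminated. The size \<open>t2 + t\<close> is tested against \<open>m\<close>
  at this moment, since no later table records it.\<close>

definition elim1 :: "nat \<Rightarrow> nat \<Rightarrow> pair_table \<Rightarrow> vertex_table \<Rightarrow> nat \<Rightarrow> nat \<Rightarrow> nat \<Rightarrow> nat \<Rightarrow> bool" where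
  "elim1 N m T U v a c s \<longleftrightarrow> c < N \<and> s < N \<and>
     (\<exists>s1<N. \<exists>d<N. \<exists>t<N. \<exists>k2<N. \<exists>s2<N. \<exists>t2<N.
        U a c s1 \<and> U v d t \<and> T a v c d k2 s2 t2 \<and>
        (k2 \<noteq> 0 \<longrightarrow> s = s1 + s2 + t2 + t) \<and>
        (k2 = 0 \<longrightarrow> s = s1 + s2 \<and> t2 + t \<le> m))"

text \<open>If both \<open>k2\<close> and \<open>k3\<close> are nonzero, \<open>x\<close> and \<open>y\<close> become connected and the weight may be split
  between them in any way; admitting every split keeps the tables symmetric.\<close>

definition elim2 :: "nat \<Rightarrow> nat \<Rightarrow> pair_table \<Rightarrow> vertex_table \<Rightarrow> nat \<Rightarrow> pair_table" where
  "elim2 N m T U v x y c c' k s s' \<longleftrightarrow> c < N \<and> c' < N \<and> k < N \<and> s < N \<and> s' < N \<and>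
     (\<exists>k1<N. \<exists>s1<N. \<exists>s1'<N. \<exists>d<N. \<exists>t<N. \<exists>k2<N. \<exists>s2<N. \<exists>t2<N. \<exists>k3<N. \<exists>s3<N. \<exists>t3<N.
        T x y c c' k1 s1 s1' \<and> U v d t \<and> T x v c d k2 s2 t2 \<and> T y v c' d k3 s3 t3 \<and>
        (k \<noteq> 0 \<longleftrightarrow> k1 \<noteq> 0 \<or> k2 \<noteq> 0 \<and> k3 \<noteq> 0) \<and>
        (k2 \<noteq> 0 \<and> k3 \<noteq> 0 \<longrightarrow> s + s' = s1 + s2 + s1' + s3 + t2 + t3 + t) \<and>
        (k2 \<noteq> 0 \<and> k3 = 0 \<longrightarrow> s = s1 + s2 + t2 + t3 + t \<and> s' = s1' + s3) \<and>
        (k2 = 0 \<and> k3 \<noteq> 0 \<longrightarrow> s = s1 + s2 \<and> s' = s1' + s3 + t2 + t3 + t) \<and>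
        (k2 = 0 \<and> k3 = 0 \<longrightarrow> s = s1 + s2 \<and> s' = s1' + s3 \<and> t2 + t3 + t \<le> m))"

definition update1 :: "nat \<Rightarrow> nat \<Rightarrow> pair_table \<Rightarrow> vertex_table \<Rightarrow> nat \<Rightarrow> nat \<Rightarrow> vertex_table" where
  "update1 N m T U v a x c s \<longleftrightarrow> (if x = a then elim1 N m T U v a c s else U x c s)"

definition update2 :: "nat \<Rightarrow> nat \<Rightarrow> pair_table \<Rightarrow> vertex_table \<Rightarrow> nat \<Rightarrow> nat \<Rightarrow> nat \<Rightarrow> pair_table" where
  "update2 N m T U v a b x y c c' k s s' \<longleftrightarrow>
     (if x = a \<and> y = b \<or> x = b \<and> y = a then elim2 N m T U v x y c c' k s s'
      else T x y c c' k s s')"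

lemma elim1I:
  assumes bd: "tables_bounded N T U" and t: "U a c s1" "U v d t" "T a v c d k2 s2 t2" and s: "s < N"
    and e: "k2 \<noteq> 0 \<longrightarrow> s = s1 + s2 + t2 + t" "k2 = 0 \<longrightarrow> s = s1 + s2 \<and> t2 + t \<le> m"
  shows "elim1 N m T U v a c s"
proof -
  have b: "c < N" "s1 < N" "d < N" "t < N" "k2 < N" "s2 < N" "t2 < N"
    using bd t unfolding tables_bounded_def by blast+
  show ?thesis unfolding elim1_def
    by (rule conjI, fact, rule conjI, fact,
        rule exI[of _ s1], rule conjI, fact,
        rule exI[of _ d], rule conjI, fact,
        rule exI[of _ t], rule conjI, fact,
        rule exI[of _ k2], rule conjI, fact,
        rule exI[of _ s2], rule conjI, fact,
        rule exI[of _ t2], rule conjI, fact,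
        intro conjI t e)
qed

lemma elim2I:
  assumes bd: "tables_bounded N T U"
    and t: "T x y c c' k1 s1 s1'" "U v d t" "T x v c d k2 s2 t2" "T y v c' d k3 s3 t3"
    and s: "k < N" "s < N" "s' < N"
    and e: "k \<noteq> 0 \<longleftrightarrow> k1 \<noteq> 0 \<or> k2 \<noteq> 0 \<and> k3 \<noteq> 0"
      "k2 \<noteq> 0 \<and> k3 \<noteq> 0 \<longrightarrow> s + s' = s1 + s2 + s1' + s3 + t2 + t3 + t"
      "k2 \<noteq> 0 \<and> k3 = 0 \<longrightarrow> s = s1 + s2 + t2 + t3 + t \<and> s' = s1' + s3"
      "k2 = 0 \<and> k3 \<noteq> 0 \<longrightarrow> s = s1 + s2 \<and> s' = s1' + s3 + t2 + t3 + t"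
      "k2 = 0 \<and> k3 = 0 \<longrightarrow> s = s1 + s2 \<and> s' = s1' + s3 \<and> t2 + t3 + t \<le> m"
  shows "elim2 N m T U v x y c c' k s s'"
proof -
  have b: "c < N" "c' < N" "k1 < N" "s1 < N" "s1' < N" using bd t(1) unfolding tables_bounded_def by blast+
  have b': "d < N" "t < N" using bd t(2) unfolding tables_bounded_def by blast+
  have b2: "k2 < N" "s2 < N" "t2 < N" using bd t(3) unfolding tables_bounded_def by blast+
  have b3: "k3 < N" "s3 < N" "t3 < N" using bd t(4) unfolding tables_bounded_def by blast+
  show ?thesis unfolding elim2_def
    by (rule conjI, fact, rule conjI, fact, rule conjI, fact, rule conjI, fact, rule conjI, fact,
        rule exI[of _ k1], rule conjI, fact,
        rule exI[of _ s1], rule conjI, fact,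
        rule exI[of _ s1'], rule conjI, fact,
        rule exI[of _ d], rule conjI, fact,
        rule exI[of _ t], rule conjI, fact,
        rule exI[of _ k2], rule conjI, fact,
        rule exI[of _ s2], rule conjI, fact,
        rule exI[of _ t2], rule conjI, fact,
        rule exI[of _ k3], rule conjI, fact,
        rule exI[of _ s3], rule conjI, fact,
        rule exI[of _ t3], rule conjI, fact,
        intro conjI t e)
qed

lemma class_weight_remove:
  "finite W \<Longrightarrow> v \<in> W \<Longrightarrow>
   class_weight W L l w = (if L v = l then w v else 0) + class_weight (W - {v}) L l w"
  unfolding class_weight_def by (rule sum.remove)

lemma class_weight_cong:
  "(\<And>y. y \<in> W \<Longrightarrow> w y = w' y \<and> L y = L' y) \<Longrightarrow> class_weight W L l w = class_weight W L' l w'"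
  unfolding class_weight_def by (rule sum.cong) auto

lemma weight_le_class_weight:
  "finite W \<Longrightarrow> y \<in> W \<Longrightarrow> w y \<le> class_weight W L (L y) w"
  by (subst class_weight_remove) auto

lemma vertex_weight_remove:
  assumes "finite W" "v \<in> W" "y \<noteq> v"
  shows "vertex_weight W u s y = s y v + vertex_weight (W - {v}) u s y"
proof -
  have "(\<Sum>z\<in>W - {y}. s y z) = s y v + (\<Sum>z\<in>W - {y} - {v}. s y z)"
    using assms by (intro sum.remove) auto
  moreover have "W - {y} - {v} = W - {v} - {y}" by auto
  ultimately show ?thesis by (simp add: vertex_weight_def)
qed

lemma vertex_weight_cong:
  "u y = u' y \<Longrightarrow> (\<And>z. z \<in> W \<Longrightarrow> z \<noteq> y \<Longrightarrow> s y z = s' y z) \<Longrightarrow> vertex_weight W u s y = vertex_weight W u' s' y"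
  unfolding vertex_weight_def by (auto intro!: sum.cong)

text \<open>From left to right the labelling is kept, and the weight of \<open>v\<close> moves to
  \<open>a\<close> if the two are connected. From right to left the new row of \<open>a\<close>
  yields the data of \<open>v\<close>, which gets the label of \<open>a\<close> or a fresh
  one.\<close>

lemma feasible_elim1:
  assumes fin: "finite W" and v: "v \<in> W" and a: "a \<in> W" "a \<noteq> v"
    and sym: "sym_table T" and bd: "tables_bounded N T U" and mN: "m < N"
    and triv: "\<And>x. x \<in> W \<Longrightarrow> x \<noteq> v \<Longrightarrow> x \<noteq> a \<Longrightarrow> trivial_pair N T v x"
  shows "feasible m W T U \<longleftrightarrow> feasible m (W - {v}) T (update1 N m T U v a)"
proof
  let ?W = "W - {v}"
  assume "feasible m W T U"
  then obtain col u k s L where sol: "solution m W T U col u k s L" unfolding feasible_def by blast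
  have sU: "U x (col x) (u x)" if "x \<in> W" for x using sol that by (simp add: solution_def)
  have sT: "T x y (col x) (col y) (k x y) (s x y) (s y x)" and sL: "k x y \<noteq> 0 \<Longrightarrow> L x = L y"
    if "x \<in> W" "y \<in> W" "x \<noteq> y" for x y using sol that by (simp_all add: solution_def)
  have cw: "class_weight W L l (vertex_weight W u s) \<le> m" for l using sol by (simp add: solution_def)
  have z: "s v x = 0" "s x v = 0" if "x \<in> W" "x \<noteq> v" "x \<noteq> a" for x
    using triv[OF that] sT[of v x] that v by (auto simp: trivial_pair_def)
  define q where "q = (if k a v \<noteq> 0 then u a + s a v + s v a + u v else u a + s a v)"
  define u' where "u' = u(a := q)"
  let ?w = "vertex_weight W u s" and ?w' = "vertex_weight ?W u' s" and ?wr = "vertex_weight ?W u s"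
  have wv: "?w v = u v + s v a"
  proof -
    have "(\<Sum>z\<in>W - {v}. s v z) = s v a + (\<Sum>z\<in>W - {v} - {a}. s v z)"
      using fin a by (intro sum.remove) auto
    also have "(\<Sum>z\<in>W - {v} - {a}. s v z) = 0" using z by (intro sum.neutral) auto
    finally show ?thesis by (simp add: vertex_weight_def)
  qed
  have wo: "?w' y = ?w y" if "y \<in> W" "y \<noteq> v" "y \<noteq> a" for y
  proof -
    have "?w' y = ?wr y"
      using that by (intro vertex_weight_cong) (auto simp: u'_def)
    then show ?thesis using vertex_weight_remove[OF fin v that(2), of u s] z(2)[OF that] by simp
  qed
  have wa: "?w' a = q + (?wr a - u a)" "u a \<le> ?wr a"
    "?w a = s a v + ?wr a"
    using vertex_weight_remove[OF fin v a(2)] by (auto simp: vertex_weight_def u'_def)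
  have cw': "class_weight ?W L l ?w' \<le> m" for l
  proof -
    have e: "class_weight (?W - {a}) L l ?w' = class_weight (?W - {a}) L l ?w"
      using wo by (intro class_weight_cong) auto
    have 1: "class_weight ?W L l ?w' = (if L a = l then ?w' a else 0) +
        class_weight (?W - {a}) L l ?w"
      using class_weight_remove[of ?W a L l "?w'"] fin a e by simp
    have 2: "class_weight W L l ?w = (if L v = l then ?w v else 0) +
        (if L a = l then ?w a else 0) + class_weight (?W - {a}) L l ?w"
      using class_weight_remove[of ?W a L l "?w"] class_weight_remove[of W v L l "?w"] fin a v
      by simp
    have La: "k a v \<noteq> 0 \<Longrightarrow> L v = L a" using sL[of a v] a v by simp
    show ?thesis using cw[of l] 1 2 La wa wv unfolding q_def by (auto split: if_splits)
  qed
  \<comment> \<open>The new row must fit into the table: its weight is bounded by that of its class,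
    hence by \<open>m\<close>.\<close>
  have qN: "q < N"
    using weight_le_class_weight[of ?W a "?w'" L] cw'[of "L a"] fin a wa mN by auto
  have tv: "s v a + u v \<le> m"
    using weight_le_class_weight[of W v "?w" L] cw[of "L v"] fin v wv by simp
  have "elim1 N m T U v a (col a) q"
    by (rule elim1I[where T = T and U = U, OF bd sU[OF a(1)] sU[OF v] sT[OF a(1) v a(2)] qN])
      (use tv in \<open>auto simp: q_def\<close>)
  then have "solution m ?W T (update1 N m T U v a) col u' k s L"
    unfolding solution_def using sU sT sL cw' by (auto simp: update1_def u'_def)
  then show "feasible m ?W T (update1 N m T U v a)" unfolding feasible_def by blast
next
  let ?W = "W - {v}"
  assume "feasible m ?W T (update1 N m T U v a)"
  then obtain col u k s L where sol: "solution m ?W T (update1 N m T U v a) col u k s L" unfolding feasible_def by blast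
  have sU: "U x (col x) (u x)" if "x \<in> ?W" "x \<noteq> a" for x using sol that by (simp add: solution_def update1_def)
  have sUa: "elim1 N m T U v a (col a) (u a)" using sol a by (simp add: solution_def update1_def)
  have sT: "T x y (col x) (col y) (k x y) (s x y) (s y x)" and sL: "k x y \<noteq> 0 \<Longrightarrow> L x = L y"
    if "x \<in> ?W" "y \<in> ?W" "x \<noteq> y" for x y using sol that by (simp_all add: solution_def)
  have cw: "class_weight ?W L l (vertex_weight ?W u s) \<le> m" for l using sol by (simp add: solution_def)
  obtain s1 d t k2 s2 t2 where el: "U a (col a) s1" "U v d t" "T a v (col a) d k2 s2 t2"
     "k2 \<noteq> 0 \<longrightarrow> u a = s1 + s2 + t2 + t" "k2 = 0 \<longrightarrow> u a = s1 + s2 \<and> t2 + t \<le> m"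
    using sUa unfolding elim1_def by blast
  \<comment> \<open>A complete component gets a label of its own, so that its weight is added to no
    other class.\<close>
  obtain fresh where fresh: "fresh \<notin> L ` ?W" using fin by (meson ex_new_if_finite finite_Diff finite_imageI infinite_UNIV_nat)
  define col' where "col' = col(v := d)"
  define u' where "u' = u(a := s1, v := t)"
  define k' where "k' x y = (if x = v \<or> y = v then if x = a \<or> y = a then k2 else 0 else k x y)" for x y
  define s' where "s' x y = (if x = v then if y = a then t2 else 0 else if y = v then if x = a then s2 else 0 else s x y)" for x y
  define L' where "L' = L(v := if k2 \<noteq> 0 then L a else fresh)"
  let ?w' = "vertex_weight W u' s'" and ?w = "vertex_weight ?W u s" and ?wr = "vertex_weight ?W u' s'"
  have bU: "col' x < N" if "x \<in> W" for x
    using bd sU[of x] el that unfolding col'_def tables_bounded_def by (cases "x = a"; cases "x = v") auto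
  have sT': "T x y (col' x) (col' y) (k' x y) (s' x y) (s' y x) \<and> (k' x y \<noteq> 0 \<longrightarrow> L' x = L' y)"
    if xy: "x \<in> W" "y \<in> W" "x \<noteq> y" for x y
  proof -
    have sy: "T y x c' c kk r' r \<Longrightarrow> T x y c c' kk r r'" for x y c c' kk r r' using sym unfolding sym_table_def by blast
    have tr: "T v x (col' v) (col' x) 0 0 0" if "x \<in> W" "x \<noteq> v" "x \<noteq> a" for x
      using triv[OF that] bU that v unfolding trivial_pair_def by blast
    consider "x \<noteq> v" "y \<noteq> v" | "x = v" "y = a" | "x = v" "y \<noteq> a" "y \<noteq> v" | "x = a" "y = v" | "x \<noteq> a" "x \<noteq> v" "y = v"
      using xy by blast
    then show ?thesis
    proof cases
      case 1 then show ?thesis using sT[of x y] sL[of x y] xy by (auto simp: col'_def k'_def s'_def L'_def)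
    next
      case 2 then show ?thesis using sy[OF el(3)] a by (auto simp: col'_def k'_def s'_def L'_def)
    next
      case 3 then show ?thesis using tr[of y] xy a(2) by (auto simp: k'_def s'_def)
    next
      case 4 then show ?thesis using el(3) a by (auto simp: col'_def k'_def s'_def L'_def)
    next
      case 5 then show ?thesis using sy[OF tr[of x]] xy a by (auto simp: k'_def s'_def)
    qed
  qed
  have wv: "?w' v = t + t2"
  proof -
    have "(\<Sum>z\<in>W - {v}. s' v z) = s' v a + (\<Sum>z\<in>W - {v} - {a}. s' v z)"
      using fin a by (intro sum.remove) auto
    also have "(\<Sum>z\<in>W - {v} - {a}. s' v z) = 0" by (intro sum.neutral) (auto simp: s'_def)
    finally show ?thesis by (simp add: vertex_weight_def s'_def u'_def)
  qed
  have wo: "?w' y = ?w y" if "y \<in> W" "y \<noteq> v" "y \<noteq> a" for y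
  proof -
    have "?wr y = ?w y"
      using that by (intro vertex_weight_cong) (auto simp: u'_def s'_def)
    then show ?thesis using vertex_weight_remove[OF fin v that(2), of u' s'] that by (simp add: s'_def)
  qed
  have wa: "?w' a + u a = s1 + s2 + ?w a"
  proof -
    have "?wr a + u a = ?w a + s1"
      using a by (auto simp: vertex_weight_def u'_def s'_def intro!: sum.cong)
    then show ?thesis using vertex_weight_remove[OF fin v a(2), of u' s'] a by (simp add: s'_def)
  qed
  have "class_weight W L' l ?w' \<le> m" for l
  proof -
    have e: "class_weight (?W - {a}) L' l ?w' = class_weight (?W - {a}) L l ?w"
      using wo by (intro class_weight_cong) (auto simp: L'_def)
    have 1: "class_weight ?W L l ?w = (if L a = l then ?w a else 0) +
        class_weight (?W - {a}) L l ?w"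
      using class_weight_remove[of ?W a L l "?w"] fin a e by simp
    have 2: "class_weight W L' l ?w' = (if L' v = l then ?w' v else 0) +
        (if L a = l then ?w' a else 0) + class_weight (?W - {a}) L l ?w"
      using class_weight_remove[of ?W a L' l "?w'"] class_weight_remove[of W v L' l "?w'"] fin a v e
      by (simp add: L'_def)
    show ?thesis
    proof (cases "k2 \<noteq> 0")
      case True
      then show ?thesis using cw[of l] 1 2 wa wv el(4) by (auto simp: L'_def split: if_splits)
    next
      case False
      have "class_weight (?W - {a}) L fresh ?w = 0"
        unfolding class_weight_def using fresh by (intro sum.neutral) auto
      moreover have "L a \<noteq> fresh" using fresh a by auto
      ultimately show ?thesis using cw[of l] 1 2 wa wv el(5) False by (auto simp: L'_def split: if_splits)
    qed
  qed
  moreover have "U x (col' x) (u' x)" if "x \<in> W" for x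
    using that el sU[of x] a by (auto simp: col'_def u'_def)
  ultimately have "solution m W T U col' u' k' s' L'" unfolding solution_def using sT' by blast
  then show "feasible m W T U" unfolding feasible_def by blast
qed

text \<open>As for one neighbour, except that \<open>v\<close> may connect \<open>a\<close> with
  \<open>b\<close>. In this case the new row records a connection, so \<open>a\<close> and
  \<open>b\<close> carry the same label, and the distribution of the weight between them does not
  change any class weight.\<close>

lemma feasible_elim2:
  assumes fin: "finite W" and v: "v \<in> W" and a: "a \<in> W" "a \<noteq> v" and b: "b \<in> W" "b \<noteq> v" and ab: "a \<noteq> b"
    and sym: "sym_table T" and bd: "tables_bounded N T U" and mN: "m < N" and N: "1 < N"
    and triv: "\<And>x. x \<in> W \<Longrightarrow> x \<noteq> v \<Longrightarrow> x \<noteq> a \<Longrightarrow> x \<noteq> b \<Longrightarrow> trivial_pair N T v x"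
  shows "feasible m W T U \<longleftrightarrow> feasible m (W - {v}) (update2 N m T U v a b) U"
proof
  let ?W = "W - {v}"
  have sy: "T y x c' c kk r' r \<Longrightarrow> T x y c c' kk r r'" for x y c c' kk r r' using sym unfolding sym_table_def by blast
  assume "feasible m W T U"
  then obtain col u k s L where sol: "solution m W T U col u k s L" unfolding feasible_def by blast
  have sU: "U x (col x) (u x)" if "x \<in> W" for x using sol that by (simp add: solution_def)
  have sT: "T x y (col x) (col y) (k x y) (s x y) (s y x)" and sL: "k x y \<noteq> 0 \<Longrightarrow> L x = L y"
    if "x \<in> W" "y \<in> W" "x \<noteq> y" for x y using sol that by (simp_all add: solution_def)
  have cw: "class_weight W L l (vertex_weight W u s) \<le> m" for l using sol by (simp add: solution_def)
  have z: "s v x = 0" "s x v = 0" if "x \<in> W" "x \<noteq> v" "x \<noteq> a" "x \<noteq> b" for x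
    using triv[OF that] sT[of v x] that v by (auto simp: trivial_pair_def)
  define t where "t = s v a + s v b + u v"
  \<comment> \<open>One admissible split: the weight \<open>t\<close> of \<open>v\<close> is charged
    to \<open>a\<close> if \<open>v\<close> is connected to \<open>a\<close>, otherwise to
    \<open>b\<close> if it is connected to \<open>b\<close>, otherwise to neither.\<close>
  define qa where "qa = s a b + s a v + (if k a v \<noteq> 0 then t else 0)"
  define qb where "qb = s b a + s b v + (if k a v = 0 \<and> k b v \<noteq> 0 then t else 0)"
  define kk where "kk = (if k a b \<noteq> 0 \<or> k a v \<noteq> 0 \<and> k b v \<noteq> 0 then 1 else 0 :: nat)"
  define s' where "s' x y = (if x = a \<and> y = b then qa else if x = b \<and> y = a then qb else s x y)" for x y
  define k' where "k' x y = (if x = a \<and> y = b \<or> x = b \<and> y = a then kk else k x y)" for x y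
  let ?w = "vertex_weight W u s" and ?w' = "vertex_weight ?W u s'" and ?wr = "vertex_weight ?W u s"
  have wv: "?w v = t"
  proof -
    have "(\<Sum>z\<in>W - {v}. s v z) = s v a + (\<Sum>z\<in>W - {v} - {a}. s v z)"
      using fin a by (intro sum.remove) auto
    also have "(\<Sum>z\<in>W - {v} - {a}. s v z) = s v b + (\<Sum>z\<in>W - {v} - {a} - {b}. s v z)"
      using fin ab b by (intro sum.remove) auto
    also have "(\<Sum>z\<in>W - {v} - {a} - {b}. s v z) = 0" using z by (intro sum.neutral) auto
    finally show ?thesis by (simp add: vertex_weight_def t_def)
  qed
  have wo: "?w' y = ?w y" if "y \<in> W" "y \<noteq> v" "y \<noteq> a" "y \<noteq> b" for y
  proof -
    have "?w' y = ?wr y"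
      using that by (intro vertex_weight_cong) (auto simp: s'_def)
    then show ?thesis using vertex_weight_remove[OF fin v that(2), of u s] z(2)[OF that] by simp
  qed
  have wa: "?w' a = ?w a + (if k a v \<noteq> 0 then t else 0)" (is "?g1")
    and wb: "?w' b = ?w b + (if k a v = 0 \<and> k b v \<noteq> 0 then t else 0)" (is "?g2")
    and qle: "qa \<le> ?w' a" "qb \<le> ?w' b"
  proof -
    have e: "vertex_weight (?W - {b}) u s' a = vertex_weight (?W - {b}) u s a"
       "vertex_weight (?W - {a}) u s' b = vertex_weight (?W - {a}) u s b"
      by (intro vertex_weight_cong; auto simp: s'_def)+
    have 1: "?w' a = qa + vertex_weight (?W - {b}) u s a"
      "?w' b = qb + vertex_weight (?W - {a}) u s b"
      using vertex_weight_remove[of ?W b a u s'] vertex_weight_remove[of ?W a b u s'] fin a b ab e by (auto simp: s'_def)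
    have 2: "?w a = s a v + s a b + vertex_weight (?W - {b}) u s a"
      "?w b = s b v + s b a + vertex_weight (?W - {a}) u s b"
      using vertex_weight_remove[of ?W b a u s] vertex_weight_remove[of ?W a b u s] vertex_weight_remove[of W v a u s]
        vertex_weight_remove[of W v b u s] fin a b v ab by auto
    show ?g1 ?g2 "qa \<le> ?w' a" "qb \<le> ?w' b" using 1 2 by (auto simp: qa_def qb_def)
  qed
  have Lk: "k a v \<noteq> 0 \<Longrightarrow> L v = L a" "k b v \<noteq> 0 \<Longrightarrow> L v = L b" "k a b \<noteq> 0 \<Longrightarrow> L a = L b"
    using sL[of a v] sL[of b v] sL[of a b] a b v ab by simp_all
  have cw': "class_weight ?W L l ?w' \<le> m" for l
  proof -
    have e: "class_weight (?W - {a} - {b}) L l ?w' = class_weight (?W - {a} - {b}) L l ?w"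
      using wo by (intro class_weight_cong) auto
    have 1: "class_weight ?W L l ?w' = (if L a = l then ?w' a else 0) +
        (if L b = l then ?w' b else 0) + class_weight (?W - {a} - {b}) L l ?w"
      using class_weight_remove[of ?W a L l "?w'"] class_weight_remove[of "?W - {a}" b L l "?w'"]
        fin a b ab e by simp
    have 2: "class_weight W L l ?w = (if L v = l then ?w v else 0) +
        (if L a = l then ?w a else 0) + (if L b = l then ?w b else 0) +
        class_weight (?W - {a} - {b}) L l ?w"
      using class_weight_remove[of W v L l "?w"] class_weight_remove[of ?W a L l "?w"]
        class_weight_remove[of "?W - {a}" b L l "?w"] fin a b v ab by simp
    show ?thesis using cw[of l] 1 2 Lk wa wb wv by (auto split: if_splits)
  qed
  have qN: "qa < N" "qb < N"
    using weight_le_class_weight[of ?W a "?w'" L] cw'[of "L a"]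
      weight_le_class_weight[of ?W b "?w'" L] cw'[of "L b"] fin a b qle mN by auto
  have tv: "t \<le> m"
    using weight_le_class_weight[of W v "?w" L] cw[of "L v"] fin v wv by simp
  have el: "elim2 N m T U v a b (col a) (col b) kk qa qb"
    by (rule elim2I[where T = T and U = U, OF bd sT[OF a(1) b(1) ab] sU[OF v] sT[OF a(1) v a(2)] sT[OF b(1) v b(2)] _ qN])
      (use tv N in \<open>auto simp: qa_def qb_def kk_def t_def\<close>)
  \<comment> \<open>A solution constrains both orders of a pair, so the same split is needed as a
    row of \<open>(b, a)\<close>.\<close>
  have el': "elim2 N m T U v b a (col b) (col a) kk qb qa"
    by (rule elim2I[where T = T and U = U, OF bd sy[OF sT[OF a(1) b(1) ab]] sU[OF v] sT[OF b(1) v b(2)] sT[OF a(1) v a(2)] _ qN(2,1)])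
      (use tv N in \<open>auto simp: qa_def qb_def kk_def t_def\<close>)
  have T': "update2 N m T U v a b x y (col x) (col y) (k' x y) (s' x y) (s' y x) \<and> (k' x y \<noteq> 0 \<longrightarrow> L x = L y)"
    if "x \<in> ?W" "y \<in> ?W" "x \<noteq> y" for x y
  proof (cases "x = a \<and> y = b \<or> x = b \<and> y = a")
    case True
    moreover have "kk \<noteq> 0 \<Longrightarrow> L a = L b" using Lk by (auto simp: kk_def split: if_splits)
    ultimately show ?thesis using el el' ab by (auto simp: update2_def k'_def s'_def)
  next
    case False
    then show ?thesis using sT[of x y] sL[of x y] that by (auto simp: update2_def k'_def s'_def)
  qed
  have "solution m ?W (update2 N m T U v a b) U col u k' s' L"
    unfolding solution_def using sU T' cw' by blast
  then show "feasible m ?W (update2 N m T U v a b) U" unfolding feasible_def by blast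
next
  let ?W = "W - {v}"
  have sy: "T y x c' c kk r' r \<Longrightarrow> T x y c c' kk r r'" for x y c c' kk r r' using sym unfolding sym_table_def by blast
  assume "feasible m ?W (update2 N m T U v a b) U"
  then obtain col u k s L where sol: "solution m ?W (update2 N m T U v a b) U col u k s L" unfolding feasible_def by blast
  have sU: "U x (col x) (u x)" if "x \<in> ?W" for x using sol that by (simp add: solution_def)
  have sT: "T x y (col x) (col y) (k x y) (s x y) (s y x)"
    if "x \<in> ?W" "y \<in> ?W" "x \<noteq> y" "\<not> (x = a \<and> y = b \<or> x = b \<and> y = a)" for x y
    using sol that unfolding solution_def update2_def by metis
  have sL: "k x y \<noteq> 0 \<Longrightarrow> L x = L y" if "x \<in> ?W" "y \<in> ?W" "x \<noteq> y" for x y using sol that by (simp add: solution_def)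
  have cw: "class_weight ?W L l (vertex_weight ?W u s) \<le> m" for l using sol by (simp add: solution_def)
  have "elim2 N m T U v a b (col a) (col b) (k a b) (s a b) (s b a)"
    using sol a b ab unfolding solution_def update2_def by (metis Diff_iff singletonD)
  then obtain k1 s1 s1' d t k2 s2 t2 k3 s3 t3 where
    el: "T a b (col a) (col b) k1 s1 s1'" "U v d t" "T a v (col a) d k2 s2 t2" "T b v (col b) d k3 s3 t3"
    and k: "k a b \<noteq> 0 \<longleftrightarrow> k1 \<noteq> 0 \<or> k2 \<noteq> 0 \<and> k3 \<noteq> 0"
    and w: "k2 \<noteq> 0 \<and> k3 \<noteq> 0 \<longrightarrow> s a b + s b a = s1 + s2 + s1' + s3 + t2 + t3 + t"
      "k2 \<noteq> 0 \<and> k3 = 0 \<longrightarrow> s a b = s1 + s2 + t2 + t3 + t \<and> s b a = s1' + s3"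
      "k2 = 0 \<and> k3 \<noteq> 0 \<longrightarrow> s a b = s1 + s2 \<and> s b a = s1' + s3 + t2 + t3 + t"
      "k2 = 0 \<and> k3 = 0 \<longrightarrow> s a b = s1 + s2 \<and> s b a = s1' + s3 \<and> t2 + t3 + t \<le> m"
    unfolding elim2_def by blast
  obtain fresh where fresh: "fresh \<notin> L ` ?W" using fin by (meson ex_new_if_finite finite_Diff finite_imageI infinite_UNIV_nat)
  define col' where "col' = col(v := d)"
  define u' where "u' = u(v := t)"
  define k' where "k' x y = (if x = v \<or> y = v then if x = a \<or> y = a then k2 else if x = b \<or> y = b then k3 else 0
     else if x = a \<and> y = b \<or> x = b \<and> y = a then k1 else k x y)" for x y
  define s' where "s' x y = (if x = v then if y = a then t2 else if y = b then t3 else 0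
     else if y = v then if x = a then s2 else if x = b then s3 else 0
     else if x = a \<and> y = b then s1 else if x = b \<and> y = a then s1' else s x y)" for x y
  define L' where "L' = L(v := if k2 \<noteq> 0 then L a else if k3 \<noteq> 0 then L b else fresh)"
  let ?w' = "vertex_weight W u' s'" and ?w = "vertex_weight ?W u s" and ?wr = "vertex_weight ?W u' s'"
  \<comment> \<open>The recorded connection \<open>k a b \<noteq> 0\<close> forces one label on
    \<open>a\<close> and \<open>b\<close>; therefore \<open>L'\<close> may give \<open>v\<close> the
    label of \<open>a\<close> even if \<open>v\<close> is connected to both.\<close>
  have Lab: "k1 \<noteq> 0 \<or> k2 \<noteq> 0 \<and> k3 \<noteq> 0 \<Longrightarrow> L a = L b" using sL[of a b] k a b ab by simp
  have bU: "col' x < N" if "x \<in> W" for x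
    using bd sU[of x] el(2) that unfolding col'_def tables_bounded_def by (cases "x = v") auto
  have sT': "T x y (col' x) (col' y) (k' x y) (s' x y) (s' y x) \<and> (k' x y \<noteq> 0 \<longrightarrow> L' x = L' y)"
    if xy: "x \<in> W" "y \<in> W" "x \<noteq> y" for x y
  proof -
    have tr: "T v x (col' v) (col' x) 0 0 0" if "x \<in> W" "x \<noteq> v" "x \<noteq> a" "x \<noteq> b" for x
      using triv[OF that] bU that v unfolding trivial_pair_def by blast
    consider "x \<noteq> v" "y \<noteq> v" "\<not> (x = a \<and> y = b \<or> x = b \<and> y = a)" | "x = a" "y = b" | "x = b" "y = a"
      | "x = v" "y = a" | "x = v" "y = b" | "x = v" "y \<noteq> a" "y \<noteq> b" "y \<noteq> v"
      | "x = a" "y = v" | "x = b" "y = v" | "x \<noteq> a" "x \<noteq> b" "x \<noteq> v" "y = v"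
      using xy by blast
    then show ?thesis
    proof cases
      case 1 then show ?thesis using sT[of x y] sL[of x y] xy by (auto simp: col'_def k'_def s'_def L'_def)
    next
      case 2 then show ?thesis using el(1) a b ab Lab by (auto simp: col'_def k'_def s'_def L'_def)
    next
      case 3 then show ?thesis using sy[OF el(1)] a b ab Lab by (auto simp: col'_def k'_def s'_def L'_def)
    next
      case 4 then show ?thesis using sy[OF el(3)] a by (auto simp: col'_def k'_def s'_def L'_def)
    next
      case 5 then show ?thesis using sy[OF el(4)] b ab Lab a by (auto simp: col'_def k'_def s'_def L'_def)
    next
      case 6 then show ?thesis using tr[of y] xy a(2) b(2) by (auto simp: k'_def s'_def)
    next
      case 7 then show ?thesis using el(3) a by (auto simp: col'_def k'_def s'_def L'_def)
    next
      case 8 then show ?thesis using el(4) a(2) b ab Lab by (auto simp: col'_def k'_def s'_def L'_def)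
    next
      case 9 then show ?thesis using sy[OF tr[of x]] xy a(2) b(2) by (auto simp: k'_def s'_def)
    qed
  qed
  have wv: "?w' v = t2 + t3 + t"
  proof -
    have "(\<Sum>z\<in>W - {v}. s' v z) = s' v a + (\<Sum>z\<in>W - {v} - {a}. s' v z)"
      using fin a by (intro sum.remove) auto
    also have "(\<Sum>z\<in>W - {v} - {a}. s' v z) = s' v b + (\<Sum>z\<in>W - {v} - {a} - {b}. s' v z)"
      using fin ab b by (intro sum.remove) auto
    also have "(\<Sum>z\<in>W - {v} - {a} - {b}. s' v z) = 0" by (intro sum.neutral) (auto simp: s'_def)
    finally show ?thesis using ab by (simp add: vertex_weight_def s'_def u'_def)
  qed
  have wo: "?w' y = ?w y" if "y \<in> W" "y \<noteq> v" "y \<noteq> a" "y \<noteq> b" for y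
  proof -
    have "?wr y = ?w y"
      using that by (intro vertex_weight_cong) (auto simp: u'_def s'_def)
    then show ?thesis using vertex_weight_remove[OF fin v that(2), of u' s'] that by (simp add: s'_def)
  qed
  have wa: "?w' a + s a b = s1 + s2 + ?w a" (is "?g1")
    and wb: "?w' b + s b a = s1' + s3 + ?w b" (is "?g2")
  proof -
    have e: "vertex_weight (?W - {b}) u' s' a = vertex_weight (?W - {b}) u s a"
       "vertex_weight (?W - {a}) u' s' b = vertex_weight (?W - {a}) u s b"
      using a b by (intro vertex_weight_cong; auto simp: s'_def u'_def)+
    have 1: "?w a = s a b + vertex_weight (?W - {b}) u s a"
      "?w b = s b a + vertex_weight (?W - {a}) u s b"
      using vertex_weight_remove[of ?W b a u s] vertex_weight_remove[of ?W a b u s] fin a b ab by auto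
    have 2: "?w' a = s2 + s1 + vertex_weight (?W - {b}) u s a"
      "?w' b = s3 + s1' + vertex_weight (?W - {a}) u s b"
      using vertex_weight_remove[of ?W b a u' s'] vertex_weight_remove[of ?W a b u' s'] vertex_weight_remove[of W v a u' s']
        vertex_weight_remove[of W v b u' s'] fin a b v ab e by (auto simp: s'_def)
    show ?g1 ?g2 using 1 2 by auto
  qed
  have "class_weight W L' l ?w' \<le> m" for l
  proof -
    have e: "class_weight (?W - {a} - {b}) L' l ?w' = class_weight (?W - {a} - {b}) L l ?w"
      using wo by (intro class_weight_cong) (auto simp: L'_def)
    have 1: "class_weight ?W L l ?w = (if L a = l then ?w a else 0) +
        (if L b = l then ?w b else 0) + class_weight (?W - {a} - {b}) L l ?w"
      using class_weight_remove[of ?W a L l "?w"] class_weight_remove[of "?W - {a}" b L l "?w"]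
        fin a b ab by simp
    have 2: "class_weight W L' l ?w' = (if L' v = l then ?w' v else 0) +
        (if L a = l then ?w' a else 0) + (if L b = l then ?w' b else 0) +
        class_weight (?W - {a} - {b}) L l ?w"
      using class_weight_remove[of W v L' l "?w'"] class_weight_remove[of ?W a L' l "?w'"]
        class_weight_remove[of "?W - {a}" b L' l "?w'"] fin a b v ab e by (simp add: L'_def)
    show ?thesis
    proof (cases "k2 = 0 \<and> k3 = 0")
      case False
      then show ?thesis using cw[of l] 1 2 wa wb wv w(1-3) Lab
        by (cases "k2 = 0"; cases "k3 = 0") (auto simp: L'_def split: if_splits)
    next
      case True
      have "class_weight (?W - {a} - {b}) L fresh ?w = 0"
        unfolding class_weight_def using fresh by (intro sum.neutral) auto
      moreover have "L a \<noteq> fresh" "L b \<noteq> fresh" using fresh a b by auto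
      ultimately show ?thesis using cw[of l] 1 2 wa wb wv w(4) True by (auto simp: L'_def split: if_splits)
    qed
  qed
  moreover have "U x (col' x) (u' x)" if "x \<in> W" for x
    using that el sU[of x] a by (auto simp: col'_def u'_def)
  ultimately have "solution m W T U col' u' k' s' L'" unfolding solution_def using sT' by blast
  then show "feasible m W T U" unfolding feasible_def by blast
qed

lemma sym_table_update2:
  assumes "sym_table T" and bd: "tables_bounded N T U"
  shows "sym_table (update2 N m T U v a b)"
proof -
  have sy: "T x y c c' kk r r' \<longleftrightarrow> T y x c' c kk r' r" for x y c c' kk r r'
    using assms unfolding sym_table_def by blast
  have imp: "elim2 N m T U v y x c' c k s' s" if e: "elim2 N m T U v x y c c' k s s'" for x y c c' k s s'
  proof -
    obtain k1 s1 s1' d t k2 s2 t2 k3 s3 t3 where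
      el: "T x y c c' k1 s1 s1'" "U v d t" "T x v c d k2 s2 t2" "T y v c' d k3 s3 t3"
      and k: "k \<noteq> 0 \<longleftrightarrow> k1 \<noteq> 0 \<or> k2 \<noteq> 0 \<and> k3 \<noteq> 0"
      and w: "k2 \<noteq> 0 \<and> k3 \<noteq> 0 \<longrightarrow> s + s' = s1 + s2 + s1' + s3 + t2 + t3 + t"
        "k2 \<noteq> 0 \<and> k3 = 0 \<longrightarrow> s = s1 + s2 + t2 + t3 + t \<and> s' = s1' + s3"
        "k2 = 0 \<and> k3 \<noteq> 0 \<longrightarrow> s = s1 + s2 \<and> s' = s1' + s3 + t2 + t3 + t"
        "k2 = 0 \<and> k3 = 0 \<longrightarrow> s = s1 + s2 \<and> s' = s1' + s3 \<and> t2 + t3 + t \<le> m"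
      using e unfolding elim2_def by blast
    have b: "k < N" "s < N" "s' < N" using e unfolding elim2_def by blast+
    have "T y x c' c k1 s1' s1" using el(1) sy by blast
    show ?thesis
      by (rule elim2I[where T = T and U = U, OF bd \<open>T y x c' c k1 s1' s1\<close> el(2,4,3) b(1,3,2)]) (use k w in auto)
  qed
  have "elim2 N m T U v x y c c' k s s' \<longleftrightarrow> elim2 N m T U v y x c' c k s' s" for x y c c' k s s'
    using imp by blast
  then show ?thesis unfolding sym_table_def update2_def using sy by auto
qed

section \<open>The fill graph and the invariant of the elimination\<close>

definition live_edges :: "nat set \<Rightarrow> (nat \<Rightarrow> nat \<Rightarrow> bool) \<Rightarrow> nat set set" where
  "live_edges W F = {{x, y} | x y. x \<in> W \<and> y \<in> W \<and> x \<noteq> y \<and> F x y}"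

text \<open>\<open>F\<close> is never pruned: edges at eliminated vertices remain in it and are
  masked by \<open>W\<close>. Only pairs that are adjacent in \<open>F\<close> may have a nontrivial
  table.\<close>

definition elim_inv ::
  "nat \<Rightarrow> nat \<Rightarrow> nat set \<Rightarrow> (nat \<Rightarrow> nat \<Rightarrow> bool) \<Rightarrow> pair_table \<Rightarrow> vertex_table \<Rightarrow> bool" where
  "elim_inv n N W F T U \<longleftrightarrow>
     W \<subseteq> {..n} \<and> n \<in> W \<and> outerplanar (W - {n}) (live_edges W F) \<and>
     (\<forall>x y. F x y \<longrightarrow> F y x) \<and> (\<forall>x. \<not> F n x) \<and> sym_table T \<and> tables_bounded N T U \<and>
     (\<forall>x\<in>W. \<forall>y\<in>W. x \<noteq> y \<and> \<not> F x y \<longrightarrow> trivial_pair N T x y)"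

text \<open>The vertex \<open>n\<close> is an extra isolated vertex that is never eliminated: an isolated vertex \<open>v\<close> is
  eliminated with \<open>a = b = n\<close>, a vertex of degree one with \<open>a = b\<close> its neighbour.\<close>

definition can_elim :: "nat \<Rightarrow> nat set \<Rightarrow> (nat \<Rightarrow> nat \<Rightarrow> bool) \<Rightarrow> nat \<Rightarrow> nat \<Rightarrow> nat \<Rightarrow> bool" where
  "can_elim n W F v a b \<longleftrightarrow> v \<in> W \<and> a \<in> W \<and> b \<in> W \<and> v \<noteq> n \<and> v \<noteq> a \<and> v \<noteq> b \<and>
     (\<forall>x\<in>W. x \<noteq> v \<and> x \<noteq> a \<and> x \<noteq> b \<longrightarrow> \<not> F v x) \<and> (a \<noteq> b \<longrightarrow> F v a \<and> F v b)"

lemma in_live_edges: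
  assumes "\<forall>x y. F x y \<longrightarrow> F y x"
  shows "{x, y} \<in> live_edges W F \<longleftrightarrow> x \<in> W \<and> y \<in> W \<and> x \<noteq> y \<and> F x y"
  unfolding live_edges_def using assms by (auto simp: doubleton_eq_iff)

lemma elim_inv1:
  assumes inv: "elim_inv n N W F T U" and ce: "can_elim n W F v a a" and m: "m < N"
  shows "elim_inv n N (W - {v}) F T (update1 N m T U v a)"
    and "feasible m W T U \<longleftrightarrow> feasible m (W - {v}) T (update1 N m T U v a)"
proof -
  have F: "\<forall>x y. F x y \<longrightarrow> F y x" and out: "outerplanar (W - {n}) (live_edges W F)"
    and fin: "finite W" and bd: "tables_bounded N T U" and sym: "sym_table T"
    and triv: "\<forall>x\<in>W. \<forall>y\<in>W. x \<noteq> y \<and> \<not> F x y \<longrightarrow> trivial_pair N T x y"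
    using inv by (auto simp: elim_inv_def intro: finite_subset)
  have c: "v \<in> W" "a \<in> W" "v \<noteq> n" "v \<noteq> a" "\<forall>x\<in>W. x \<noteq> v \<and> x \<noteq> a \<longrightarrow> \<not> F v x"
    using ce by (auto simp: can_elim_def)
  show "feasible m W T U \<longleftrightarrow> feasible m (W - {v}) T (update1 N m T U v a)"
    using c triv by (intro feasible_elim1[OF fin _ _ _ sym bd m]) auto
  have "outerplanar (W - {v} - {n}) (live_edges (W - {v}) F)"
  proof (rule outerplanar_subgraph[OF out])
    have "n \<notin> e" if "e \<in> live_edges W F" for e
      using out that unfolding outerplanar_def simple_graph_def by blast
    moreover have sub: "live_edges (W - {v}) F \<subseteq> live_edges W F" unfolding live_edges_def by blast
    moreover have "e \<subseteq> W - {v}" if "e \<in> live_edges (W - {v}) F" for e using that unfolding live_edges_def by blast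
    ultimately show "e \<subseteq> W - {v} - {n}" if "e \<in> live_edges (W - {v}) F" for e using that by blast
    show "live_edges (W - {v}) F \<subseteq> live_edges W F" by fact
  qed auto
  moreover have "tables_bounded N T (update1 N m T U v a)"
    using bd unfolding tables_bounded_def update1_def elim1_def by auto
  ultimately show "elim_inv n N (W - {v}) F T (update1 N m T U v a)"
    using inv c unfolding elim_inv_def by auto
qed

text \<open>The table of \<open>a\<close> and \<open>b\<close> ceases to be trivial, so their edge
  enters the fill graph, and \<open>outerplanar_suppress\<close> keeps the fill graph
  outerplanar.\<close>

lemma elim_inv2:
  fixes F
  assumes inv: "elim_inv n N W F T U" and ce: "can_elim n W F v a b" and ab: "a \<noteq> b" and m: "m < N" "1 < N"
  defines "F' \<equiv> \<lambda>x y. F x y \<or> x = a \<and> y = b \<or> x = b \<and> y = a"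
  shows "elim_inv n N (W - {v}) F' (update2 N m T U v a b) U"
    and "feasible m W T U \<longleftrightarrow> feasible m (W - {v}) (update2 N m T U v a b) U"
proof -
  have F: "\<forall>x y. F x y \<longrightarrow> F y x" and out: "outerplanar (W - {n}) (live_edges W F)"
    and fin: "finite W" and bd: "tables_bounded N T U" and sym: "sym_table T" and Fn: "\<forall>x. \<not> F n x"
    and triv: "\<forall>x\<in>W. \<forall>y\<in>W. x \<noteq> y \<and> \<not> F x y \<longrightarrow> trivial_pair N T x y"
    using inv by (auto simp: elim_inv_def intro: finite_subset)
  have c: "v \<in> W" "a \<in> W" "b \<in> W" "v \<noteq> n" "v \<noteq> a" "v \<noteq> b" "F v a" "F v b"
    "\<forall>x\<in>W. x \<noteq> v \<and> x \<noteq> a \<and> x \<noteq> b \<longrightarrow> \<not> F v x"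
    using ce ab by (auto simp: can_elim_def)
  have nn: "a \<noteq> n" "b \<noteq> n" using c(7,8) F Fn by blast+
  show "feasible m W T U \<longleftrightarrow> feasible m (W - {v}) (update2 N m T U v a b) U"
    using c triv ab by (intro feasible_elim2[OF fin _ _ _ _ _ _ sym bd m]) auto
  have F'sym: "\<forall>x y. F' x y \<longrightarrow> F' y x" using F unfolding F'_def by blast
  have "outerplanar (W - {n} - {v}) (insert {a, b} {e \<in> live_edges W F. v \<notin> e})"
  proof (rule outerplanar_suppress[OF out _ _ ab])
    show "{a, v} \<in> live_edges W F" "{v, b} \<in> live_edges W F"
      using c F by (auto simp: in_live_edges[OF F])
  qed
  moreover have "insert {a, b} {e \<in> live_edges W F. v \<notin> e} = live_edges (W - {v}) F'" (is "?A = ?B")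
  proof
    show "?A \<subseteq> ?B"
      using c ab unfolding live_edges_def F'_def by blast
    show "?B \<subseteq> ?A" using c ab unfolding live_edges_def F'_def by (auto simp: insert_commute)
  qed
  moreover have "W - {n} - {v} = W - {v} - {n}" by blast
  ultimately have "outerplanar (W - {v} - {n}) (live_edges (W - {v}) F')" by simp
  moreover have "tables_bounded N (update2 N m T U v a b) U"
    unfolding tables_bounded_def
  proof (intro conjI allI impI)
    fix x y c c' k s s' assume u: "update2 N m T U v a b x y c c' k s s'"
    show "c < N" "c' < N" "k < N" "s < N" "s' < N"
      using u bd unfolding update2_def elim2_def tables_bounded_def by (auto split: if_splits)
  qed (use bd in \<open>auto simp: tables_bounded_def\<close>)
  moreover have "trivial_pair N (update2 N m T U v a b) x y" if "x \<in> W - {v}" "y \<in> W - {v}" "x \<noteq> y" "\<not> F' x y" for x y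
  proof -
    have "trivial_pair N T x y" using triv that unfolding F'_def by blast
    moreover have "\<not> (x = a \<and> y = b \<or> x = b \<and> y = a)" using that unfolding F'_def by blast
    ultimately show ?thesis unfolding trivial_pair_def update2_def by (simp only: if_False) simp
  qed
  moreover have "\<forall>x. \<not> F' n x" using Fn nn unfolding F'_def by simp
  ultimately show "elim_inv n N (W - {v}) F' (update2 N m T U v a b) U"
    using inv c F'sym sym_table_update2[OF sym bd] unfolding elim_inv_def by auto
qed

text \<open>The degree bound is applied to the fill graph on the remaining vertices, not to the
  input; zero, one and two neighbours give the three shapes of \<open>can_elim\<close>.\<close>

lemma ex_can_elim:
  assumes inv: "elim_inv n N W F T U" and W: "W \<noteq> {n}"
  shows "\<exists>v a b. can_elim n W F v a b"
proof -
  have F: "\<forall>x y. F x y \<longrightarrow> F y x" and out: "outerplanar (W - {n}) (live_edges W F)" and n: "n \<in> W"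
    and fin: "finite W"
    using inv by (auto simp: elim_inv_def intro: finite_subset)
  obtain v where v: "v \<in> W - {n}" "card {u. {v, u} \<in> live_edges W F} \<le> 2"
    using outerplanar_degree_le_2[OF out] W n by blast
  define A where "A = {u \<in> W. u \<noteq> v \<and> F v u}"
  have A: "{u. {v, u} \<in> live_edges W F} = A" using v unfolding A_def by (auto simp: in_live_edges[OF F])
  have fA: "finite A" using fin by (simp add: A_def)
  consider "card A = 0" | "card A = 1" | "card A = 2" using v(2) A by fastforce
  then show ?thesis
  proof cases
    case 1
    then have "A = {}" using fA by simp
    then have "can_elim n W F v n n" using v n unfolding can_elim_def A_def by auto
    then show ?thesis by blast
  next
    case 2
    then obtain a where "A = {a}" by (auto simp: card_1_singleton_iff)
    moreover from this have "a \<in> W" "a \<noteq> v" unfolding A_def by blast+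
    ultimately have "can_elim n W F v a a" using v n unfolding can_elim_def A_def by auto
    then show ?thesis by blast
  next
    case 3
    then obtain a b where ab: "A = {a, b}" "a \<noteq> b" by (auto simp: card_2_iff)
    moreover from this have "a \<in> W" "a \<noteq> v" "F v a" "b \<in> W" "b \<noteq> v" "F v b" unfolding A_def by blast+
    ultimately have "can_elim n W F v a b" using v n unfolding can_elim_def A_def by auto
    then show ?thesis by blast
  qed
qed

section \<open>Initial tables and monochromatic components\<close>

definition init_pairs :: "nat \<Rightarrow> nat set set \<Rightarrow> pair_table" where
  "init_pairs N E x y c c' k s s' \<longleftrightarrow>
     c < N \<and> c' < N \<and> k < N \<and> s = 0 \<and> s' = 0 \<and> (k \<noteq> 0 \<longleftrightarrow> {x, y} \<in> E \<and> c = c')"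

text \<open>The parameter \<open>ok\<close> gives the admissible colours, so that the same tables
  serve the search for the optimum and the extension of a partial colouring.\<close>

definition init_vertices :: "nat \<Rightarrow> nat \<Rightarrow> (nat \<Rightarrow> nat \<Rightarrow> bool) \<Rightarrow> vertex_table" where
  "init_vertices n N ok x c s \<longleftrightarrow> c < N \<and> (x = n \<and> s = 0 \<or> x \<noteq> n \<and> ok x c \<and> s = 1)"

lemma elim_inv_init:
  assumes out: "outerplanar {..<n} E" and N: "1 < N"
  shows "elim_inv n N {..n} (\<lambda>x y. {x, y} \<in> E) (init_pairs N E) (init_vertices n N ok)"
proof -
  have E: "\<And>e. e \<in> E \<Longrightarrow> e \<subseteq> {..<n} \<and> card e = 2" using out by (auto simp: outerplanar_def simple_graph_def)
  have "live_edges {..n} (\<lambda>x y. {x, y} \<in> E) = E"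
  proof
    show "E \<subseteq> live_edges {..n} (\<lambda>x y. {x, y} \<in> E)"
    proof
      fix e assume e: "e \<in> E"
      then obtain x y where xy: "e = {x, y}" "x \<noteq> y" using E[OF e] by (meson card_2_iff)
      then have "x \<in> {..n}" "y \<in> {..n}" using E[OF e] by auto
      then show "e \<in> live_edges {..n} (\<lambda>x y. {x, y} \<in> E)" using e xy unfolding live_edges_def by blast
    qed
  qed (auto simp: live_edges_def)
  moreover have "{..n} - {n} = {..<n}" by auto
  moreover have "{n, x} \<notin> E" for x using E by blast
  ultimately show ?thesis
    using out N unfolding elim_inv_def sym_table_def tables_bounded_def trivial_pair_def init_pairs_def init_vertices_def
    by (auto simp: insert_commute)
qed

definition mono_rel :: "'a set set \<Rightarrow> ('a \<Rightarrow> nat) \<Rightarrow> ('a \<times> 'a) set" where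
  "mono_rel E f = {(x, y). {x, y} \<in> E \<and> f x = f y}"

text \<open>A step of \<open>mono_rel\<close> preserves the colour, so one reflexive transitive
  closure on all vertices replaces the separate closures in the colour classes.\<close>

lemma mono_components_eq:
  assumes "simple_graph V E"
  shows "mono_components V E f = {{w \<in> V. (v, w) \<in> (mono_rel E f)\<^sup>*} | v. v \<in> V}"
proof -
  have eq: "{w \<in> {x \<in> V. f x = f v}. (v, w) \<in> {(x, y). {x, y} \<in> induced_edges E {x \<in> V. f x = f v}}\<^sup>*} =
      {w \<in> V. (v, w) \<in> (mono_rel E f)\<^sup>*}" if v: "v \<in> V" for v
  proof -
    let ?R = "{(x, y). {x, y} \<in> induced_edges E {x \<in> V. f x = f v}}"
    have "?R \<subseteq> mono_rel E f" unfolding induced_edges_def mono_rel_def by auto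
    then have 1: "(v, w) \<in> ?R\<^sup>* \<Longrightarrow> (v, w) \<in> (mono_rel E f)\<^sup>*" for w using rtrancl_mono by blast
    have 2: "(v, w) \<in> (mono_rel E f)\<^sup>* \<Longrightarrow> (v, w) \<in> ?R\<^sup>* \<and> w \<in> V \<and> f w = f v" for w
    proof (induction rule: rtrancl_induct)
      case (step y z)
      have "{y, z} \<in> E" "f y = f z" using step(2) by (auto simp: mono_rel_def)
      moreover have "z \<in> V" using assms \<open>{y, z} \<in> E\<close> unfolding simple_graph_def by blast
      ultimately have "(y, z) \<in> ?R" using step(3) unfolding induced_edges_def by auto
      then show ?case using step(3) \<open>z \<in> V\<close> \<open>f y = f z\<close> by (auto intro: rtrancl_into_rtrancl)
    qed (use v in auto)
    show ?thesis using 1 2 by blast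
  qed
  show ?thesis
  proof
    show "mono_components V E f \<subseteq> {{w \<in> V. (v, w) \<in> (mono_rel E f)\<^sup>*} | v. v \<in> V}"
    proof
      fix C assume "C \<in> mono_components V E f"
      then obtain v where v: "v \<in> V" "C = {w \<in> {x \<in> V. f x = f v}. (v, w) \<in> {(x, y). {x, y} \<in> induced_edges E {x \<in> V. f x = f v}}\<^sup>*}"
        unfolding mono_components_def graph_components_def Let_def by auto
      then show "C \<in> {{w \<in> V. (v, w) \<in> (mono_rel E f)\<^sup>*} | v. v \<in> V}" using eq[OF v(1)] by blast
    qed
    show "{{w \<in> V. (v, w) \<in> (mono_rel E f)\<^sup>*} | v. v \<in> V} \<subseteq> mono_components V E f"
    proof
      fix C assume "C \<in> {{w \<in> V. (v, w) \<in> (mono_rel E f)\<^sup>*} | v. v \<in> V}"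
      then obtain v where v: "v \<in> V" "C = {w \<in> V. (v, w) \<in> (mono_rel E f)\<^sup>*}" by blast
      then have "C \<in> graph_components {x \<in> V. f x = f v} (induced_edges E {x \<in> V. f x = f v})"
        using eq[OF v(1)] unfolding graph_components_def by blast
      then show "C \<in> mono_components V E f" unfolding mono_components_def Let_def by blast
    qed
  qed
qed

lemma max_mono_size_le_iff:
  assumes "simple_graph V E"
  shows "max_mono_size V E f \<le> m \<longleftrightarrow> (\<forall>C\<in>mono_components V E f. card C \<le> m)"
proof -
  have "finite V" using assms by (simp add: simple_graph_def)
  then have "finite (mono_components V E f)" unfolding mono_components_eq[OF assms] by simp
  then show ?thesis unfolding max_mono_size_def by simp
qed

text \<open>The labels of a solution are constant on monochromatic components, so the size of a
  component is at most the weight of its class. Conversely, a colouring is labelled by its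
  components.\<close>

lemma feasible_init_iff:
  assumes sg: "simple_graph {..<n} E" and N: "1 < N"
  shows "feasible m {..n} (init_pairs N E) (init_vertices n N ok) \<longleftrightarrow>
    (\<exists>f. (\<forall>x<n. f x < N \<and> ok x (f x)) \<and> max_mono_size {..<n} E f \<le> m)"
proof
  assume "feasible m {..n} (init_pairs N E) (init_vertices n N ok)"
  then obtain col u k s L where sol: "solution m {..n} (init_pairs N E) (init_vertices n N ok) col u k s L"
    unfolding feasible_def by blast
  have U: "col x < N \<and> ok x (col x) \<and> u x = 1" if "x < n" for x
    using sol that unfolding solution_def init_vertices_def by auto
  have L: "L x = L y" if "(x, y) \<in> mono_rel E col" for x y
  proof -
    have e: "{x, y} \<in> E" "col x = col y" using that by (auto simp: mono_rel_def)
    then have "x \<noteq> y" "x < n" "y < n" using sg unfolding simple_graph_def by (fastforce simp: card_insert_if)+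
    then show ?thesis using sol e unfolding solution_def init_pairs_def by (metis atMost_iff less_imp_le)
  qed
  have "card C \<le> m" if CC: "C \<in> mono_components {..<n} E col" for C
  proof -
    obtain v where C: "v < n" "C = {w \<in> {..<n}. (v, w) \<in> (mono_rel E col)\<^sup>*}"
      using CC unfolding mono_components_eq[OF sg] by auto
    have Lw: "(v, w) \<in> (mono_rel E col)\<^sup>* \<Longrightarrow> L w = L v" for w
      by (induction rule: rtrancl_induct) (use L in auto)
    have "card C = (\<Sum>y\<in>C. 1)" by simp
    also have "\<dots> \<le> (\<Sum>y\<in>C. if L y = L v then vertex_weight {..n} u s y else 0)"
    proof (rule sum_mono)
      fix y assume "y \<in> C"
      then have "L y = L v" "u y = 1" using C Lw[of y] U[of y] by auto
      then show "1 \<le> (if L y = L v then vertex_weight {..n} u s y else 0)" by (simp add: vertex_weight_def)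
    qed
    also have "\<dots> \<le> class_weight {..n} L (L v) (vertex_weight {..n} u s)"
      unfolding class_weight_def using C by (intro sum_mono2) auto
    also have "\<dots> \<le> m" using sol by (simp add: solution_def)
    finally show ?thesis .
  qed
  then show "\<exists>f. (\<forall>x<n. f x < N \<and> ok x (f x)) \<and> max_mono_size {..<n} E f \<le> m"
    using U by (intro exI[of _ col]) (auto simp: max_mono_size_le_iff[OF sg])
next
  assume "\<exists>f. (\<forall>x<n. f x < N \<and> ok x (f x)) \<and> max_mono_size {..<n} E f \<le> m"
  then obtain f where f: "\<forall>x<n. f x < N \<and> ok x (f x)" and mm: "\<forall>C\<in>mono_components {..<n} E f. card C \<le> m"
    by (auto simp: max_mono_size_le_iff[OF sg])
  define comp where "comp x = {w \<in> {..<n}. (x, w) \<in> (mono_rel E f)\<^sup>*}" for x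
  have symr: "sym ((mono_rel E f)\<^sup>*)"
    by (intro sym_rtrancl symI) (auto simp: mono_rel_def insert_commute)
  have comp_eq: "comp x = comp y" if "(x, y) \<in> (mono_rel E f)\<^sup>*" for x y
    using that symr unfolding comp_def by (auto dest: symD intro: rtrancl_trans)
  define col where "col = f(n := 0)"
  define u where "u x = (if x = n then 0 else 1 :: nat)" for x
  define k where "k x y = (if {x, y} \<in> E \<and> col x = col y then 1 else 0 :: nat)" for x y
  \<comment> \<open>The least vertex of a component represents it; the extra vertex gets
    \<open>n\<close>, a label of no other vertex.\<close>
  define L where "L x = (if x < n then Min (comp x) else n)" for x
  have Lin: "L x \<in> comp x" if "x < n" for x
  proof -
    have "x \<in> comp x" using that by (simp add: comp_def)
    then have "Min (comp x) \<in> comp x" by (intro Min_in) (auto simp: comp_def)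
    then show ?thesis using that by (simp add: L_def)
  qed
  have En: "x < n \<and> y < n \<and> x \<noteq> y" if "{x, y} \<in> E" for x y
    using sg that unfolding simple_graph_def by (fastforce simp: card_insert_if)
  have w: "vertex_weight {..n} u (\<lambda>x y. 0) y = u y" for y by (simp add: vertex_weight_def)
  have cw: "class_weight {..n} L l u \<le> m" for l
  proof (cases "l < n")
    case True
    have "class_weight {..n} L l u \<le> (\<Sum>y\<in>{..n}. if y \<in> comp l then 1 else 0)"
      unfolding class_weight_def
    proof (rule sum_mono)
      fix y assume "y \<in> {..n}"
      show "(if L y = l then u y else 0) \<le> (if y \<in> comp l then 1 else 0)"
      proof (cases "L y = l \<and> y \<noteq> n")
        case True
        then have "y < n" using \<open>y \<in> {..n}\<close> by auto
        then have "l \<in> comp y" using Lin[of y] True by auto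
        then have "y \<in> comp l" using symr \<open>y < n\<close> unfolding comp_def by (auto dest: symD)
        then show ?thesis by (simp add: u_def)
      qed (auto simp: u_def)
    qed
    also have "\<dots> = card (comp l)"
    proof -
      have "{..n} \<inter> comp l = comp l" by (auto simp: comp_def)
      then show ?thesis by (simp add: sum.If_cases)
    qed
    also have "\<dots> \<le> m" using mm True unfolding mono_components_eq[OF sg] comp_def by blast
    finally show ?thesis .
  next
    case False
    have "class_weight {..n} L l u = 0"
      unfolding class_weight_def
    proof (intro sum.neutral ballI)
      fix y assume y: "y \<in> {..n}"
      show "(if L y = l then u y else 0) = 0"
      proof (cases "y = n")
        case False
        then have "L y < n" using y Lin[of y] by (auto simp: comp_def)
        then show ?thesis using \<open>\<not> l < n\<close> by auto
      qed (simp add: u_def)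
    qed
    then show ?thesis by simp
  qed
  have "solution m {..n} (init_pairs N E) (init_vertices n N ok) col u k (\<lambda>x y. 0) L"
    unfolding solution_def
  proof (intro conjI ballI impI allI)
    fix x assume "x \<in> {..n}"
    then show "init_vertices n N ok x (col x) (u x)"
      using f N by (auto simp: init_vertices_def col_def u_def)
  next
    fix x y assume xy: "x \<in> {..n}" "y \<in> {..n}" "x \<noteq> y"
    show "init_pairs N E x y (col x) (col y) (k x y) 0 0"
      using xy f N by (auto simp: init_pairs_def col_def k_def)
    assume "k x y \<noteq> 0"
    then have e: "{x, y} \<in> E" "col x = col y" by (auto simp: k_def split: if_splits)
    then have "(x, y) \<in> mono_rel E f" using En[OF e(1)] by (auto simp: mono_rel_def col_def)
    then have "comp x = comp y" by (intro comp_eq) auto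
    then show "L x = L y" using En[OF e(1)] by (simp add: L_def)
  next
    fix l
    have "class_weight {..n} L l (vertex_weight {..n} u (\<lambda>x y. 0)) = class_weight {..n} L l u"
      by (intro class_weight_cong) (simp add: w)
    then show "class_weight {..n} L l (vertex_weight {..n} u (\<lambda>x y. 0)) \<le> m" using cw[of l] by simp
  qed
  then show "feasible m {..n} (init_pairs N E) (init_vertices n N ok)" unfolding feasible_def by blast
qed

lemma feasible_singleton: "feasible m {n} T U \<longleftrightarrow> (\<exists>c s. U n c s \<and> s \<le> m)"
proof
  assume "feasible m {n} T U"
  then obtain col u k s L where sol: "solution m {n} T U col u k s L" unfolding feasible_def by blast
  have "class_weight {n} L (L n) (vertex_weight {n} u s) \<le> m" using sol by (simp add: solution_def)
  then show "\<exists>c s. U n c s \<and> s \<le> m"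
    using sol by (auto simp: solution_def class_weight_def vertex_weight_def)
next
  assume "\<exists>c s. U n c s \<and> s \<le> m"
  then obtain c s where "U n c s" "s \<le> m" by blast
  then have "solution m {n} T U (\<lambda>_. c) (\<lambda>_. s) (\<lambda>_ _. 0) (\<lambda>_ _. 0) (\<lambda>_. 0)"
    by (auto simp: solution_def class_weight_def vertex_weight_def)
  then show "feasible m {n} T U" unfolding feasible_def by blast
qed

section \<open>Structured programs for the random access machine\<close>

datatype cmd = Op instr | Seq cmd cmd | Cond nat cmd cmd | Loop nat cmd

fun cmd_size :: "cmd \<Rightarrow> nat" where
  "cmd_size (Op i) = 1"
| "cmd_size (Seq a b) = cmd_size a + cmd_size b"
| "cmd_size (Cond r a b) = cmd_size a + cmd_size b + 2"
| "cmd_size (Loop r c) = cmd_size c + 6"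

text \<open>Register 1 holds the number of iterations of every loop, register 2 is scratch space of the
  loop control.\<close>

fun assemble :: "nat \<Rightarrow> cmd \<Rightarrow> instr list" where
  "assemble q (Op i) = [i]"
| "assemble q (Seq a b) = assemble q a @ assemble (q + cmd_size a) b"
| "assemble q (Cond r a b) = [JumpZero r (q + cmd_size a + 2)] @ assemble (q + 1) a @
     [Jump (q + cmd_size a + cmd_size b + 2)] @ assemble (q + cmd_size a + 2) b"
| "assemble q (Loop r c) = [Const r 0, Sub 2 1 r, JumpZero 2 (q + cmd_size c + 6)] @ assemble (q + 3) c @
     [Const 2 1, Add r r 2, Jump (q + 1)]"

lemma length_assemble: "length (assemble q c) = cmd_size c"
  by (induction c arbitrary: q) auto

type_synonym store = "(nat \<Rightarrow> nat) \<times> (nat \<Rightarrow> nat)"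

text \<open>The value \<open>N - i\<close> in register 2 is what the loop test leaves there, so
  \<open>exec\<close> describes exactly the registers that the body finds.\<close>

definition loop_body :: "nat \<Rightarrow> nat \<Rightarrow> (store \<Rightarrow> store) \<Rightarrow> nat \<Rightarrow> store \<Rightarrow> store" where
  "loop_body r N f i s = f ((fst s)(r := i, 2 := N - i), snd s)"

definition loop_end :: "nat \<Rightarrow> nat \<Rightarrow> store \<Rightarrow> store" where
  "loop_end r N s = ((fst s)(r := N, 2 := 0), snd s)"

fun exec :: "cmd \<Rightarrow> store \<Rightarrow> store" where
  "exec (Op i) s = snd (exec_instr i (0, s))"
| "exec (Seq a b) s = exec b (exec a s)"
| "exec (Cond r a b) s = (if fst s r = 0 then exec b s else exec a s)"
| "exec (Loop r c) s = loop_end r (fst s 1) (fold (loop_body r (fst s 1) (exec c)) [0..<fst s 1] s)"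

fun instr_writes :: "instr \<Rightarrow> nat set" where
  "instr_writes (Const i c) = {i}"
| "instr_writes (Add i j k) = {i}"
| "instr_writes (Sub i j k) = {i}"
| "instr_writes (Load i j) = {i}"
| "instr_writes _ = {}"

fun writes :: "cmd \<Rightarrow> nat set" where
  "writes (Op i) = instr_writes i"
| "writes (Seq a b) = writes a \<union> writes b"
| "writes (Cond r a b) = writes a \<union> writes b"
| "writes (Loop r c) = insert r (insert 2 (writes c))"

fun is_op :: "instr \<Rightarrow> bool" where
  "is_op (Jump l) = False"
| "is_op (JumpZero r l) = False"
| "is_op _ = True"

fun wf_cmd :: "cmd \<Rightarrow> bool" where
  "wf_cmd (Op i) = is_op i"
| "wf_cmd (Seq a b) = (wf_cmd a \<and> wf_cmd b)"
| "wf_cmd (Cond r a b) = (wf_cmd a \<and> wf_cmd b)"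
| "wf_cmd (Loop r c) = (wf_cmd c \<and> r \<noteq> 1 \<and> r \<noteq> 2 \<and> r \<notin> writes c \<and> 1 \<notin> writes c)"

text \<open>Both branches of a conditional are charged, so that the bound depends on
  \<open>N\<close> alone. A loop has five control instructions per round, and three more for the
  initialisation and the last test.\<close>

fun cost :: "cmd \<Rightarrow> nat \<Rightarrow> nat" where
  "cost (Op i) N = 1"
| "cost (Seq a b) N = cost a N + cost b N"
| "cost (Cond r a b) N = cost a N + cost b N + 2"
| "cost (Loop r c) N = N * (cost c N + 5) + 3"

lemma cost_poly: "\<exists>p :: nat poly. \<forall>n. cost c (n + 2) = poly p n"
proof (induction c)
  case (Op i)
  show ?case by (rule exI[of _ "[:1:]"]) simp
next
  case (Seq a b)
  then obtain p q :: "nat poly" where "\<forall>n. cost a (n + 2) = poly p n" "\<forall>n. cost b (n + 2) = poly q n" by blast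
  then show ?case by (intro exI[of _ "p + q"]) simp
next
  case (Cond r a b)
  then obtain p q :: "nat poly" where "\<forall>n. cost a (n + 2) = poly p n" "\<forall>n. cost b (n + 2) = poly q n" by blast
  then show ?case by (intro exI[of _ "p + q + [:2:]"]) simp
next
  case (Loop r c)
  then obtain p :: "nat poly" where "\<forall>n. cost c (n + 2) = poly p n" by blast
  then show ?case by (intro exI[of _ "[:2, 1:] * (p + [:5:]) + [:3:]"]) simp
qed

lemma fold_invariant:
  assumes "P 0 s" "\<And>i s. i < N \<Longrightarrow> P i s \<Longrightarrow> P (Suc i) (f i s)"
  shows "P N (fold f [0..<N] s)"
  using assms by (induction N) auto

lemma exec_writes: "r \<notin> writes c \<Longrightarrow> fst (exec c s) r = fst s r"
proof (induction c arbitrary: s)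
  case (Op i)
  then show ?case by (cases s; cases i) auto
next
  case (Loop r' c)
  have "fst (fold (loop_body r' (fst s 1) (exec c)) [0..<fst s 1] s) r = fst s r"
    by (rule fold_invariant) (use Loop in \<open>auto simp: loop_body_def\<close>)
  then show ?case using Loop by (auto simp: loop_end_def)
qed auto

lemma exec_unchanged: "exec c (R, M) = (R', M') \<Longrightarrow> writes c \<subseteq> X \<Longrightarrow> r \<notin> X \<Longrightarrow> R' r = R r"
  using exec_writes[of r c "(R, M)"] by (metis fst_conv subsetD)

section \<open>Correctness of the assembled code\<close>

definition code_at :: "instr list \<Rightarrow> nat \<Rightarrow> instr list \<Rightarrow> bool" where
  "code_at P q xs \<longleftrightarrow> (\<exists>A B. P = A @ xs @ B \<and> length A = q)"

lemma code_at_append: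
  "code_at P q (xs @ ys) \<longleftrightarrow> code_at P q xs \<and> code_at P (q + length xs) ys"
proof
  assume "code_at P q (xs @ ys)"
  then obtain A B where "P = A @ (xs @ ys) @ B" "length A = q" unfolding code_at_def by blast
  then have "P = A @ xs @ (ys @ B)" "P = (A @ xs) @ ys @ B" "length (A @ xs) = q + length xs" by auto
  then show "code_at P q xs \<and> code_at P (q + length xs) ys" unfolding code_at_def using \<open>length A = q\<close> by blast
next
  assume "code_at P q xs \<and> code_at P (q + length xs) ys"
  then obtain A B C D where 1: "P = A @ xs @ B" "length A = q" and 2: "P = C @ ys @ D" "length C = q + length xs"
    unfolding code_at_def by blast
  have "(A @ xs) @ B = C @ (ys @ D)" using 1 2 by simp
  then have "A @ xs = C" "B = ys @ D" using 1(2) 2(2) append_eq_append_conv[of "A @ xs" C B "ys @ D"] by auto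
  then have "P = A @ (xs @ ys) @ D" using 1 by simp
  then show "code_at P q (xs @ ys)" unfolding code_at_def using 1(2) by blast
qed

lemma code_at_Cons: "code_at P q (x # xs) \<longleftrightarrow> q < length P \<and> P ! q = x \<and> code_at P (Suc q) xs"
proof -
  have "code_at P q [x] \<longleftrightarrow> q < length P \<and> P ! q = x"
  proof
    assume "q < length P \<and> P ! q = x"
    then have "P = take q P @ [x] @ drop (Suc q) P" "length (take q P) = q" by (auto simp: id_take_nth_drop)
    then show "code_at P q [x]" unfolding code_at_def by blast
  qed (auto simp: code_at_def nth_append)
  then show ?thesis using code_at_append[of P q "[x]" xs] by simp
qed

definition reaches :: "instr list \<Rightarrow> nat \<Rightarrow> config \<Rightarrow> config \<Rightarrow> bool" where
  "reaches P t s s' \<longleftrightarrow> (\<exists>k\<le>t. (ram_step P ^^ k) s = s')"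

lemma reaches_trans:
  assumes "reaches P t s s'" "reaches P t' s' s''" shows "reaches P (t + t') s s''"
proof -
  obtain k k' where "k \<le> t" "(ram_step P ^^ k) s = s'" "k' \<le> t'" "(ram_step P ^^ k') s' = s''"
    using assms unfolding reaches_def by blast
  then have "(ram_step P ^^ (k' + k)) s = s''" "k' + k \<le> t + t'" by (auto simp: funpow_add)
  then show ?thesis unfolding reaches_def by blast
qed

lemma reaches_mono: "reaches P t s s' \<Longrightarrow> t \<le> t' \<Longrightarrow> reaches P t' s s'"
  unfolding reaches_def using le_trans by blast

lemma reaches_step:
  assumes "q < length P" "P ! q = i" shows "reaches P 1 (q, s) (exec_instr i (q, s))"
  unfolding reaches_def using assms
  by (intro exI[of _ 1]) (simp add: ram_step_def halted_def)

lemma exec_instr_op: "is_op i \<Longrightarrow> exec_instr i (q, s) = (Suc q, snd (exec_instr i (0, s)))"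
  by (cases s; cases i) auto

lemma assemble_correct:
  assumes "wf_cmd c" "code_at P q (assemble q c)" "1 \<notin> writes c"
  shows "reaches P (cost c (fst s 1)) (q, s) (q + cmd_size c, exec c s)"
  using assms
proof (induction c arbitrary: q s)
  case (Op i)
  then show ?case using reaches_step[of q P i s] exec_instr_op[of i q s] by (simp add: code_at_Cons)
next
  case (Seq a b)
  have "reaches P (cost a (fst s 1)) (q, s) (q + cmd_size a, exec a s)"
    using Seq by (auto simp: code_at_append)
  moreover have "reaches P (cost b (fst (exec a s) 1)) (q + cmd_size a, exec a s)
     (q + cmd_size a + cmd_size b, exec b (exec a s))"
    using Seq by (auto simp: code_at_append length_assemble)
  ultimately show ?case using reaches_trans Seq(5) by (fastforce simp: exec_writes add.assoc)
next
  case (Cond r a b)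
  have code: "q < length P" "P ! q = JumpZero r (q + cmd_size a + 2)" "code_at P (q + 1) (assemble (q + 1) a)"
    "q + 1 + cmd_size a < length P" "P ! (q + 1 + cmd_size a) = Jump (q + cmd_size a + cmd_size b + 2)"
    "code_at P (q + cmd_size a + 2) (assemble (q + cmd_size a + 2) b)"
    using Cond(4) by (auto simp: code_at_append code_at_Cons length_assemble)
  have st: "reaches P 1 (q, s) (if fst s r = 0 then q + cmd_size a + 2 else q + 1, s)"
    using reaches_step[OF code(1,2), of s] by (cases s) auto
  show ?case
  proof (cases "fst s r = 0")
    case True
    have "reaches P (cost b (fst s 1)) (q + cmd_size a + 2, s) (q + cmd_size a + 2 + cmd_size b, exec b s)"
      using Cond.IH(2)[OF _ code(6), of s] Cond.prems by simp
    from reaches_trans[OF st[unfolded if_P[OF True]] this] show ?thesis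
      using True by (auto simp: algebra_simps intro: reaches_mono)
  next
    case False
    have 1: "reaches P (cost a (fst s 1)) (q + 1, s) (q + 1 + cmd_size a, exec a s)"
      using Cond.IH(1)[OF _ code(3), of s] Cond.prems by simp
    have 2: "reaches P 1 (q + 1 + cmd_size a, exec a s) (q + cmd_size a + cmd_size b + 2, exec a s)"
      using reaches_step[OF code(4,5), of "exec a s"] by (cases "exec a s") auto
    from reaches_trans[OF reaches_trans[OF st[unfolded if_not_P[OF False]] 1] 2] show ?thesis
      using False by (auto simp: algebra_simps intro: reaches_mono)
  qed
next
  case (Loop r c)
  let ?N = "fst s 1"
  let ?l = "q + 3 + cmd_size c"
  have wf: "wf_cmd c" "r \<noteq> 1" "r \<noteq> 2" "r \<notin> writes c" "1 \<notin> writes c" using Loop by auto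
  have code: "q < length P" "P ! q = Const r 0" "q + 1 < length P" "P ! (q + 1) = Sub 2 1 r"
    "q + 2 < length P" "P ! (q + 2) = JumpZero 2 (q + cmd_size c + 6)"
    "code_at P (q + 3) (assemble (q + 3) c)"
    "?l < length P" "P ! ?l = Const 2 1" "?l + 1 < length P" "P ! (?l + 1) = Add r r 2"
    "?l + 2 < length P" "P ! (?l + 2) = Jump (q + 1)"
    using Loop(3) by (auto simp: code_at_append code_at_Cons length_assemble eval_nat_numeral)
  \<comment> \<open>Between rounds the machine and \<open>exec\<close> may differ in the counter
    \<open>r\<close> and in register 2; both are set again at the start of the next round. The
    initial 1 in the time bound pays for \<open>Const r 0\<close>.\<close>
  define Q where "Q i s' \<longleftrightarrow> fst s' 1 = ?N \<and>
    (\<exists>R. reaches P (1 + i * (cost c ?N + 5)) (q, s) (q + 1, R, snd s') \<and> R r = i \<and>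
      (\<forall>x. x \<noteq> r \<and> x \<noteq> 2 \<longrightarrow> R x = fst s' x))" for i and s' :: store
  have "Q ?N (fold (loop_body r ?N (exec c)) [0..<?N] s)"
  proof (rule fold_invariant)
    show "Q 0 s"
      using reaches_step[OF code(1,2), of s] unfolding Q_def by (cases s) auto
    fix i and s' :: store assume i: "i < ?N" and "Q i s'"
    then obtain R where R: "reaches P (1 + i * (cost c ?N + 5)) (q, s) (q + 1, R, snd s')" "R r = i"
      "\<forall>x. x \<noteq> r \<and> x \<noteq> 2 \<longrightarrow> R x = fst s' x" and N: "fst s' 1 = ?N" unfolding Q_def by blast
    have R1: "R 1 = ?N" using R(3) N wf by auto
    let ?s1 = "((fst s')(r := i, 2 := ?N - i), snd s')"
    have eqR: "R(2 := ?N - i) = (fst s')(r := i, 2 := ?N - i)" using R by (auto simp: fun_eq_iff)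
    have 1: "reaches P 1 (q + 1, R, snd s') (q + 2, ?s1)"
      using reaches_step[OF code(3,4), of "(R, snd s')"] R1 R(2) eqR by simp
    have 2: "reaches P 1 (q + 2, ?s1) (q + 3, ?s1)"
      using reaches_step[OF code(5,6), of ?s1] i by (simp add: eval_nat_numeral)
    have 3: "reaches P (cost c ?N) (q + 3, ?s1) (?l, exec c ?s1)"
      using Loop.IH[OF wf(1) code(7) wf(5), of ?s1] N wf by simp
    obtain R2 M2 where s2: "exec c ?s1 = (R2, M2)" by fastforce
    have R2: "R2 r = i" "R2 1 = ?N"
      using exec_writes[OF wf(4), of ?s1] exec_writes[OF wf(5), of ?s1] s2 N wf by auto
    have 4: "reaches P 1 (?l, R2, M2) (?l + 1, R2(2 := 1), M2)"
      using reaches_step[OF code(8,9), of "(R2, M2)"] by simp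
    have 5: "reaches P 1 (?l + 1, R2(2 := 1), M2) (?l + 2, R2(2 := 1, r := Suc i), M2)"
      using reaches_step[OF code(10,11), of "(R2(2 := 1), M2)"] R2 wf by (simp add: eval_nat_numeral)
    have 6: "reaches P 1 (?l + 2, R2(2 := 1, r := Suc i), M2) (q + 1, R2(2 := 1, r := Suc i), M2)"
      using reaches_step[OF code(12,13), of "(R2(2 := 1, r := Suc i), M2)"] by simp
    have "reaches P ((1 + i * (cost c ?N + 5)) + 1 + 1 + cost c ?N + 1 + 1 + 1) (q, s) (q + 1, R2(2 := 1, r := Suc i), M2)"
      by (rule reaches_trans[OF reaches_trans[OF reaches_trans[OF reaches_trans[OF reaches_trans[OF reaches_trans[OF R(1) 1] 2] 3[unfolded s2]] 4] 5] 6])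
    then have "reaches P (1 + Suc i * (cost c ?N + 5)) (q, s) (q + 1, R2(2 := 1, r := Suc i), M2)"
      by (rule reaches_mono) simp
    then show "Q (Suc i) (loop_body r ?N (exec c) i s')"
      unfolding Q_def loop_body_def s2 using R2 by auto
  qed
  then obtain R where R: "reaches P (1 + ?N * (cost c ?N + 5)) (q, s) (q + 1, R, snd (fold (loop_body r ?N (exec c)) [0..<?N] s))" "R r = ?N"
    "\<forall>x. x \<noteq> r \<and> x \<noteq> 2 \<longrightarrow> R x = fst (fold (loop_body r ?N (exec c)) [0..<?N] s) x"
    and N: "fst (fold (loop_body r ?N (exec c)) [0..<?N] s) 1 = ?N" unfolding Q_def by blast
  obtain R' M' where s': "fold (loop_body r ?N (exec c)) [0..<?N] s = (R', M')" by fastforce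
  have eqR: "R(2 := 0) = R'(r := ?N, 2 := 0)" using R s' by (auto simp: fun_eq_iff)
  have "R 1 = ?N" using R(3) N wf by auto
  then have 1: "reaches P 1 (q + 1, R, M') (q + 2, R(2 := 0), M')"
    using reaches_step[OF code(3,4), of "(R, M')"] R(2) by simp
  have 2: "reaches P 1 (q + 2, R(2 := 0), M') (q + cmd_size c + 6, R(2 := 0), M')"
    using reaches_step[OF code(5,6), of "(R(2 := 0), M')"] by simp
  have "reaches P (1 + ?N * (cost c ?N + 5) + 1 + 1) (q, s) (q + cmd_size c + 6, R(2 := 0), M')"
    using reaches_trans[OF reaches_trans[OF R(1)[unfolded s' snd_conv] 1] 2] .
  then show ?case
    unfolding exec.simps s' loop_end_def fst_conv snd_conv eqR cmd_size.simps cost.simps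
    by (simp add: add.assoc add.commute numeral_3_eq_3)
qed

section \<open>First-order programs over a finite domain\<close>

datatype fm =
    LeS "nat list" "nat list"
  | Rel nat "nat list"
  | Inp nat nat
  | Neg fm
  | And fm fm
  | Exists nat fm

type_synonym rels = "nat \<Rightarrow> nat list \<Rightarrow> bool"

text \<open>\<open>LeS xs ys\<close> compares the sums of the variables in \<open>xs\<close> and \<open>ys\<close>, and \<open>Inp x y\<close> reads the adjacency
  matrix, whose rows have length \<open>N - 2\<close>. Variables are de Bruijn levels: a quantifier at level \<open>d\<close>
  binds variable \<open>d\<close>. All relations have the same arity, so that the leading digit \<open>r + 1\<close> of an
  address separates them; a relation of smaller arity repeats its last argument.\<close>

definition arity :: nat where "arity = 7"

fun sat :: "nat \<Rightarrow> (nat \<Rightarrow> bool) \<Rightarrow> rels \<Rightarrow> (nat \<Rightarrow> nat) \<Rightarrow> fm \<Rightarrow> bool" where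
  "sat N inp I e (LeS xs ys) \<longleftrightarrow> sum_list (map e xs) \<le> sum_list (map e ys)"
| "sat N inp I e (Rel r xs) \<longleftrightarrow> I r (map e xs)"
| "sat N inp I e (Inp x y) \<longleftrightarrow> inp (e x * (N - 2) + e y)"
| "sat N inp I e (Neg \<phi>) \<longleftrightarrow> \<not> sat N inp I e \<phi>"
| "sat N inp I e (And \<phi> \<psi>) \<longleftrightarrow> sat N inp I e \<phi> \<and> sat N inp I e \<psi>"
| "sat N inp I e (Exists x \<phi>) \<longleftrightarrow> (\<exists>i<N. sat N inp I (e(x := i)) \<phi>)"

fun wf_fm :: "nat \<Rightarrow> fm \<Rightarrow> bool" where
  "wf_fm d (LeS xs ys) \<longleftrightarrow> (\<forall>x\<in>set xs \<union> set ys. x < d)"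
| "wf_fm d (Rel r xs) \<longleftrightarrow> length xs = arity \<and> (\<forall>x\<in>set xs. x < d)"
| "wf_fm d (Inp x y) \<longleftrightarrow> x < d \<and> y < d"
| "wf_fm d (Neg \<phi>) \<longleftrightarrow> wf_fm d \<phi>"
| "wf_fm d (And \<phi> \<psi>) \<longleftrightarrow> wf_fm d \<phi> \<and> wf_fm d \<psi>"
| "wf_fm d (Exists x \<phi>) \<longleftrightarrow> x = d \<and> wf_fm (Suc d) \<phi>"

fun rels_fm :: "fm \<Rightarrow> nat set" where
  "rels_fm (Rel r xs) = {r}"
| "rels_fm (Neg \<phi>) = rels_fm \<phi>"
| "rels_fm (And \<phi> \<psi>) = rels_fm \<phi> \<union> rels_fm \<psi>"
| "rels_fm (Exists x \<phi>) = rels_fm \<phi>"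
| "rels_fm _ = {}"

text \<open>Registers below 10 are reserved for the machine's conventions and scratch values. From
  10 on, even registers hold the variables, and the odd register next to a variable is the
  accumulator of its quantifier.\<close>

definition var_reg :: "nat \<Rightarrow> nat" where "var_reg x = 2 * x + 10"
definition flag_reg :: "nat \<Rightarrow> nat" where "flag_reg x = 2 * x + 11"

text \<open>The registers that code at level \<open>d\<close> may overwrite; the outer variables and
  their accumulators are not among them.\<close>

definition level_regs :: "nat \<Rightarrow> nat set" where
  "level_regs d = {2..7} \<union> {r. var_reg d \<le> r}"

fun sum_cmd :: "nat \<Rightarrow> nat list \<Rightarrow> cmd" where
  "sum_cmd t [] = Op (Const t 0)"
| "sum_cmd t (x # xs) = Seq (sum_cmd t xs) (Op (Add t t (var_reg x)))"

text \<open>Multiplication by \<open>N\<close>: every loop has \<open>N\<close> rounds, so the loop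
  itself supplies the factor.\<close>

definition mul_cmd :: "nat \<Rightarrow> cmd" where
  "mul_cmd x = Seq (Op (Const 5 0)) (Loop 6 (Op (Add 5 5 x)))"

fun horner_cmd :: "nat list \<Rightarrow> cmd" where
  "horner_cmd [] = Op (Const 7 0)"
| "horner_cmd (x # xs) = Seq (Seq (mul_cmd 4) (Op (Add 4 5 (var_reg x)))) (horner_cmd xs)"

text \<open>A formula is true if register 3 ends up nonzero. Because subtraction is truncated,
  \<open>x \<le> y\<close> becomes \<open>(y + 1) - x \<noteq> 0\<close>. A quantifier adds up the
  truth values of its body. \<open>Const 7 0\<close> serves as an empty instruction, or as the
  summand 0 that turns an addition into a copy.\<close>

fun fm_cmd :: "fm \<Rightarrow> cmd" where
  "fm_cmd (LeS xs ys) = Seq (sum_cmd 4 xs) (Seq (sum_cmd 5 ys)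
     (Seq (Op (Const 7 1)) (Seq (Op (Add 5 5 7)) (Op (Sub 3 5 4)))))"
| "fm_cmd (Rel r xs) = Seq (Op (Const 4 (r + 1))) (Seq (horner_cmd xs) (Op (Load 3 4)))"
| "fm_cmd (Inp x y) = Seq (mul_cmd (var_reg x)) (Seq (Op (Sub 5 5 (var_reg x))) (Seq (Op (Sub 5 5 (var_reg x)))
     (Seq (Op (Add 5 5 (var_reg y))) (Op (Load 3 5)))))"
| "fm_cmd (Neg \<phi>) = Seq (fm_cmd \<phi>) (Seq (Op (Const 7 1)) (Op (Sub 3 7 3)))"
| "fm_cmd (And \<phi> \<psi>) = Seq (fm_cmd \<phi>) (Cond 3 (fm_cmd \<psi>) (Op (Const 7 0)))"
| "fm_cmd (Exists x \<phi>) = Seq (Op (Const (flag_reg x) 0)) (Seq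
     (Loop (var_reg x) (Seq (fm_cmd \<phi>) (Op (Add (flag_reg x) (flag_reg x) 3))))
     (Seq (Op (Const 7 0)) (Op (Add 3 (flag_reg x) 7))))"

lemma writes_sum_cmd: "writes (sum_cmd t xs) = {t}" and wf_sum_cmd: "wf_cmd (sum_cmd t xs)"
  by (induction xs) auto

lemma writes_horner_cmd: "writes (horner_cmd xs) \<subseteq> {2, 4, 5, 6, 7}" and wf_horner_cmd: "wf_cmd (horner_cmd xs)"
  by (induction xs) (auto simp: mul_cmd_def)

lemma level_regs_Suc: "level_regs (Suc d) \<subseteq> level_regs d"
  by (auto simp: level_regs_def var_reg_def)

lemma writes_fm_cmd: "wf_fm d \<phi> \<Longrightarrow> writes (fm_cmd \<phi>) \<subseteq> level_regs d"
proof (induction \<phi> arbitrary: d)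
  case (Rel r xs)
  then show ?case using writes_horner_cmd[of xs] by (auto simp: level_regs_def)
next
  case (Exists x \<phi>)
  then have "writes (fm_cmd \<phi>) \<subseteq> level_regs d" using level_regs_Suc by fastforce
  then show ?case using Exists by (auto simp: level_regs_def var_reg_def flag_reg_def)
qed (auto simp: writes_sum_cmd level_regs_def mul_cmd_def; fastforce simp: level_regs_def)+

lemma wf_fm_cmd: "wf_fm d \<phi> \<Longrightarrow> wf_cmd (fm_cmd \<phi>)"
proof (induction \<phi> arbitrary: d)
  case (Exists x \<phi>)
  then have "writes (fm_cmd \<phi>) \<subseteq> level_regs (Suc d)" by (intro writes_fm_cmd) auto
  then show ?case using Exists by (auto simp: level_regs_def var_reg_def flag_reg_def)
qed (auto simp: wf_sum_cmd wf_horner_cmd mul_cmd_def var_reg_def)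

section \<open>Addresses of table entries\<close>

definition address :: "nat \<Rightarrow> nat \<Rightarrow> nat list \<Rightarrow> nat" where
  "address N r ds = foldl (\<lambda>a d. a * N + d) (r + 1) ds"

definition digits :: "nat \<Rightarrow> nat list \<Rightarrow> bool" where
  "digits N ds \<longleftrightarrow> length ds = arity \<and> (\<forall>d\<in>set ds. d < N)"

text \<open>The digit lists have equal length, so comparing digits modulo \<open>N\<close> also
  identifies the leading parts \<open>a\<close> and \<open>b\<close>. These need not be below
  \<open>N\<close>, and indeed a relation number may exceed \<open>N\<close>.\<close>

lemma foldl_digits_inj:
  fixes a b N :: nat
  assumes "length xs = length ys" "\<forall>d\<in>set xs. d < N" "\<forall>d\<in>set ys. d < N"
    "foldl (\<lambda>a d. a * N + d) a xs = foldl (\<lambda>a d. a * N + d) b ys"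
  shows "a = b \<and> xs = ys"
  using assms
proof (induction xs ys arbitrary: a b rule: list_induct2)
  case (Cons x xs y ys)
  have *: "x < N" "y < N" using Cons.prems by auto
  have "a * N + x = b * N + y \<and> xs = ys" using Cons.IH[of "a * N + x" "b * N + y"] Cons.prems by simp
  note * = * conjunct1[OF this] conjunct2[OF this]
  have "x = (a * N + x) mod N" "y = (b * N + y) mod N" using *(1,2) by simp_all
  then have "x = y" using *(3) by simp
  then show ?case using * by simp
qed auto

lemma address_inj:
  "digits N ds \<Longrightarrow> digits N ds' \<Longrightarrow> address N r ds = address N r' ds' \<longleftrightarrow> r = r' \<and> ds = ds'"
proof
  assume ds: "digits N ds" "digits N ds'" and "address N r ds = address N r' ds'"
  then have "r + 1 = r' + 1 \<and> ds = ds'"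
    unfolding address_def digits_def by (intro foldl_digits_inj[of ds ds' N]) simp_all
  then show "r = r' \<and> ds = ds'" by simp
qed simp

lemma foldl_digits_ge: "a * N ^ length ds \<le> foldl (\<lambda>a d. a * N + d) (a :: nat) ds"
proof (induction ds arbitrary: a)
  case (Cons d ds)
  have "a * N ^ length (d # ds) \<le> (a * N + d) * N ^ length ds" by (simp add: algebra_simps)
  also have "\<dots> \<le> foldl (\<lambda>a d. a * N + d) (a * N + d) ds" by (rule Cons)
  finally show ?case by simp
qed simp

text \<open>The leading part \<open>r + 1\<close> is positive and seven digits follow, so the
  address is at least \<open>N ^ 7\<close>. The tables thus lie beyond the adjacency matrix.\<close>

lemma address_ge:
  assumes "digits N ds" "0 < N" shows "N * N \<le> address N r ds"
proof -
  have "N * N * 1 \<le> (N * N) * N ^ 5" using assms(2) by (intro mult_le_mono2) simp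
  also have "\<dots> \<le> (r + 1) * N ^ arity" by (simp add: arity_def eval_nat_numeral algebra_simps)
  also have "\<dots> \<le> address N r ds" using foldl_digits_ge[of "r + 1" N ds] assms unfolding address_def digits_def by simp
  finally show ?thesis by simp
qed

definition represents :: "nat \<Rightarrow> (nat \<Rightarrow> bool) \<Rightarrow> rels \<Rightarrow> (nat \<Rightarrow> nat) \<Rightarrow> bool" where
  "represents N inp I M \<longleftrightarrow> (\<forall>a < N * N. inp a \<longleftrightarrow> M a \<noteq> 0) \<and>
     (\<forall>r ds. digits N ds \<longrightarrow> (I r ds \<longleftrightarrow> M (address N r ds) \<noteq> 0))"

definition env_ok :: "nat \<Rightarrow> nat \<Rightarrow> (nat \<Rightarrow> nat) \<Rightarrow> (nat \<Rightarrow> nat) \<Rightarrow> bool" where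
  "env_ok N d e R \<longleftrightarrow> R 1 = N \<and> (\<forall>x<d. R (var_reg x) = e x \<and> e x < N)"

lemma var_reg_neq [simp]:
  "var_reg x \<noteq> 1" "var_reg x \<noteq> Suc 0" "var_reg x \<noteq> 2" "var_reg x \<noteq> 3" "var_reg x \<noteq> 4" "var_reg x \<noteq> 5" "var_reg x \<noteq> 6"
  "var_reg x \<noteq> 7"
  by (simp_all add: var_reg_def)

lemma exec_sum_cmd:
  assumes "t < 10" shows "exec (sum_cmd t xs) (R, M) = (R(t := sum_list (map (\<lambda>x. R (var_reg x)) xs)), M)"
  using assms by (induction xs) (auto simp: fun_eq_iff var_reg_def)

lemma exec_mul_cmd:
  assumes "x \<notin> {2, 5, 6}"
  shows "\<exists>R'. exec (mul_cmd x) (R, M) = (R', M) \<and> R' 5 = R 1 * R x \<and> (\<forall>y. y \<notin> {2, 5, 6} \<longrightarrow> R' y = R y)"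
proof -
  let ?R = "R(5 := 0)" and ?body = "Op (Add 5 5 x)"
  define Q where "Q i s \<longleftrightarrow> snd s = M \<and> fst s 5 = i * R x \<and> (\<forall>y. y \<notin> {2, 5, 6} \<longrightarrow> fst s y = R y)" for i and s :: store
  have "Q (R 1) (fold (loop_body 6 (R 1) (exec ?body)) [0..<R 1] (?R, M))"
  proof (rule fold_invariant)
    show "Q 0 (?R, M)" by (simp add: Q_def)
    fix i s assume "Q i s"
    moreover obtain R' M' where "s = (R', M')" by fastforce
    ultimately show "Q (Suc i) (loop_body 6 (R 1) (exec ?body) i s)"
      using assms by (simp add: Q_def loop_body_def)
  qed
  moreover obtain R' M' where R': "fold (loop_body 6 (R 1) (exec ?body)) [0..<R 1] (?R, M) = (R', M')" by fastforce
  ultimately have q: "M' = M" "R' 5 = R 1 * R x" "\<forall>y. y \<notin> {2, 5, 6} \<longrightarrow> R' y = R y" by (simp_all add: Q_def)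
  have "exec (mul_cmd x) (R, M) = loop_end 6 (R 1) (fold (loop_body 6 (R 1) (exec ?body)) [0..<R 1] (?R, M))"
    by (simp add: mul_cmd_def)
  also have "\<dots> = (R'(6 := R 1, 2 := 0), M)" unfolding R' using q by (simp add: loop_end_def)
  finally show ?thesis using q by simp
qed

lemma exec_horner_cmd:
  "\<exists>R'. exec (horner_cmd xs) (R, M) = (R', M) \<and>
    R' 4 = foldl (\<lambda>a d. a * R 1 + d) (R 4) (map (\<lambda>x. R (var_reg x)) xs) \<and>
    (\<forall>y. y \<notin> {2, 4, 5, 6, 7} \<longrightarrow> R' y = R y)"
proof (induction xs arbitrary: R)
  case (Cons x xs)
  obtain R1 where R1: "exec (mul_cmd 4) (R, M) = (R1, M)" "R1 5 = R 1 * R 4" "\<forall>y. y \<notin> {2, 5, 6} \<longrightarrow> R1 y = R y"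
    using exec_mul_cmd[of 4 R M] by auto
  let ?R2 = "R1(4 := R1 5 + R1 (var_reg x))"
  obtain R3 where R3: "exec (horner_cmd xs) (?R2, M) = (R3, M)"
    "R3 4 = foldl (\<lambda>a d. a * ?R2 1 + d) (?R2 4) (map (\<lambda>x. ?R2 (var_reg x)) xs)"
    "\<forall>y. y \<notin> {2, 4, 5, 6, 7} \<longrightarrow> R3 y = ?R2 y"
    using Cons[of ?R2] by blast
  have "?R2 (var_reg z) = R (var_reg z)" for z using R1(3) by (auto simp: var_reg_def)
  moreover have "R1 (var_reg z) = R (var_reg z)" for z using R1(3) by (auto simp: var_reg_def)
  moreover have "?R2 1 = R 1" using R1(3) by auto
  ultimately have "R3 4 = foldl (\<lambda>a d. a * R 1 + d) (R 4) (map (\<lambda>x. R (var_reg x)) (x # xs))"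
    using R3(2) R1(2) by (simp add: mult.commute)
  then show ?case using R1 R3 by auto
qed auto

lemma fm_cmd_correct:
  assumes "wf_fm d \<phi>" "env_ok N d e R" "represents N inp I M" "2 \<le> N"
  shows "\<exists>R'. exec (fm_cmd \<phi>) (R, M) = (R', M) \<and> (R' 3 \<noteq> 0 \<longleftrightarrow> sat N inp I e \<phi>)"
  using assms
proof (induction \<phi> arbitrary: d e R)
  case (LeS xs ys)
  have "(\<Sum>x\<leftarrow>zs. R (var_reg x)) = sum_list (map e zs)" if "\<forall>x\<in>set zs. x < d" for zs
    using LeS that by (intro arg_cong[where f = sum_list] map_cong) (auto simp: env_ok_def)
  from this[of xs] this[of ys] show ?case using LeS by (simp add: exec_sum_cmd less_Suc_eq_le)
next
  case (Rel r xs)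
  let ?R = "R(4 := r + 1)"
  obtain R' where R': "exec (horner_cmd xs) (?R, M) = (R', M)"
    "R' 4 = foldl (\<lambda>a d. a * ?R 1 + d) (?R 4) (map (\<lambda>x. ?R (var_reg x)) xs)"
    using exec_horner_cmd[of xs ?R M] by blast
  have m: "map (\<lambda>x. ?R (var_reg x)) xs = map e xs" using Rel by (auto simp: env_ok_def)
  have "?R 1 = N" "?R 4 = r + 1" using Rel by (auto simp: env_ok_def)
  then have "R' 4 = address N r (map e xs)" using R'(2) unfolding m address_def by simp
  moreover have "digits N (map e xs)" using Rel by (auto simp: digits_def env_ok_def)
  ultimately show ?case using R'(1) Rel(3) by (auto simp: represents_def)
next
  case (Inp x y)
  obtain R' where R': "exec (mul_cmd (var_reg x)) (R, M) = (R', M)" "R' 5 = R 1 * R (var_reg x)"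
    "\<forall>y. y \<notin> {2, 5, 6} \<longrightarrow> R' y = R y"
    using exec_mul_cmd[of "var_reg x" R M] by (auto simp: var_reg_def)
  have eqs: "R (var_reg x) = e x" "R (var_reg y) = e y" "R 1 = N" "e x < N" "e y < N" using Inp by (auto simp: env_ok_def)
  have R'v: "R' (var_reg z) = R (var_reg z)" for z using R'(3) by (auto simp: var_reg_def)
  obtain k where k: "N = k + 2" using Inp(4) by (metis add.commute le_Suc_ex)
  \<comment> \<open>Rows have length \<open>N - 2\<close>, but loops multiply by \<open>N\<close>;
    the excess is removed by subtracting \<open>e x\<close> twice.\<close>
  have ad: "N * e x - e x - e x + e y = e x * (N - 2) + e y" unfolding k by (simp add: algebra_simps)
  have "e x * (N - 2) + e y < N * N"
  proof -
    have "e x * (N - 2) \<le> N * (N - 2)" using eqs by simp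
    moreover have "N * (N - 2) + N \<le> N * N" unfolding k by (simp add: algebra_simps)
    ultimately show ?thesis using eqs by linarith
  qed
  then have "inp (e x * (N - 2) + e y) \<longleftrightarrow> M (e x * (N - 2) + e y) \<noteq> 0"
    using Inp(3) unfolding represents_def by blast
  moreover have v: "var_reg z \<noteq> 5" for z by (simp add: var_reg_def)
  ultimately show ?case using R' ad eqs R'v by simp
next
  case (Neg \<phi>)
  obtain R' where "exec (fm_cmd \<phi>) (R, M) = (R', M)" "R' 3 \<noteq> 0 \<longleftrightarrow> sat N inp I e \<phi>"
    using Neg.IH[OF _ Neg.prems(2-4)] Neg.prems(1) by auto
  then show ?case by auto
next
  case (And \<phi> \<psi>)
  obtain R' where R': "exec (fm_cmd \<phi>) (R, M) = (R', M)" "R' 3 \<noteq> 0 \<longleftrightarrow> sat N inp I e \<phi>"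
    using And.IH(1)[OF _ And.prems(2-4)] And.prems(1) by auto
  have "env_ok N d e R'"
  proof -
    have "R' r = R r" if "r \<notin> level_regs d" for r
      by (rule exec_unchanged[OF R'(1) writes_fm_cmd[of d] that]) (use And(3) in simp)
    then show ?thesis using And(4) by (auto simp: env_ok_def level_regs_def var_reg_def)
  qed
  then obtain R2 where "exec (fm_cmd \<psi>) (R', M) = (R2, M)" "R2 3 \<noteq> 0 \<longleftrightarrow> sat N inp I e \<psi>"
    using And(2)[of d e R'] And(3,5,6) by auto
  then show ?case using R' by auto
next
  case (Exists x \<phi>)
  have x: "x = d" and wf: "wf_fm (Suc d) \<phi>" using Exists by auto
  let ?body = "Seq (fm_cmd \<phi>) (Op (Add (flag_reg x) (flag_reg x) 3))"
  let ?R = "R(flag_reg x := 0)"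
  have N: "?R 1 = N" using Exists by (auto simp: env_ok_def flag_reg_def)
  define Q where "Q i s \<longleftrightarrow> snd s = M \<and> env_ok N d e (fst s) \<and>
     (fst s (flag_reg x) \<noteq> 0 \<longleftrightarrow> (\<exists>j<i. sat N inp I (e(x := j)) \<phi>))" for i and s :: store
  have "Q N (fold (loop_body (var_reg x) N (exec ?body)) [0..<N] (?R, M))"
  proof (rule fold_invariant)
    show "Q 0 (?R, M)" using Exists by (auto simp: Q_def env_ok_def flag_reg_def var_reg_def) (presburger)?
    fix i s assume i: "i < N" and Q: "Q i s"
    let ?R1 = "(fst s)(var_reg x := i, 2 := N - i)"
    have "env_ok N (Suc d) (e(x := i)) ?R1"
      using Q i x by (auto simp: Q_def env_ok_def var_reg_def less_Suc_eq)
    then obtain R' where R': "exec (fm_cmd \<phi>) (?R1, M) = (R', M)" "R' 3 \<noteq> 0 \<longleftrightarrow> sat N inp I (e(x := i)) \<phi>"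
      using Exists(1)[OF wf] Exists(4,5) by blast
    have un: "R' r = ?R1 r" if "r \<notin> level_regs (Suc d)" for r
      by (rule exec_unchanged[OF R'(1) writes_fm_cmd[OF wf] that])
    \<comment> \<open>The accumulator of level \<open>d\<close> is the register just below
      \<open>var_reg (Suc d)\<close>, so the body cannot overwrite it.\<close>
    have "R' (flag_reg x) = fst s (flag_reg x)"
      using un[of "flag_reg x"] x by (auto simp: level_regs_def var_reg_def flag_reg_def split: if_splits) (presburger)?
    moreover have "R' 1 = N" using un[of 1] Q by (auto simp: level_regs_def var_reg_def Q_def env_ok_def)
    moreover have "R' (var_reg y) = e y \<and> e y < N" if "y < d" for y
      using un[of "var_reg y"] Q x that by (auto simp: level_regs_def var_reg_def Q_def env_ok_def)
    moreover have "snd s = M" using Q by (simp add: Q_def)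
    moreover have "var_reg y \<noteq> flag_reg x" for y unfolding var_reg_def flag_reg_def by presburger
    moreover have "flag_reg x \<noteq> 1" by (simp add: flag_reg_def)
    ultimately show "Q (Suc i) (loop_body (var_reg x) N (exec ?body) i s)"
      using Q R' unfolding Q_def loop_body_def env_ok_def by (auto simp: less_Suc_eq)
  qed
  moreover obtain R2 M2 where R2: "fold (loop_body (var_reg x) N (exec ?body)) [0..<N] (?R, M) = (R2, M2)" by fastforce
  ultimately have q: "M2 = M" "R2 (flag_reg x) \<noteq> 0 \<longleftrightarrow> (\<exists>j<N. sat N inp I (e(x := j)) \<phi>)" by (auto simp: Q_def)
  have ne: "flag_reg x \<noteq> var_reg x" "flag_reg x \<noteq> 2" "flag_reg x \<noteq> 7" unfolding var_reg_def flag_reg_def by presburger+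
  have "exec (Loop (var_reg x) ?body) (?R, M) = (R2(var_reg x := N, 2 := 0), M)"
    using R2 N q(1) by (simp add: loop_end_def del: exec.simps(1,2))
  then show ?case using q(2) ne by (simp del: exec.simps(4))
qed

section \<open>Programs that update relations\<close>

datatype prog =
    Put nat "nat list" fm
  | Assign nat nat fm
  | PSeq prog prog
  | PIf fm prog
  | PFor nat prog

text \<open>\<open>Assign d r \<phi>\<close> replaces relation \<open>r\<close> by the set of tuples that satisfy \<open>\<phi>\<close> when assigned to the
  variables \<open>d\<close>, \<open>d + 1\<close>, \<dots>; it is compiled to nested loops around \<open>Put\<close>, which sets a single tuple.\<close>

definition args_env :: "(nat \<Rightarrow> nat) \<Rightarrow> nat \<Rightarrow> nat list \<Rightarrow> nat \<Rightarrow> nat" where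
  "args_env e d ds x = (if d \<le> x \<and> x < d + arity then ds ! (x - d) else e x)"

fun run :: "nat \<Rightarrow> (nat \<Rightarrow> bool) \<Rightarrow> prog \<Rightarrow> (nat \<Rightarrow> nat) \<Rightarrow> rels \<Rightarrow> rels" where
  "run N inp (Put r xs \<phi>) e I = I(r := (I r)(map e xs := sat N inp I e \<phi>))"
| "run N inp (Assign d r \<phi>) e I = I(r := \<lambda>ds. digits N ds \<and> sat N inp I (args_env e d ds) \<phi>)"
| "run N inp (PSeq p q) e I = run N inp q e (run N inp p e I)"
| "run N inp (PIf \<phi> p) e I = (if sat N inp I e \<phi> then run N inp p e I else I)"
| "run N inp (PFor x p) e I = fold (\<lambda>i. run N inp p (e(x := i))) [0..<N] I"

text \<open>The compiled \<open>Assign\<close> overwrites \<open>r\<close> tuple by tuple. It agrees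
  with the simultaneous replacement because \<open>\<phi>\<close> may not read
  \<open>r\<close>.\<close>

fun wf_prog :: "nat \<Rightarrow> prog \<Rightarrow> bool" where
  "wf_prog d (Put r xs \<phi>) \<longleftrightarrow> length xs = arity \<and> (\<forall>x\<in>set xs. x < d) \<and> wf_fm d \<phi>"
| "wf_prog d (Assign d' r \<phi>) \<longleftrightarrow> d' = d \<and> wf_fm (d + arity) \<phi> \<and> r \<notin> rels_fm \<phi>"
| "wf_prog d (PSeq p q) \<longleftrightarrow> wf_prog d p \<and> wf_prog d q"
| "wf_prog d (PIf \<phi> p) \<longleftrightarrow> wf_fm d \<phi> \<and> wf_prog d p"
| "wf_prog d (PFor x p) \<longleftrightarrow> x = d \<and> wf_prog (Suc d) p"

definition put_cmd :: "nat \<Rightarrow> nat list \<Rightarrow> fm \<Rightarrow> cmd" where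
  "put_cmd r xs \<phi> = Seq (fm_cmd \<phi>) (Seq (Op (Const 4 (r + 1))) (Seq (horner_cmd xs) (Op (Store 4 3))))"

fun nest :: "nat \<Rightarrow> nat \<Rightarrow> prog \<Rightarrow> prog" where
  "nest d 0 p = p"
| "nest d (Suc k) p = PFor d (nest (Suc d) k p)"

fun nest_cmd :: "nat \<Rightarrow> nat \<Rightarrow> cmd \<Rightarrow> cmd" where
  "nest_cmd d 0 c = c"
| "nest_cmd d (Suc k) c = Loop (var_reg d) (nest_cmd (Suc d) k c)"

fun prog_cmd :: "prog \<Rightarrow> cmd" where
  "prog_cmd (Put r xs \<phi>) = put_cmd r xs \<phi>"
| "prog_cmd (Assign d r \<phi>) = nest_cmd d arity (put_cmd r [d..<d + arity] \<phi>)"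
| "prog_cmd (PSeq p q) = Seq (prog_cmd p) (prog_cmd q)"
| "prog_cmd (PIf \<phi> p) = Seq (fm_cmd \<phi>) (Cond 3 (prog_cmd p) (Op (Const 7 0)))"
| "prog_cmd (PFor x p) = Loop (var_reg x) (prog_cmd p)"

lemma prog_cmd_nest: "prog_cmd (nest d k p) = nest_cmd d k (prog_cmd p)"
  by (induction k arbitrary: d) auto

lemma wf_prog_nest: "wf_prog (d + k) p \<Longrightarrow> wf_prog d (nest d k p)"
  by (induction k arbitrary: d) auto

lemma wf_prog_let: "wf_prog d (Assign d' r \<phi>) \<Longrightarrow> wf_prog d (nest d arity (Put r [d..<d + arity] \<phi>))"
  by (rule wf_prog_nest) simp

fun let_free :: "prog \<Rightarrow> bool" where
  "let_free (Assign d r \<phi>) = False"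
| "let_free (PSeq p q) \<longleftrightarrow> let_free p \<and> let_free q"
| "let_free (PIf \<phi> p) \<longleftrightarrow> let_free p"
| "let_free (PFor x p) \<longleftrightarrow> let_free p"
| "let_free (Put r xs \<phi>) = True"

lemma let_free_nest: "let_free p \<Longrightarrow> let_free (nest d k p)"
  by (induction k arbitrary: d) auto

lemma writes_put_cmd: "wf_fm d \<phi> \<Longrightarrow> writes (put_cmd r xs \<phi>) \<subseteq> level_regs d"
  using writes_fm_cmd[of d \<phi>] writes_horner_cmd[of xs] by (auto simp: put_cmd_def level_regs_def)

lemma wf_put_cmd: "wf_fm d \<phi> \<Longrightarrow> wf_cmd (put_cmd r xs \<phi>)"
  by (auto simp: put_cmd_def wf_fm_cmd wf_horner_cmd)

lemma writes_nest_cmd: "writes c \<subseteq> level_regs (d + k) \<Longrightarrow> writes (nest_cmd d k c) \<subseteq> level_regs d"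
proof (induction k arbitrary: d)
  case (Suc k)
  then have "writes (nest_cmd (Suc d) k c) \<subseteq> level_regs (Suc d)" by simp
  then show ?case using level_regs_Suc[of d] by (auto simp: level_regs_def)
qed simp

lemma not_level_regs: "1 \<notin> level_regs d" "var_reg d \<notin> level_regs (Suc d)" "x < d \<Longrightarrow> var_reg x \<notin> level_regs d"
  by (auto simp: level_regs_def var_reg_def)

lemma wf_nest_cmd: "wf_cmd c \<Longrightarrow> writes c \<subseteq> level_regs (d + k) \<Longrightarrow> wf_cmd (nest_cmd d k c)"
proof (induction k arbitrary: d)
  case (Suc k)
  then have "writes (nest_cmd (Suc d) k c) \<subseteq> level_regs (Suc d)" by (intro writes_nest_cmd) simp
  then show ?case using Suc not_level_regs[of "Suc d"] not_level_regs(2)[of d] by auto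
qed simp

lemma writes_prog_cmd: "wf_prog d p \<Longrightarrow> writes (prog_cmd p) \<subseteq> level_regs d"
proof (induction p arbitrary: d)
  case (Assign d' r \<phi>)
  then show ?case by (auto intro!: writes_nest_cmd writes_put_cmd)
next
  case (PFor x p)
  then have "writes (prog_cmd p) \<subseteq> level_regs (Suc d)" by simp
  then show ?case using level_regs_Suc[of d] PFor by (auto simp: level_regs_def)
next
  case (PIf \<phi> p)
  then show ?case using writes_fm_cmd[of d \<phi>] by (auto simp: level_regs_def)
qed (auto intro!: writes_put_cmd)

lemma wf_prog_cmd: "wf_prog d p \<Longrightarrow> wf_cmd (prog_cmd p)"
proof (induction p arbitrary: d)
  case (Assign d' r \<phi>)
  then show ?case by (auto intro!: wf_nest_cmd wf_put_cmd writes_put_cmd)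
next
  case (PFor x p)
  then have "writes (prog_cmd p) \<subseteq> level_regs (Suc d)" using writes_prog_cmd by simp
  then show ?case using PFor not_level_regs[of "Suc d"] not_level_regs(2)[of d] by auto
qed (auto intro: wf_fm_cmd wf_put_cmd)

lemma sat_cong_rels:
  "(\<And>r. r \<in> rels_fm \<phi> \<Longrightarrow> I r = J r) \<Longrightarrow> sat N inp I e \<phi> = sat N inp J e \<phi>"
  by (induction \<phi> arbitrary: e) auto

lemma sat_cong_env:
  "wf_fm d \<phi> \<Longrightarrow> (\<And>x. x < d \<Longrightarrow> e x = e' x) \<Longrightarrow> sat N inp I e \<phi> = sat N inp I e' \<phi>"
proof (induction \<phi> arbitrary: d e e')
  case (LeS xs ys)
  then have "map e xs = map e' xs" "map e ys = map e' ys" by auto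
  then show ?case by (simp del: map_eq_conv)
next
  case (Rel r xs)
  then have "map e xs = map e' xs" by auto
  then show ?case by (simp del: map_eq_conv)
next
  case (Exists x \<phi>)
  have "sat N inp I (e(x := i)) \<phi> = sat N inp I (e'(x := i)) \<phi>" for i
    by (rule Exists.IH[of "Suc d"]) (use Exists in \<open>auto simp: less_Suc_eq\<close>)
  then show ?case by simp
next
  case (Neg \<phi>)
  have "sat N inp I e \<phi> = sat N inp I e' \<phi>" by (rule Neg.IH[of d]) (use Neg.prems in auto)
  then show ?case by simp
next
  case (And \<phi> \<psi>)
  have "sat N inp I e \<phi> = sat N inp I e' \<phi>" by (rule And.IH(1)[of d]) (use And.prems in auto)
  moreover have "sat N inp I e \<psi> = sat N inp I e' \<psi>" by (rule And.IH(2)[of d]) (use And.prems in auto)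
  ultimately show ?case by simp
qed simp

lemma put_cmd_correct:
  assumes "wf_prog d (Put r xs \<phi>)" "env_ok N d e R" "represents N inp I M" "2 \<le> N"
  shows "represents N inp (run N inp (Put r xs \<phi>) e I) (snd (exec (put_cmd r xs \<phi>) (R, M)))"
proof -
  have wf: "wf_fm d \<phi>" "length xs = arity" "\<forall>x\<in>set xs. x < d" using assms(1) by auto
  obtain R1 where R1: "exec (fm_cmd \<phi>) (R, M) = (R1, M)" "R1 3 \<noteq> 0 \<longleftrightarrow> sat N inp I e \<phi>"
    using fm_cmd_correct[OF wf(1) assms(2-4)] by blast
  have un: "R1 q = R q" if "q \<notin> level_regs d" for q
    by (rule exec_unchanged[OF R1(1) writes_fm_cmd[OF wf(1)] that])
  let ?R = "R1(4 := r + 1)"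
  obtain R2 where R2: "exec (horner_cmd xs) (?R, M) = (R2, M)"
    "R2 4 = foldl (\<lambda>a d. a * ?R 1 + d) (?R 4) (map (\<lambda>x. ?R (var_reg x)) xs)"
    "\<forall>y. y \<notin> {2, 4, 5, 6, 7} \<longrightarrow> R2 y = ?R y"
    using exec_horner_cmd[of xs ?R M] by blast
  have m: "map (\<lambda>x. ?R (var_reg x)) xs = map e xs"
    using wf(3) un not_level_regs(3) assms(2) by (auto simp: env_ok_def)
  have "?R 1 = N" "?R 4 = r + 1" using assms(2) un[of 1] not_level_regs(1) by (auto simp: env_ok_def)
  then have "R2 4 = address N r (map e xs)" using R2(2) unfolding m address_def by simp
  moreover have "R2 3 = R1 3" using R2(3) by simp
  ultimately have ex: "snd (exec (put_cmd r xs \<phi>) (R, M)) = M(address N r (map e xs) := R1 3)"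
    using R1(1) R2(1) by (simp add: put_cmd_def)
  have dg: "digits N (map e xs)" using wf assms(2) by (auto simp: digits_def env_ok_def)
  show ?thesis
    unfolding ex represents_def
  proof (intro conjI allI impI)
    fix a assume "a < N * N"
    then have "a \<noteq> address N r (map e xs)" using address_ge[OF dg, of r] assms(4) by auto
    then show "inp a \<longleftrightarrow> (M(address N r (map e xs) := R1 3)) a \<noteq> 0"
      using assms(3) \<open>a < N * N\<close> by (simp add: represents_def)
  next
    fix r' ds assume ds: "digits N ds"
    show "run N inp (Put r xs \<phi>) e I r' ds \<longleftrightarrow> (M(address N r (map e xs) := R1 3)) (address N r' ds) \<noteq> 0"
      using assms(3) ds R1(2) by (simp add: represents_def address_inj[OF ds dg])
  qed
qed

text \<open>Resolves a circularity: \<open>Assign\<close> is compiled to loops that are themselves a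
  program without \<open>Assign\<close>. Correctness of such programs comes first, yields
  \<open>lets_correct\<close>, and with it the case of all programs.\<close>

definition lets_correct :: "nat \<Rightarrow> (nat \<Rightarrow> bool) \<Rightarrow> bool" where
  "lets_correct N inp \<longleftrightarrow> (\<forall>d r \<phi> e R I M. wf_prog d (Assign d r \<phi>) \<longrightarrow> env_ok N d e R \<longrightarrow> represents N inp I M \<longrightarrow>
     represents N inp (run N inp (Assign d r \<phi>) e I) (snd (exec (prog_cmd (Assign d r \<phi>)) (R, M))))"

lemma prog_cmd_correct_if:
  assumes "let_free p \<or> lets_correct N inp" "wf_prog d p" "env_ok N d e R" "represents N inp I M" "2 \<le> N"
  shows "represents N inp (run N inp p e I) (snd (exec (prog_cmd p) (R, M)))"
  using assms
proof (induction p arbitrary: d e R I M)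
  case (Put r xs \<phi>)
  show ?case unfolding prog_cmd.simps by (rule put_cmd_correct[OF Put(2-5)])
next
  case (Assign d' r \<phi>)
  then have "d' = d" "lets_correct N inp" by simp_all
  then show ?case using Assign(2-4) unfolding lets_correct_def by blast
next
  case (PSeq p q)
  obtain R' M' where s: "exec (prog_cmd p) (R, M) = (R', M')" by fastforce
  have "R' r = R r" if "r \<notin> level_regs d" for r
    by (rule exec_unchanged[OF s writes_prog_cmd[of d] that]) (use PSeq.prems(2) in simp)
  then have "env_ok N d e R'" using PSeq.prems(3) not_level_regs unfolding env_ok_def by simp
  moreover have "represents N inp (run N inp p e I) M'" using PSeq.IH(1)[of d e R I M] PSeq.prems s by auto
  ultimately show ?case using PSeq.IH(2)[of d e R' _ M'] PSeq.prems s by auto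
next
  case (PIf \<phi> p)
  obtain R' where R': "exec (fm_cmd \<phi>) (R, M) = (R', M)" "R' 3 \<noteq> 0 \<longleftrightarrow> sat N inp I e \<phi>"
    using fm_cmd_correct[of d \<phi> N e R inp I M] PIf.prems by auto
  have "R' r = R r" if "r \<notin> level_regs d" for r
    by (rule exec_unchanged[OF R'(1) writes_fm_cmd[of d] that]) (use PIf.prems(2) in simp)
  then have "env_ok N d e R'" using PIf.prems(3) not_level_regs unfolding env_ok_def by simp
  then show ?case using PIf.IH[of d e R' I M] PIf.prems R' by auto
next
  case (PFor x p)
  have x: "x = d" and wf: "wf_prog (Suc d) p" using PFor.prems by auto
  have N: "R 1 = N" using PFor.prems by (simp add: env_ok_def)
  let ?f = "\<lambda>i. run N inp p (e(x := i))"
  define Q where "Q i s \<longleftrightarrow> env_ok N d e (fst s) \<and> represents N inp (fold ?f [0..<i] I) (snd s)" for i and s :: store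
  have "Q N (fold (loop_body (var_reg x) N (exec (prog_cmd p))) [0..<N] (R, M))"
  proof (rule fold_invariant)
    show "Q 0 (R, M)" using PFor.prems by (simp add: Q_def)
    fix i s assume i: "i < N" and Q: "Q i s"
    let ?R1 = "(fst s)(var_reg x := i, 2 := N - i)"
    have env: "env_ok N (Suc d) (e(x := i)) ?R1"
      using Q i x by (auto simp: Q_def env_ok_def var_reg_def less_Suc_eq)
    obtain R' M' where s': "exec (prog_cmd p) (?R1, snd s) = (R', M')" by fastforce
    have "R' r = ?R1 r" if "r \<notin> level_regs (Suc d)" for r
      by (rule exec_unchanged[OF s' writes_prog_cmd[OF wf] that])
    then have "env_ok N (Suc d) (e(x := i)) R'" using env not_level_regs unfolding env_ok_def by simp
    then have "env_ok N d e R'" using x unfolding env_ok_def by (auto simp: less_Suc_eq split: if_splits)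
    moreover have "represents N inp (?f i (fold ?f [0..<i] I)) (snd (exec (prog_cmd p) (?R1, snd s)))"
      by (rule PFor.IH[OF _ wf env _ PFor.prems(5)]) (use PFor.prems(1) Q in \<open>simp_all add: Q_def\<close>)
    ultimately show "Q (Suc i) (loop_body (var_reg x) N (exec (prog_cmd p)) i s)"
      by (simp add: Q_def loop_body_def s')
  qed
  then show ?case using N by (simp add: Q_def loop_end_def)
qed

text \<open>Generalised to the innermost \<open>k\<close> of the loops, where the outer
  \<open>j\<close> variables are already fixed by \<open>e\<close>: exactly the tuples that continue
  these \<open>j\<close> values are updated.\<close>

lemma run_nest_put:
  assumes "r \<notin> rels_fm \<phi>" "wf_fm (d + arity) \<phi>" "j + k = arity"
  shows "run N inp (nest (d + j) k (Put r [d..<d + arity] \<phi>)) e I =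
    I(r := \<lambda>ds. if length ds = arity \<and> take j ds = map e [d..<d + j] \<and> (\<forall>x\<in>set (drop j ds). x < N)
                 then sat N inp I (args_env e d ds) \<phi> else I r ds)"
  using assms(3)
proof (induction k arbitrary: j e I)
  case 0
  have eq: "length ds = arity \<and> take j ds = map e [d..<d + j] \<and> (\<forall>x\<in>set (drop j ds). x < N) \<longleftrightarrow>
      ds = map e [d..<d + arity]" for ds using 0 by auto
  have "sat N inp I (args_env e d (map e [d..<d + arity])) \<phi> = sat N inp I e \<phi>"
    by (rule sat_cong_env[OF assms(2)]) (auto simp: args_env_def)
  then show ?case using 0 unfolding eq by (auto simp: fun_eq_iff)
next
  case (Suc k)
  \<comment> \<open>The state after the values below \<open>i\<close> have been treated for
    component \<open>j\<close>. Evaluating \<open>\<phi>\<close> in it is the same as in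
    \<open>I\<close>, since the two differ only in \<open>r\<close>.\<close>
  define J where "J i = I(r := \<lambda>ds. if length ds = arity \<and> take j ds = map e [d..<d + j] \<and> ds ! j < i \<and>
      (\<forall>x\<in>set (drop (Suc j) ds). x < N) then sat N inp I (args_env e d ds) \<phi> else I r ds)" for i
  have jk: "j < arity" "Suc j + k = arity" using Suc.prems by auto
  let ?q = "nest (Suc (d + j)) k (Put r [d..<d + arity] \<phi>)"
  define Q where "Q i K \<longleftrightarrow> K = J i" for i K
  have "Q N (fold (\<lambda>i. run N inp ?q (e(d + j := i))) [0..<N] I)"
  proof (rule fold_invariant[where P = Q])
    show "Q 0 I" by (simp add: Q_def J_def)
    fix i K assume "Q i K"
    then have "K = J i" by (simp add: Q_def)
    have IH: "run N inp ?q (e(d + j := i)) (J i) =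
      (J i)(r := \<lambda>ds. if length ds = arity \<and> take (Suc j) ds = map (e(d + j := i)) [d..<d + Suc j] \<and>
          (\<forall>x\<in>set (drop (Suc j) ds). x < N)
        then sat N inp (J i) (args_env (e(d + j := i)) d ds) \<phi> else J i r ds)"
      using Suc.IH[OF jk(2), of "e(d + j := i)" "J i"] by (simp only: add_Suc_right)
    have s1: "sat N inp (J i) e' \<phi> = sat N inp I e' \<phi>" for e'
      by (rule sat_cong_rels) (use assms(1) in \<open>auto simp: J_def\<close>)
    have s2: "args_env (e(d + j := i)) d ds = args_env e d ds" for ds
      using jk by (auto simp: args_env_def fun_eq_iff)
    have tk: "length ds = arity \<Longrightarrow> take (Suc j) ds = map (e(d + j := i)) [d..<d + Suc j] \<longleftrightarrow>
        take j ds = map e [d..<d + j] \<and> ds ! j = i" for ds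
      using jk by (auto simp: take_Suc_conv_app_nth)
    show "Q (Suc i) (run N inp ?q (e(d + j := i)) K)"
      unfolding Q_def \<open>K = J i\<close> IH s1 s2 using tk by (auto simp: J_def fun_eq_iff less_Suc_eq)
  qed
  then have res: "run N inp (nest (d + j) (Suc k) (Put r [d..<d + arity] \<phi>)) e I = J N" by (simp add: Q_def)
  have "(ds ! j < N \<and> (\<forall>x\<in>set (drop (Suc j) ds). x < N)) = (\<forall>x\<in>set (drop j ds). x < N)" if "length ds = arity" for ds
  proof -
    have "drop j ds = ds ! j # drop (Suc j) ds" using Cons_nth_drop_Suc[of j ds] jk that by simp
    then show ?thesis by simp
  qed
  then have cond: "length ds = arity \<and> take j ds = map e [d..<d + j] \<and> ds ! j < N \<and>
      (\<forall>x\<in>set (drop (Suc j) ds). x < N) \<longleftrightarrow>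
      length ds = arity \<and> take j ds = map e [d..<d + j] \<and> (\<forall>x\<in>set (drop j ds). x < N)" for ds by blast
  show ?case unfolding res J_def cond by (rule refl)
qed

lemma represents_cong:
  "represents N inp I M \<Longrightarrow> (\<And>r ds. digits N ds \<Longrightarrow> I r ds = J r ds) \<Longrightarrow> represents N inp J M"
  unfolding represents_def by simp

text \<open>The loops leave tuples outside the digit range as they were, whereas
  \<open>Assign\<close> removes them. \<open>represents\<close> only speaks of tuples of digits, so
  the difference disappears.\<close>

lemma let_cmd_correct:
  assumes wf: "wf_prog d (Assign d r \<phi>)" and env: "env_ok N d e R" and rep: "represents N inp I M" and N: "2 \<le> N"
  shows "represents N inp (run N inp (Assign d r \<phi>) e I) (snd (exec (prog_cmd (Assign d r \<phi>)) (R, M)))"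
proof -
  let ?q = "nest d arity (Put r [d..<d + arity] \<phi>)"
  have 1: "represents N inp (run N inp ?q e I) (snd (exec (prog_cmd ?q) (R, M)))"
    by (rule prog_cmd_correct_if[OF _ wf_prog_let[OF wf] env rep N]) (simp add: let_free_nest)
  have 2: "run N inp ?q e I = I(r := \<lambda>ds. if length ds = arity \<and> (\<forall>x\<in>set ds. x < N)
       then sat N inp I (args_env e d ds) \<phi> else I r ds)"
    using run_nest_put[of r \<phi> d 0 arity N inp e I] wf by simp
  show ?thesis
    using represents_cong[OF 1, of "run N inp (Assign d r \<phi>) e I"] unfolding prog_cmd_nest 2 by (simp add: digits_def)
qed

lemma prog_cmd_correct:
  assumes "wf_prog d p" "env_ok N d e R" "represents N inp I M" "2 \<le> N"
  shows "represents N inp (run N inp p e I) (snd (exec (prog_cmd p) (R, M)))"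
proof -
  have "lets_correct N inp" unfolding lets_correct_def using let_cmd_correct assms(4) by blast
  then show ?thesis using prog_cmd_correct_if assms by blast
qed

section \<open>The dynamic program\<close>

definition Or :: "fm \<Rightarrow> fm \<Rightarrow> fm" where "Or \<phi> \<psi> = Neg (And (Neg \<phi>) (Neg \<psi>))"
definition Imp :: "fm \<Rightarrow> fm \<Rightarrow> fm" where "Imp \<phi> \<psi> = Neg (And \<phi> (Neg \<psi>))"
definition Iff :: "fm \<Rightarrow> fm \<Rightarrow> fm" where "Iff \<phi> \<psi> = And (Imp \<phi> \<psi>) (Imp \<psi> \<phi>)"
definition EqS :: "nat list \<Rightarrow> nat list \<Rightarrow> fm" where "EqS xs ys = And (LeS xs ys) (LeS ys xs)"
definition Zero :: "nat \<Rightarrow> fm" where "Zero x = LeS [x] []"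
definition Rel1 :: "nat \<Rightarrow> nat \<Rightarrow> fm" where "Rel1 r x = Rel r [x, x, x, x, x, x, x]"
definition Rel2 :: "nat \<Rightarrow> nat \<Rightarrow> nat \<Rightarrow> fm" where "Rel2 r x y = Rel r [x, y, y, y, y, y, y]"
definition Rel3 :: "nat \<Rightarrow> nat \<Rightarrow> nat \<Rightarrow> nat \<Rightarrow> fm" where "Rel3 r x y z = Rel r [x, y, z, z, z, z, z]"

lemmas fm_defs = Or_def Imp_def Iff_def EqS_def Zero_def Rel1_def Rel2_def Rel3_def

lemma sat_connectives [simp]:
  "sat N inp I e (Or \<phi> \<psi>) \<longleftrightarrow> sat N inp I e \<phi> \<or> sat N inp I e \<psi>"
  "sat N inp I e (Imp \<phi> \<psi>) \<longleftrightarrow> (sat N inp I e \<phi> \<longrightarrow> sat N inp I e \<psi>)"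
  "sat N inp I e (Iff \<phi> \<psi>) \<longleftrightarrow> (sat N inp I e \<phi> \<longleftrightarrow> sat N inp I e \<psi>)"
  "sat N inp I e (EqS xs ys) \<longleftrightarrow> sum_list (map e xs) = sum_list (map e ys)"
  "sat N inp I e (Zero x) \<longleftrightarrow> e x = 0"
  by (auto simp: fm_defs)

text \<open>Relations 0--3 hold the fill graph, the remaining vertices, the vertex tables and the pair
  tables; relations 4--7 are copies that allow simultaneous updates. Relation 8 holds the admissible
  colours, relation 9 the vertices of colour 1, relation 10 the optimum. Variables 0, 1, 2, 3 stand
  for the number of vertices, the constant 1, the bound on the component sizes, and the vertex whose
  colour is being fixed.\<close>

definition graph_rel :: "rels \<Rightarrow> nat \<Rightarrow> nat \<Rightarrow> bool" where "graph_rel I x y = I 0 [x, y, y, y, y, y, y]"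
definition live :: "rels \<Rightarrow> nat set" where "live I = {x. I 1 [x, x, x, x, x, x, x]}"
definition vertex_tab :: "rels \<Rightarrow> vertex_table" where "vertex_tab I x c s = I 2 [x, c, s, s, s, s, s]"
definition pair_tab :: "rels \<Rightarrow> pair_table" where "pair_tab I x y c c' k s s' = I 3 [x, y, c, c', k, s, s']"

lemmas acc_defs = graph_rel_def live_def vertex_tab_def pair_tab_def

text \<open>\<open>Assign 4\<close> binds a tuple to the variables 4 to 10: a vertex row is 4, 5, 6,
  and a pair row is 4 to 10 in the order of \<open>pair_tab\<close>. As variable 1 has the value 1,
  \<open>LeS [4, 1] [0]\<close> says that variable 4 is less than \<open>n\<close>.\<close>

definition init_prog :: prog where
  "init_prog =
     PSeq (Assign 4 0 (And (LeS [4, 1] [0]) (And (LeS [5, 1] [0]) (Inp 4 5))))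
    (PSeq (Assign 4 1 (LeS [4] [0]))
    (PSeq (Assign 4 2 (Or (And (EqS [4] [0]) (Zero 6)) (And (Neg (EqS [4] [0])) (And (Rel2 8 4 5) (EqS [6] [1])))))
          (Assign 4 3 (And (Zero 9) (And (Zero 10) (Iff (Neg (Zero 8)) (And (Rel2 0 4 5) (EqS [6] [7]))))))))"

text \<open>The tuple occupies the variables 8 to 14, behind the round counter 4 and
  \<open>v\<close>, \<open>a\<close>, \<open>b\<close> in 5, 6, 7. The detour through
  \<open>r'\<close> is forced by the ban on reading the assigned relation.\<close>

definition update_rel :: "nat \<Rightarrow> nat \<Rightarrow> fm \<Rightarrow> prog" where
  "update_rel r r' \<phi> = PSeq (Assign 8 r' \<phi>) (Assign 8 r (Rel r' [8, 9, 10, 11, 12, 13, 14]))"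

text \<open>Variables 15 to 20 are the witnesses of \<open>elim1\<close> in the order of its
  quantifiers; the updated vertex is 6, its colour 9 and its weight 10.\<close>

definition elim1_fm :: fm where
  "elim1_fm = Exists 15 (Exists 16 (Exists 17 (Exists 18 (Exists 19 (Exists 20 (
     And (Rel3 2 6 9 15) (And (Rel3 2 5 16 17) (And (Rel 3 [6, 5, 9, 16, 18, 19, 20])
    (And (Imp (Neg (Zero 18)) (EqS [10] [15, 19, 20, 17]))
         (Imp (Zero 18) (And (EqS [10] [15, 19]) (LeS [20, 17] [2]))))))))))))"

text \<open>Variables 8 to 14 are the new row, 15 to 25 the witnesses of \<open>elim2\<close> in the
  order of its quantifiers.\<close>

definition elim2_fm :: fm where
  "elim2_fm = Exists 15 (Exists 16 (Exists 17 (Exists 18 (Exists 19 (Exists 20 (Exists 21 (Exists 22 (Exists 23 (Exists 24 (Exists 25 (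
     And (Rel 3 [8, 9, 10, 11, 15, 16, 17]) (And (Rel3 2 5 18 19)
    (And (Rel 3 [8, 5, 10, 18, 20, 21, 22]) (And (Rel 3 [9, 5, 11, 18, 23, 24, 25])
    (And (Iff (Neg (Zero 12)) (Or (Neg (Zero 15)) (And (Neg (Zero 20)) (Neg (Zero 23)))))
    (And (Imp (And (Neg (Zero 20)) (Neg (Zero 23))) (EqS [13, 14] [16, 21, 17, 24, 22, 25, 19]))
    (And (Imp (And (Neg (Zero 20)) (Zero 23)) (And (EqS [13] [16, 21, 22, 25, 19]) (EqS [14] [17, 24])))
    (And (Imp (And (Zero 20) (Neg (Zero 23))) (And (EqS [13] [16, 21]) (EqS [14] [17, 24, 22, 25, 19])))
         (Imp (And (Zero 20) (Zero 23)) (And (EqS [13] [16, 21]) (And (EqS [14] [17, 24]) (LeS [22, 25, 19] [2]))))))))))))))))))))))"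

definition is_pair_fm :: fm where
  "is_pair_fm = Or (And (EqS [8] [6]) (EqS [9] [7])) (And (EqS [8] [7]) (EqS [9] [6]))"

definition remove_prog :: prog where
  "remove_prog = update_rel 1 5 (And (Rel1 1 8) (Neg (EqS [8] [5])))"

definition step1_prog :: prog where
  "step1_prog = PSeq (update_rel 2 6 (Or (And (EqS [8] [6]) elim1_fm) (And (Neg (EqS [8] [6])) (Rel3 2 8 9 10)))) remove_prog"

definition step2_prog :: prog where
  "step2_prog =
     PSeq (update_rel 3 7 (Or (And is_pair_fm elim2_fm) (And (Neg is_pair_fm) (Rel 3 [8, 9, 10, 11, 12, 13, 14]))))
    (PSeq (update_rel 0 4 (Or (Rel2 0 8 9) is_pair_fm)) remove_prog)"

definition can_elim_fm :: fm where
  "can_elim_fm = And (Rel1 1 5) (And (Rel1 1 6) (And (Rel1 1 7) (And (Neg (EqS [5] [0]))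
    (And (Neg (EqS [5] [6])) (And (Neg (EqS [5] [7]))
    (And (Neg (Exists 8 (And (Rel1 1 8) (And (Neg (EqS [8] [5])) (And (Neg (EqS [8] [6])) (And (Neg (EqS [8] [7])) (Rel2 0 5 8)))))))
         (Or (EqS [6] [7]) (And (Rel2 0 5 6) (Rel2 0 5 7)))))))))"

text \<open>The two inner guards compare variables only, so running the first branch cannot enable
  the second.\<close>

definition try_elim_prog :: prog where
  "try_elim_prog = PIf can_elim_fm (PSeq (PIf (EqS [6] [7]) step1_prog) (PIf (Neg (EqS [6] [7])) step2_prog))"

text \<open>Variable 4 counts rounds, and every round tries all triples \<open>v\<close>,
  \<open>a\<close>, \<open>b\<close>. A round removes a vertex as long as one besides
  \<open>n\<close> is left, so no elimination order has to be computed in advance.\<close>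

definition elim_prog :: prog where
  "elim_prog = PFor 4 (PFor 5 (PFor 6 (PFor 7 try_elim_prog)))"

definition dp_prog :: prog where "dp_prog = PSeq init_prog elim_prog"

definition feasible_fm :: fm where
  "feasible_fm = Exists 4 (Exists 5 (And (Rel3 2 0 4 5) (LeS [5] [2])))"

lemma wf_dp: "wf_prog 4 dp_prog" "wf_fm 4 feasible_fm"
  unfolding dp_prog_def init_prog_def elim_prog_def try_elim_prog_def step1_prog_def step2_prog_def remove_prog_def
    update_rel_def can_elim_fm_def elim1_fm_def elim2_fm_def is_pair_fm_def feasible_fm_def fm_defs
  by (simp_all add: arity_def)

lemma run_update_rel:
  assumes "r \<noteq> r'"
  shows "run N inp (update_rel r r' \<phi>) e I =
    I(r' := \<lambda>ds. digits N ds \<and> sat N inp I (args_env e 8 ds) \<phi>, r := \<lambda>ds. digits N ds \<and> sat N inp I (args_env e 8 ds) \<phi>)"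
proof -
  have "map (args_env e 8 ds) [8, 9, 10, 11, 12, 13, 14] = ds" if "digits N ds" for ds
  proof -
    have "length ds = 7" using that by (simp add: digits_def arity_def)
    then show ?thesis by (auto simp: args_env_def arity_def eval_nat_numeral length_Suc_conv)
  qed
  then show ?thesis unfolding update_rel_def by (auto simp: fun_eq_iff)
qed

lemma digits_simps: "digits N [x0, x1, x2, x3, x4, x5, x6] \<longleftrightarrow>
   x0 < N \<and> x1 < N \<and> x2 < N \<and> x3 < N \<and> x4 < N \<and> x5 < N \<and> x6 < N"
  by (auto simp: digits_def arity_def)

text \<open>If each attempt either changes nothing or shrinks \<open>W\<close>, so does the whole
  sweep; in this form the property passes through nested loops.\<close>

lemma fold_shrink:
  fixes W :: "'s \<Rightarrow> 'a set"
  assumes "\<And>i s. i < N \<Longrightarrow> S s \<Longrightarrow> S (f i s) \<and> (f i s = s \<or> W (f i s) \<subset> W s)" "S s"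
  shows "S (fold f [0..<N] s) \<and> (fold f [0..<N] s = s \<or> W (fold f [0..<N] s) \<subset> W s)"
proof (rule fold_invariant[where P = "\<lambda>i t. S t \<and> (t = s \<or> W t \<subset> W s)"])
  show "S s \<and> (s = s \<or> W s \<subset> W s)" using assms(2) by simp
  fix i t assume i: "i < N" and t: "S t \<and> (t = s \<or> W t \<subset> W s)"
  have f: "S (f i t)" "f i t = t \<or> W (f i t) \<subset> W t" using assms(1)[OF i] t by blast+
  from f(2) show "S (f i t) \<and> (f i t = s \<or> W (f i t) \<subset> W s)"
    using f(1) t by (elim disjE) auto
qed

text \<open>The attempt \<open>j\<close> is known to succeed only from the initial state. If that
  state has changed before \<open>j\<close> is reached, then \<open>W\<close> has already
  shrunk.\<close>

lemma fold_shrink_strict: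
  fixes W :: "'s \<Rightarrow> 'a set"
  assumes "\<And>i s. i < N \<Longrightarrow> S s \<Longrightarrow> S (f i s) \<and> (f i s = s \<or> W (f i s) \<subset> W s)" "S s"
    and "j < N" "W (f j s) \<subset> W s"
  shows "W (fold f [0..<N] s) \<subset> W s"
proof -
  have "S (fold f [0..<N] s) \<and> (N \<le> j \<and> fold f [0..<N] s = s \<or> W (fold f [0..<N] s) \<subset> W s)"
  proof (rule fold_invariant[where P = "\<lambda>i t. S t \<and> (i \<le> j \<and> t = s \<or> W t \<subset> W s)"])
    show "S s \<and> (0 \<le> j \<and> s = s \<or> W s \<subset> W s)" using assms(2) by simp
    fix i t assume i: "i < N" and t: "S t \<and> (i \<le> j \<and> t = s \<or> W t \<subset> W s)"
    have f: "S (f i t)" "f i t = t \<or> W (f i t) \<subset> W t" using assms(1)[OF i] t by blast+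
    show "S (f i t) \<and> (Suc i \<le> j \<and> f i t = s \<or> W (f i t) \<subset> W s)"
    proof (cases "W t \<subset> W s")
      case True
      then show ?thesis using f by auto
    next
      case False
      then have "i \<le> j" "t = s" using t by auto
      then show ?thesis using f assms(4) by (cases "i = j") auto
    qed
  qed
  then show ?thesis using assms(3) by simp
qed

locale dp =
  fixes n N :: nat and E :: "nat set set" and inp :: "nat \<Rightarrow> bool"
  assumes out: "outerplanar {..<n} E" and N: "N = n + 2"
    and inp: "\<And>a. inp a \<longleftrightarrow> a < n * n \<and> {a div n, a mod n} \<in> E"
begin

definition bounded_rels :: "rels \<Rightarrow> bool" where
  "bounded_rels I \<longleftrightarrow> (\<forall>r<4. \<forall>ds. I r ds \<longrightarrow> digits N ds)"

lemma bounded_relsD: "bounded_rels I \<Longrightarrow> I r ds \<Longrightarrow> r < 4 \<Longrightarrow> digits N ds"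
  by (simp add: bounded_rels_def)

text \<open>\<open>b\<close> is the answer for the initial tables, which every elimination
  preserves; \<open>K\<close> fixes the relations from 8 on, which belong to the surrounding
  search.\<close>

definition dp_inv :: "nat \<Rightarrow> bool \<Rightarrow> rels \<Rightarrow> rels \<Rightarrow> bool" where
  "dp_inv m b K I \<longleftrightarrow> elim_inv n N (live I) (graph_rel I) (pair_tab I) (vertex_tab I) \<and>
     (feasible m (live I) (pair_tab I) (vertex_tab I) \<longleftrightarrow> b) \<and> bounded_rels I \<and> (\<forall>r\<ge>8. I r = K r)"

lemma edge_iff: "x < n \<Longrightarrow> y < n \<Longrightarrow> inp (x * n + y) \<longleftrightarrow> {x, y} \<in> E"
proof -
  assume xy: "x < n" "y < n"
  have "x * n + y < n * n"
  proof -
    have "x * n + y < Suc x * n" using xy by simp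
    also have "\<dots> \<le> n * n" using xy by (intro mult_le_mono1) simp
    finally show ?thesis .
  qed
  moreover have "(x * n + y) div n = x" "(x * n + y) mod n = y" using xy by simp_all
  ultimately show ?thesis using inp by simp
qed

lemma edge_lt: "{x, y} \<in> E \<Longrightarrow> x < n \<and> y < n"
  using out unfolding outerplanar_def simple_graph_def by blast

lemma run_init:
  assumes e: "e 0 = n" "e 1 = 1" and ok: "ok = (\<lambda>x c. I 8 [x, c, c, c, c, c, c])" and m: "m < N"
  shows "dp_inv m (\<exists>f. (\<forall>x<n. f x < N \<and> ok x (f x)) \<and> max_mono_size {..<n} E f \<le> m) I (run N inp init_prog e I)"
proof -
  define I' where "I' = run N inp init_prog e I"
  have keep: "I' r = I r" if "8 \<le> r" for r using that unfolding I'_def init_prog_def by simp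
  have bd: "bounded_rels I'" unfolding bounded_rels_def I'_def init_prog_def by (simp add: less_Suc_eq eval_nat_numeral)
  have N2: "N - 2 = n" using N by simp
  have F: "graph_rel I' = (\<lambda>x y. {x, y} \<in> E)"
  proof (intro ext)
    fix x y
    show "graph_rel I' x y = ({x, y} \<in> E)"
      unfolding I'_def init_prog_def graph_rel_def
      using edge_iff[of x y] edge_lt[of x y] e N by (auto simp: digits_simps args_env_def arity_def N2)
  qed
  have W: "live I' = {..n}"
    unfolding I'_def init_prog_def live_def using e N by (auto simp: digits_simps args_env_def arity_def)
  \<comment> \<open>The stored tables agree with the initial ones only for vertices below
    \<open>N\<close>; all live vertices are.\<close>
  have U: "vertex_tab I' x c s \<longleftrightarrow> x < N \<and> init_vertices n N ok x c s" for x c s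
    unfolding I'_def init_prog_def vertex_tab_def init_vertices_def ok using e N
    by (auto simp: digits_simps args_env_def arity_def Rel2_def)
  have T: "pair_tab I' x y c c' k s s' \<longleftrightarrow> x < N \<and> y < N \<and> init_pairs N E x y c c' k s s'" for x y c c' k s s'
  proof -
    have "pair_tab I' x y c c' k s s' \<longleftrightarrow> digits N [x, y, c, c', k, s, s'] \<and> s = 0 \<and> s' = 0 \<and>
        (k \<noteq> 0 \<longleftrightarrow> graph_rel I' x y \<and> c = c')"
      unfolding I'_def init_prog_def pair_tab_def graph_rel_def
      by (simp add: args_env_def arity_def Rel2_def)
    then show ?thesis unfolding F init_pairs_def using N by (auto simp: digits_simps)
  qed
  have ei: "elim_inv n N {..n} (\<lambda>x y. {x, y} \<in> E) (init_pairs N E) (init_vertices n N ok)"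
    using out N by (intro elim_inv_init) auto
  have lt: "x \<le> n \<Longrightarrow> x < N" for x using N by simp
  have "elim_inv n N (live I') (graph_rel I') (pair_tab I') (vertex_tab I')"
    using ei unfolding W F elim_inv_def sym_table_def tables_bounded_def trivial_pair_def
    by (auto simp: U T lt)
  moreover have "solution m {..n} (pair_tab I') (vertex_tab I') = solution m {..n} (init_pairs N E) (init_vertices n N ok)"
    unfolding solution_def fun_eq_iff by (auto simp: U T lt)
  then have "feasible m (live I') (pair_tab I') (vertex_tab I') \<longleftrightarrow>
     (\<exists>f. (\<forall>x<n. f x < N \<and> ok x (f x)) \<and> max_mono_size {..<n} E f \<le> m)"
    using feasible_init_iff[of n E N m ok] out N unfolding W feasible_def outerplanar_def by simp
  ultimately show ?thesis unfolding dp_inv_def I'_def[symmetric] using bd keep by simp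
qed

lemma run_remove:
  assumes "bounded_rels I"
  shows "run N inp remove_prog e I 0 = I 0" "run N inp remove_prog e I 2 = I 2" "run N inp remove_prog e I 3 = I 3"
    "\<And>r. 8 \<le> r \<Longrightarrow> run N inp remove_prog e I r = I r"
    "live (run N inp remove_prog e I) = live I - {e 5}" "bounded_rels (run N inp remove_prog e I)"
proof -
  have b: "I 1 [x, x, x, x, x, x, x] \<Longrightarrow> x < N" for x using bounded_relsD[OF assms, of 1 "[x, x, x, x, x, x, x]"] by (auto simp: digits_simps)
  show "run N inp remove_prog e I 0 = I 0" "run N inp remove_prog e I 2 = I 2" "run N inp remove_prog e I 3 = I 3"
    "\<And>r. 8 \<le> r \<Longrightarrow> run N inp remove_prog e I r = I r"
    unfolding remove_prog_def by (auto simp: run_update_rel)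
  show "live (run N inp remove_prog e I) = live I - {e 5}"
    unfolding remove_prog_def live_def using b
    by (auto simp: run_update_rel args_env_def arity_def Rel1_def digits_simps)
  show "bounded_rels (run N inp remove_prog e I)"
    using assms unfolding remove_prog_def bounded_rels_def by (simp add: run_update_rel)
qed

lemma acc_cong:
  "I 0 = J 0 \<Longrightarrow> graph_rel I = graph_rel J" "I 1 = J 1 \<Longrightarrow> live I = live J"
  "I 2 = J 2 \<Longrightarrow> vertex_tab I = vertex_tab J" "I 3 = J 3 \<Longrightarrow> pair_tab I = pair_tab J"
  by (auto simp: acc_defs fun_eq_iff)

lemma run_step1:
  assumes inv: "dp_inv m b K I" and ce: "can_elim n (live I) (graph_rel I) v a a" and m: "m < N"
    and e: "e 2 = m" "e 5 = v" "e 6 = a"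
  shows "dp_inv m b K (run N inp step1_prog e I) \<and> live (run N inp step1_prog e I) = live I - {v}"
proof -
  have ei: "elim_inv n N (live I) (graph_rel I) (pair_tab I) (vertex_tab I)"
    and fe: "feasible m (live I) (pair_tab I) (vertex_tab I) \<longleftrightarrow> b" and bd: "bounded_rels I" and keep: "\<forall>r\<ge>8. I r = K r"
    using inv by (auto simp: dp_inv_def)
  define J where "J = run N inp (update_rel 2 6 (Or (And (EqS [8] [6]) elim1_fm) (And (Neg (EqS [8] [6])) (Rel3 2 8 9 10)))) e I"
  have J: "J 0 = I 0" "J 1 = I 1" "J 3 = I 3" "\<And>r. 8 \<le> r \<Longrightarrow> J r = I r" unfolding J_def by (auto simp: run_update_rel)
  have bJ: "bounded_rels J" using bd unfolding J_def bounded_rels_def by (simp add: run_update_rel)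
  have aN: "a < N" using ce ei N unfolding can_elim_def elim_inv_def by auto
  have U: "vertex_tab J = update1 N m (pair_tab I) (vertex_tab I) v a"
  proof (intro ext)
    fix x c s
    have "vertex_tab I x c s \<Longrightarrow> x < N \<and> c < N \<and> s < N"
      using bounded_relsD[OF bd, of 2 "[x, c, s, s, s, s, s]"] unfolding vertex_tab_def by (auto simp: digits_simps)
    then show "vertex_tab J x c s = update1 N m (pair_tab I) (vertex_tab I) v a x c s"
      unfolding J_def update1_def elim1_def elim1_fm_def vertex_tab_def pair_tab_def using e aN
      by (simp add: run_update_rel args_env_def arity_def Rel3_def digits_simps add.assoc) blast
  qed
  have r: "run N inp step1_prog e I = run N inp remove_prog e J" unfolding step1_prog_def J_def by simp
  note rm = run_remove[OF bJ, where e = e]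
  have acc: "graph_rel (run N inp step1_prog e I) = graph_rel I" "pair_tab (run N inp step1_prog e I) = pair_tab I"
    "vertex_tab (run N inp step1_prog e I) = update1 N m (pair_tab I) (vertex_tab I) v a"
    "live (run N inp step1_prog e I) = live I - {v}"
    unfolding r using rm J acc_cong(1)[of "run N inp remove_prog e J" I] acc_cong(4)[of "run N inp remove_prog e J" I]
      acc_cong(3)[of "run N inp remove_prog e J" J] acc_cong(2)[of J I] U e by auto
  have "\<forall>r\<ge>8. run N inp step1_prog e I r = K r" unfolding r using rm(4) J(4) keep by simp
  then show ?thesis
    using elim_inv1[OF ei ce m] fe rm(6) unfolding dp_inv_def acc r[symmetric] by simp
qed

lemma run_step2:
  assumes inv: "dp_inv m b K I" and ce: "can_elim n (live I) (graph_rel I) v a a'" and m: "m < N" and ne: "a \<noteq> a'"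
    and e: "e 2 = m" "e 5 = v" "e 6 = a" "e 7 = a'"
  shows "dp_inv m b K (run N inp step2_prog e I) \<and> live (run N inp step2_prog e I) = live I - {v}"
proof -
  have ei: "elim_inv n N (live I) (graph_rel I) (pair_tab I) (vertex_tab I)"
    and fe: "feasible m (live I) (pair_tab I) (vertex_tab I) \<longleftrightarrow> b" and bd: "bounded_rels I" and keep: "\<forall>r\<ge>8. I r = K r"
    using inv by (auto simp: dp_inv_def)
  define J where "J = run N inp (update_rel 3 7 (Or (And is_pair_fm elim2_fm) (And (Neg is_pair_fm) (Rel 3 [8, 9, 10, 11, 12, 13, 14])))) e I"
  define L where "L = run N inp (update_rel 0 4 (Or (Rel2 0 8 9) is_pair_fm)) e J"
  have J: "J 0 = I 0" "J 1 = I 1" "J 2 = I 2" "\<And>r. 8 \<le> r \<Longrightarrow> J r = I r" unfolding J_def by (auto simp: run_update_rel)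
  have L: "L 1 = I 1" "L 2 = I 2" "L 3 = J 3" "\<And>r. 8 \<le> r \<Longrightarrow> L r = I r" unfolding L_def using J by (auto simp: run_update_rel)
  have bJ: "bounded_rels J" using bd unfolding J_def bounded_rels_def by (simp add: run_update_rel)
  then have bL: "bounded_rels L" unfolding L_def bounded_rels_def by (simp add: run_update_rel)
  have aN: "a < N" "a' < N" using ce ei N unfolding can_elim_def elim_inv_def by auto
  have pair: "sat N inp K' (args_env e 8 (x # y # zs)) is_pair_fm \<longleftrightarrow> x = a \<and> y = a' \<or> x = a' \<and> y = a" for K' x y zs
    using e by (simp add: is_pair_fm_def args_env_def arity_def)
  have T: "pair_tab J = update2 N m (pair_tab I) (vertex_tab I) v a a'"
  proof (intro ext)
    fix x y c c' k s s'
    have b3: "pair_tab I x y c c' k s s' \<Longrightarrow> digits N [x, y, c, c', k, s, s']"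
      using bounded_relsD[OF bd, of 3] unfolding pair_tab_def by simp
    have el: "digits N [x, y, c, c', k, s, s'] \<and> sat N inp I (args_env e 8 [x, y, c, c', k, s, s']) elim2_fm \<longleftrightarrow>
        elim2 N m (pair_tab I) (vertex_tab I) v x y c c' k s s'" if "x < N" "y < N"
      unfolding elim2_def elim2_fm_def vertex_tab_def pair_tab_def using e that
      by (simp add: args_env_def arity_def Rel3_def digits_simps add.assoc)
    have sI: "pair_tab J x y c c' k s s' \<longleftrightarrow> digits N [x, y, c, c', k, s, s'] \<and>
       ((x = a \<and> y = a' \<or> x = a' \<and> y = a) \<and> sat N inp I (args_env e 8 [x, y, c, c', k, s, s']) elim2_fm \<or>
        \<not> (x = a \<and> y = a' \<or> x = a' \<and> y = a) \<and> pair_tab I x y c c' k s s')"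
      unfolding J_def pair_tab_def by (simp add: run_update_rel pair) (simp add: args_env_def arity_def)
    show "pair_tab J x y c c' k s s' = update2 N m (pair_tab I) (vertex_tab I) v a a' x y c c' k s s'"
      unfolding sI update2_def using el b3 aN by (cases "x = a \<and> y = a' \<or> x = a' \<and> y = a") auto
  qed
  have F: "graph_rel L = (\<lambda>x y. graph_rel I x y \<or> x = a \<and> y = a' \<or> x = a' \<and> y = a)"
  proof (intro ext)
    fix x y
    have "graph_rel I x y \<Longrightarrow> digits N [x, y, y, y, y, y, y]" using bounded_relsD[OF bd, of 0] unfolding graph_rel_def by simp
    then show "graph_rel L x y = (graph_rel I x y \<or> x = a \<and> y = a' \<or> x = a' \<and> y = a)"
      unfolding L_def graph_rel_def using aN J(1)
      by (simp add: run_update_rel pair) (auto simp: args_env_def arity_def Rel2_def digits_simps)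
  qed
  have r: "run N inp step2_prog e I = run N inp remove_prog e L" unfolding step2_prog_def J_def L_def by simp
  note rm = run_remove[OF bL, where e = e]
  have acc: "graph_rel (run N inp step2_prog e I) = (\<lambda>x y. graph_rel I x y \<or> x = a \<and> y = a' \<or> x = a' \<and> y = a)"
    "pair_tab (run N inp step2_prog e I) = update2 N m (pair_tab I) (vertex_tab I) v a a'"
    "vertex_tab (run N inp step2_prog e I) = vertex_tab I"
    "live (run N inp step2_prog e I) = live I - {v}"
    unfolding r using rm L acc_cong(1)[of "run N inp remove_prog e L" L] acc_cong(4)[of "run N inp remove_prog e L" J]
      acc_cong(3)[of "run N inp remove_prog e L" I] acc_cong(2)[of L I] T F e by auto
  have "\<forall>r\<ge>8. run N inp step2_prog e I r = K r" unfolding r using rm(4) L(4) keep by simp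
  moreover have "1 < N" using N by simp
  ultimately show ?thesis
    using elim_inv2[OF ei ce ne m] fe rm(6) unfolding dp_inv_def acc r[symmetric] by simp
qed

end

lemma run_PFor: "run N inp (PFor x p) e = fold (\<lambda>i. run N inp p (e(x := i))) [0..<N]"
  by (rule ext) simp

context dp
begin

lemma dp_inv_live: "dp_inv m b K I \<Longrightarrow> live I \<subseteq> {..n} \<and> n \<in> live I"
  by (simp add: dp_inv_def elim_inv_def)

lemma sat_can_elim:
  assumes "live I \<subseteq> {..n}" and e: "e 0 = n" "e 5 = v" "e 6 = a" "e 7 = a'"
  shows "sat N inp I e can_elim_fm \<longleftrightarrow> can_elim n (live I) (graph_rel I) v a a'"
proof -
  have "x \<in> live I \<Longrightarrow> x < N" for x using assms(1) N by auto
  then show ?thesis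
    using e unfolding can_elim_fm_def can_elim_def
    by (auto simp: Rel1_def Rel2_def live_def graph_rel_def)
qed

lemma run_try_elim:
  assumes inv: "dp_inv m b K I" and m: "m < N" and e: "e 0 = n" "e 2 = m" "e 5 = v" "e 6 = a" "e 7 = a'"
  shows "dp_inv m b K (run N inp try_elim_prog e I) \<and>
    (run N inp try_elim_prog e I = I \<or> live (run N inp try_elim_prog e I) \<subset> live I) \<and>
    (can_elim n (live I) (graph_rel I) v a a' \<longrightarrow> live (run N inp try_elim_prog e I) \<subset> live I)"
proof (cases "can_elim n (live I) (graph_rel I) v a a'")
  case False
  then have "run N inp try_elim_prog e I = I"
    unfolding try_elim_prog_def using sat_can_elim[of I e v a a'] dp_inv_live[OF inv] e by simp
  then show ?thesis using inv False by simp
next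
  case True
  then have vl: "live I - {v} \<subset> live I" unfolding can_elim_def by blast
  have sat: "sat N inp I e can_elim_fm" using True sat_can_elim[of I e v a a'] dp_inv_live[OF inv] e by simp
  show ?thesis
  proof (cases "a = a'")
    case eq: True
    then have "run N inp try_elim_prog e I = run N inp step1_prog e I"
      unfolding try_elim_prog_def using sat e by simp
    then show ?thesis using run_step1[OF inv _ m e(2-4)] True eq vl by simp
  next
    case ne: False
    then have "run N inp try_elim_prog e I = run N inp step2_prog e I"
      unfolding try_elim_prog_def using sat e by simp
    then show ?thesis using run_step2[OF inv True m ne e(2-5)] vl by simp
  qed
qed

lemma run_elim:
  assumes inv: "dp_inv m b K I" and m: "m < N" and e: "e 0 = n" "e 2 = m"
  shows "dp_inv m b K (run N inp elim_prog e I)" "live (run N inp elim_prog e I) = {n}"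
proof -
  define f3 where "f3 r v a a' = run N inp try_elim_prog (e(4 := r, 5 := v, 6 := a, 7 := a'))" for r v a a'
  define f2 where "f2 r v a = fold (f3 r v a) [0..<N]" for r v a
  define f1 where "f1 r v = fold (f2 r v) [0..<N]" for r v
  define f0 where "f0 r = fold (f1 r) [0..<N]" for r
  have run: "run N inp elim_prog e I = fold f0 [0..<N] I"
    unfolding elim_prog_def f0_def f1_def f2_def f3_def run_PFor by (rule refl)
  have s3: "dp_inv m b K (f3 r v a a' J) \<and> (f3 r v a a' J = J \<or> live (f3 r v a a' J) \<subset> live J)"
    and c3: "can_elim n (live J) (graph_rel J) v a a' \<Longrightarrow> live (f3 r v a a' J) \<subset> live J"
    if "dp_inv m b K J" for r v a a' J
    using run_try_elim[OF that m, of "e(4 := r, 5 := v, 6 := a, 7 := a')" v a a'] e unfolding f3_def by auto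
  have s2: "dp_inv m b K (f2 r v a J) \<and> (f2 r v a J = J \<or> live (f2 r v a J) \<subset> live J)"
    if "dp_inv m b K J" for r v a J
    unfolding f2_def by (rule fold_shrink[where S = "dp_inv m b K"]) (use s3 that in blast)+
  have s1: "dp_inv m b K (f1 r v J) \<and> (f1 r v J = J \<or> live (f1 r v J) \<subset> live J)"
    if "dp_inv m b K J" for r v J
    unfolding f1_def by (rule fold_shrink[where S = "dp_inv m b K"]) (use s2 that in blast)+
  have s0: "dp_inv m b K (f0 r J) \<and> (f0 r J = J \<or> live (f0 r J) \<subset> live J)"
    if "dp_inv m b K J" for r J
    unfolding f0_def by (rule fold_shrink[where S = "dp_inv m b K"]) (use s1 that in blast)+
  have c0: "live (f0 r J) \<subset> live J" if J: "dp_inv m b K J" and ne: "live J \<noteq> {n}" for r J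
  proof -
    obtain v a a' where ce: "can_elim n (live J) (graph_rel J) v a a'"
      using ex_can_elim[of n N "live J" "graph_rel J"] J ne unfolding dp_inv_def by blast
    then have lt: "v < N" "a < N" "a' < N" using dp_inv_live[OF J] N unfolding can_elim_def by auto
    have "live (f2 r v a J) \<subset> live J"
      unfolding f2_def by (rule fold_shrink_strict[where S = "dp_inv m b K" and j = a']) (use s3 J lt c3[OF J ce] in blast)+
    then have "live (f1 r v J) \<subset> live J"
      unfolding f1_def by (intro fold_shrink_strict[where S = "dp_inv m b K" and j = a]) (use s2 J lt in blast)+
    then show ?thesis
      unfolding f0_def by (intro fold_shrink_strict[where S = "dp_inv m b K" and j = v]) (use s1 J lt in blast)+
  qed
  \<comment> \<open>At first at most \<open>n + 1\<close> vertices are live, and every round removes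
    one unless only \<open>n\<close> is left. After \<open>N = n + 2\<close> rounds the second
    alternative is impossible.\<close>
  define Q where "Q i J \<longleftrightarrow> dp_inv m b K J \<and> (live J = {n} \<or> card (live J) + i \<le> n + 1)" for i J
  have "Q N (fold f0 [0..<N] I)"
  proof (rule fold_invariant[where P = Q])
    have "card (live I) \<le> card {..n}" using dp_inv_live[OF inv] by (intro card_mono) auto
    then show "Q 0 I" using inv by (simp add: Q_def)
    fix i J assume "Q i J"
    then have J: "dp_inv m b K J" and l: "live J = {n} \<or> card (live J) + i \<le> n + 1" by (auto simp: Q_def)
    have J': "dp_inv m b K (f0 i J)" using s0[OF J] by blast
    show "Q (Suc i) (f0 i J)"
    proof (cases "live J = {n}")
      case True
      then have "live (f0 i J) = {n}" using s0[OF J, of i] dp_inv_live[OF J'] by auto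
      then show ?thesis using J' by (simp add: Q_def)
    next
      case False
      then have "card (live (f0 i J)) < card (live J)"
        using c0[OF J] dp_inv_live[OF J] by (intro psubset_card_mono) (auto intro: finite_subset)
      then show ?thesis using l False J' by (simp add: Q_def)
    qed
  qed
  then show "dp_inv m b K (run N inp elim_prog e I)" "live (run N inp elim_prog e I) = {n}"
    unfolding run Q_def using N by auto
qed

lemma run_dp:
  assumes m: "m < N" and e: "e 0 = n" "e 1 = 1" "e 2 = m" and ok: "ok = (\<lambda>x c. I 8 [x, c, c, c, c, c, c])"
  shows "sat N inp (run N inp dp_prog e I) e feasible_fm \<longleftrightarrow>
      (\<exists>f. (\<forall>x<n. f x < N \<and> ok x (f x)) \<and> max_mono_size {..<n} E f \<le> m)"
    and "\<And>r. 8 \<le> r \<Longrightarrow> run N inp dp_prog e I r = I r"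
proof -
  let ?b = "\<exists>f. (\<forall>x<n. f x < N \<and> ok x (f x)) \<and> max_mono_size {..<n} E f \<le> m"
  define J where "J = run N inp dp_prog e I"
  have "dp_inv m ?b I (run N inp init_prog e I)" by (rule run_init[where e = e and ok = ok and I = I and m = m, OF e(1,2) ok m])
  from run_elim[OF this m e(1,3)] have J: "dp_inv m ?b I J" "live J = {n}" by (simp_all add: J_def dp_prog_def)
  then show "\<And>r. 8 \<le> r \<Longrightarrow> run N inp dp_prog e I r = I r" by (simp add: dp_inv_def J_def)
  have b: "vertex_tab J n c s \<Longrightarrow> c < N \<and> s < N" for c s
    using J(1) unfolding dp_inv_def elim_inv_def tables_bounded_def by blast
  have "sat N inp J e feasible_fm \<longleftrightarrow> (\<exists>c<N. \<exists>s<N. vertex_tab J n c s \<and> s \<le> m)"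
    using e by (simp add: feasible_fm_def Rel3_def vertex_tab_def)
  also have "\<dots> \<longleftrightarrow> (\<exists>c s. vertex_tab J n c s \<and> s \<le> m)" using b by blast
  also have "\<dots> \<longleftrightarrow> ?b"
    using J unfolding dp_inv_def by (simp add: feasible_singleton)
  finally show "sat N inp (run N inp dp_prog e I) e feasible_fm \<longleftrightarrow> ?b" by (simp add: J_def)
qed

section \<open>The optimum and the search for an optimal colouring\<close>

definition achievable :: "nat \<Rightarrow> (nat \<Rightarrow> nat) \<Rightarrow> bool" where
  "achievable m f \<longleftrightarrow> is_coloring 2 {..<n} f \<and> max_mono_size {..<n} E f \<le> m"

definition opt :: nat where "opt = (LEAST m. \<exists>f. achievable m f)"

lemma simple: "simple_graph {..<n} E" using out by (simp add: outerplanar_def)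

lemma opt_eq_mcc: "opt = mcc 2 {..<n} E"
  unfolding opt_def mcc_def achievable_def max_mono_size_le_iff[OF simple] by simp

lemma achievable_n: "achievable n (\<lambda>_. 0)"
proof -
  have "card C \<le> n" if "C \<in> mono_components {..<n} E (\<lambda>_. 0)" for C
  proof -
    have "C \<subseteq> {..<n}" using that unfolding mono_components_eq[OF simple] by auto
    from card_mono[OF _ this] show ?thesis by simp
  qed
  then show ?thesis by (simp add: achievable_def is_coloring_def max_mono_size_le_iff[OF simple])
qed

lemma opt_achievable: "\<exists>f. achievable opt f"
  unfolding opt_def by (rule LeastI_ex) (use achievable_n in blast)

lemma opt_le: "achievable m f \<Longrightarrow> opt \<le> m"
  unfolding opt_def by (rule Least_le) blast

lemma opt_less: "opt < N" using opt_le[OF achievable_n] N by simp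

end

text \<open>Relation 10 is written only while it is empty, hence at the least feasible bound. The
  loop on variable 3 acts only at the value 0; it is there because \<open>dp_prog\<close> is written
  for level 4, with variable 3 reserved for the colouring phase.\<close>

definition search_prog :: prog where
  "search_prog = PFor 2 (PFor 3 (PIf (Zero 3) (PSeq (Assign 4 8 (LeS [5] [1])) (PSeq dp_prog
     (PIf (And feasible_fm (Neg (Exists 4 (Rel1 10 4)))) (Assign 4 10 (EqS [4] [2])))))))"

text \<open>The first guard singles out the optimal bound among all values of variable 2. The test
  asks whether vertex 3 can have colour 0: the vertices up to it must have colour 1 exactly if they
  are in relation 9. If this fails, the vertex joins relation 9, through the copy 11.\<close>

definition color_prog :: prog where
  "color_prog = PFor 2 (PFor 3 (PIf (And (Rel1 10 2) (LeS [3, 1] [0]))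
     (PSeq (Assign 4 8 (And (LeS [5] [1]) (Imp (LeS [4] [3]) (Iff (EqS [5] [1]) (Rel1 9 4))))) (PSeq dp_prog
       (PIf (Neg feasible_fm) (PSeq (Assign 4 11 (Or (Rel1 9 4) (EqS [4] [3]))) (Assign 4 9 (Rel1 11 4))))))))"

lemma wf_search_color: "wf_prog 2 (PSeq search_prog color_prog)"
  using wf_dp unfolding search_prog_def color_prog_def by (simp add: fm_defs arity_def feasible_fm_def)

definition unary :: "rels \<Rightarrow> nat \<Rightarrow> nat set" where
  "unary I r = {x. I r [x, x, x, x, x, x, x]}"

context dp
begin

lemma run_search:
  assumes e: "e 0 = n" "e 1 = 1"
  shows "unary (run N inp search_prog e (\<lambda>_ _. False)) 10 = {opt}"
    "unary (run N inp search_prog e (\<lambda>_ _. False)) 9 = {}"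
proof -
  let ?body = "PIf (Zero 3) (PSeq (Assign 4 8 (LeS [5] [1])) (PSeq dp_prog
     (PIf (And feasible_fm (Neg (Exists 4 (Rel1 10 4)))) (Assign 4 10 (EqS [4] [2])))))"
  define Q where "Q i I \<longleftrightarrow> unary I 10 = (if opt < i then {opt} else {}) \<and> unary I 9 = {}" for i and I :: rels
  have step: "Q (Suc m) (run N inp ?body (e(2 := m, 3 := 0)) I)" if m: "m < N" and Q: "Q m I" for m I
  proof -
    let ?e = "e(2 := m, 3 := 0)"
    define I1 where "I1 = run N inp (Assign 4 8 (LeS [5] [1])) ?e I"
    define I2 where "I2 = run N inp dp_prog ?e I1"
    define ok where "ok = (\<lambda>x c. I1 8 [x, c, c, c, c, c, c])"
    have k1: "I1 r = I r" if "r \<noteq> 8" for r using that unfolding I1_def by simp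
    have okx: "ok x c \<longleftrightarrow> x < N \<and> c < 2" for x c
      unfolding ok_def I1_def using e N by (auto simp: digits_simps args_env_def arity_def)
    have dp1: "sat N inp I2 ?e feasible_fm \<longleftrightarrow> (\<exists>f. (\<forall>x<n. f x < N \<and> ok x (f x)) \<and> max_mono_size {..<n} E f \<le> m)"
      unfolding I2_def using e m ok_def by (intro run_dp) simp_all
    have dp2: "I2 r = I1 r" if "8 \<le> r" for r
      unfolding I2_def using e m that by (intro run_dp(2)[OF m _ _ _ refl]) simp_all
    have N2: "c < 2 \<Longrightarrow> c < N" and NN: "c < n \<Longrightarrow> c < N" for c using N by simp_all
    have "(\<forall>x<n. f x < N \<and> ok x (f x)) \<longleftrightarrow> is_coloring 2 {..<n} f" for f
      using N2 NN by (auto simp: okx is_coloring_def)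
    then have fe: "sat N inp I2 ?e feasible_fm \<longleftrightarrow> (\<exists>f. achievable m f)" using dp1 by (simp add: achievable_def)
    have u: "unary I2 10 = unary I 10" "unary I2 9 = unary I 9" using dp2 k1 by (simp_all add: unary_def)
    have ex: "sat N inp I2 ?e (Exists 4 (Rel1 10 4)) \<longleftrightarrow> opt < m"
    proof -
      have "sat N inp I2 ?e (Exists 4 (Rel1 10 4)) \<longleftrightarrow> (\<exists>i<N. i \<in> unary I2 10)" by (simp add: Rel1_def unary_def)
      then show ?thesis using u Q opt_less by (auto simp: Q_def)
    qed
    have r: "run N inp ?body ?e I = (if (\<exists>f. achievable m f) \<and> \<not> opt < m then run N inp (Assign 4 10 (EqS [4] [2])) ?e I2 else I2)"
    proof -
      have z: "sat N inp I ?e (Zero 3)" by simp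
      show ?thesis
        unfolding run.simps(3,4) if_P[OF z] I1_def[symmetric] I2_def[symmetric] sat.simps(4,5) fe ex by (rule refl)
    qed
    show ?thesis
    proof (cases "(\<exists>f. achievable m f) \<and> \<not> opt < m")
      case True
      then have "opt = m" using opt_le by force
      moreover have "unary (run N inp (Assign 4 10 (EqS [4] [2])) ?e I2) 10 = {m}"
        using m by (auto simp: unary_def digits_simps args_env_def arity_def)
      moreover have "unary (run N inp (Assign 4 10 (EqS [4] [2])) ?e I2) 9 = {}"
        using u Q by (simp add: unary_def Q_def)
      ultimately show ?thesis unfolding r Q_def using True by simp
    next
      case False
      then have "opt \<noteq> m" using opt_achievable by auto
      then show ?thesis unfolding r using False u Q by (auto simp: Q_def)
    qed
  qed
  have N0: "[0..<N] = 0 # [1..<N]" using N by (simp add: upt_rec)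
  have inner: "fold (\<lambda>v. run N inp ?body (e(2 := m, 3 := v))) [0..<N] I = run N inp ?body (e(2 := m, 3 := 0)) I" for m I
  proof -
    have "fold (\<lambda>v. run N inp ?body (e(2 := m, 3 := v))) xs J = J" if "0 \<notin> set xs" for xs J
      using that by (induction xs arbitrary: J) auto
    then show ?thesis unfolding N0 by simp
  qed
  have "Q N (fold (\<lambda>m. fold (\<lambda>v. run N inp ?body (e(2 := m, 3 := v))) [0..<N]) [0..<N] (\<lambda>_ _. False))"
    unfolding inner by (rule fold_invariant[where P = Q]) (use step in \<open>simp_all add: Q_def unary_def\<close>)
  then have "Q N (run N inp search_prog e (\<lambda>_ _. False))" by (simp only: search_prog_def run_PFor)
  then show "unary (run N inp search_prog e (\<lambda>_ _. False)) 10 = {opt}"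
    "unary (run N inp search_prog e (\<lambda>_ _. False)) 9 = {}" using opt_less by (simp_all add: Q_def)
qed

lemma run_color:
  assumes e: "e 0 = n" "e 1 = 1" and I: "unary I 10 = {opt}" "unary I 9 = {}"
  shows "unary (run N inp color_prog e I) 10 = {opt}"
    "\<exists>f. achievable opt f \<and> (\<forall>x<n. f x = 1 \<longleftrightarrow> x \<in> unary (run N inp color_prog e I) 9)"
proof -
  let ?ok = "And (LeS [5] [1]) (Imp (LeS [4] [3]) (Iff (EqS [5] [1]) (Rel1 9 4)))"
  let ?add = "PSeq (Assign 4 11 (Or (Rel1 9 4) (EqS [4] [3]))) (Assign 4 9 (Rel1 11 4))"
  let ?body = "PIf (And (Rel1 10 2) (LeS [3, 1] [0])) (PSeq (Assign 4 8 ?ok) (PSeq dp_prog (PIf (Neg feasible_fm) ?add)))"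
  \<comment> \<open>Some optimal colouring agrees with all choices made so far. By
    \<open>unary I 9 \<subseteq> {..<i}\<close> the current vertex is not yet in relation 9, so the
    test gives it colour 0.\<close>
  define Q where "Q i I \<longleftrightarrow> unary I 10 = {opt} \<and> unary I 9 \<subseteq> {..<i} \<and>
     (\<exists>f. achievable opt f \<and> (\<forall>x<n. x < i \<longrightarrow> (f x = 1 \<longleftrightarrow> x \<in> unary I 9)))" for i and I :: rels
  have skip: "run N inp ?body e' I = I" if "\<not> (e' 2 \<in> unary I 10 \<and> e' 3 < n)" "e' 0 = n" "e' 1 = 1" for e' I
    using that by (auto simp: unary_def Rel1_def)
  have step: "Q (Suc v) (run N inp ?body (e(2 := opt, 3 := v)) I)" if v: "v < N" and Q: "Q v I" for v I
  proof (cases "v < n")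
    case False
    then have "run N inp ?body (e(2 := opt, 3 := v)) I = I" using e by (intro skip) simp_all
    then show ?thesis using Q False by (auto simp: Q_def)
  next
    case True
    let ?e = "e(2 := opt, 3 := v)"
    let ?Z = "unary I 9"
    obtain f where f: "achievable opt f" "\<forall>x<n. x < v \<longrightarrow> (f x = 1 \<longleftrightarrow> x \<in> ?Z)" using Q by (auto simp: Q_def)
    have Z: "?Z \<subseteq> {..<v}" "unary I 10 = {opt}" using Q by (auto simp: Q_def)
    define I1 where "I1 = run N inp (Assign 4 8 ?ok) ?e I"
    define I2 where "I2 = run N inp dp_prog ?e I1"
    define ok where "ok = (\<lambda>x c. I1 8 [x, c, c, c, c, c, c])"
    have k1: "I1 r = I r" if "r \<noteq> 8" for r using that unfolding I1_def by simp
    have okx: "ok x c \<longleftrightarrow> x < N \<and> c < 2 \<and> (x \<le> v \<longrightarrow> (c = 1 \<longleftrightarrow> x \<in> ?Z))" for x c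
      unfolding ok_def I1_def using e N by (auto simp: digits_simps args_env_def arity_def Rel1_def unary_def)
    have dp1: "sat N inp I2 ?e feasible_fm \<longleftrightarrow> (\<exists>f. (\<forall>x<n. f x < N \<and> ok x (f x)) \<and> max_mono_size {..<n} E f \<le> opt)"
      unfolding I2_def using e opt_less ok_def by (intro run_dp) simp_all
    have dp2: "I2 r = I1 r" if "8 \<le> r" for r
      unfolding I2_def using e opt_less that by (intro run_dp(2)[OF opt_less _ _ _ refl]) simp_all
    have u: "unary I2 10 = unary I 10" "unary I2 9 = unary I 9" using dp2 k1 by (simp_all add: unary_def)
    have N2: "c < 2 \<Longrightarrow> c < N" and NN: "c < n \<Longrightarrow> c < N" for c using N by simp_all
    have "(\<forall>x<n. f x < N \<and> ok x (f x)) \<longleftrightarrow> is_coloring 2 {..<n} f \<and> (\<forall>x\<le>v. f x = 1 \<longleftrightarrow> x \<in> ?Z)" for f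
      using N2 NN True by (auto simp: okx is_coloring_def)
    then have fe: "sat N inp I2 ?e feasible_fm \<longleftrightarrow> (\<exists>f. achievable opt f \<and> (\<forall>x\<le>v. f x = 1 \<longleftrightarrow> x \<in> ?Z))"
      using dp1 by (auto simp: achievable_def)
    have g: "sat N inp I ?e (And (Rel1 10 2) (LeS [3, 1] [0]))"
      using Z(2) True e by (auto simp: unary_def Rel1_def)
    have r: "run N inp ?body ?e I = (if sat N inp I2 ?e feasible_fm then I2 else run N inp ?add ?e I2)"
      unfolding run.simps(3,4) if_P[OF g] I1_def[symmetric] I2_def[symmetric] sat.simps(4)
      by (cases "sat N inp I2 ?e feasible_fm") (simp_all only: simp_thms if_True if_False)
    show ?thesis
    proof (cases "sat N inp I2 ?e feasible_fm")
      case sat: True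
      then obtain h where "achievable opt h" "\<forall>x\<le>v. h x = 1 \<longleftrightarrow> x \<in> ?Z" using fe by blast
      then show ?thesis unfolding r Q_def using sat u Z by (auto simp: less_Suc_eq_le)
    next
      case sat: False
      let ?I = "run N inp ?add ?e I2"
      have u9: "unary ?I 9 = insert v ?Z"
      proof -
        have "x < N" if "x \<in> ?Z" for x using Z that v by auto
        then have "unary ?I 9 = insert v (unary I2 9)"
          using v unfolding u(2) by (auto simp: unary_def digits_simps args_env_def arity_def Rel1_def dp2 k1)
        then show ?thesis using u by simp
      qed
      have u10: "unary ?I 10 = {opt}" using u Z by (simp add: unary_def)
      \<comment> \<open>With colour 0 at \<open>v\<close>, the colouring \<open>f\<close> itself
        would have made the test succeed.\<close>
      have "f v = 1"
      proof (rule ccontr)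
        assume "f v \<noteq> 1"
        then have "\<forall>x\<le>v. f x = 1 \<longleftrightarrow> x \<in> ?Z" using f(2) Z(1) True by (auto simp: le_less)
        then show False using sat fe f(1) by blast
      qed
      then have "\<forall>x<n. x < Suc v \<longrightarrow> (f x = 1 \<longleftrightarrow> x \<in> insert v ?Z)" using f(2) by (auto simp: less_Suc_eq)
      then show ?thesis unfolding r Q_def using sat u9 u10 f(1) Z(1) by auto
    qed
  qed
  \<comment> \<open>The outer loop acts only at \<open>opt\<close>: before it relation 9 is empty,
    and after it the colouring is complete.\<close>
  define P where "P i I \<longleftrightarrow> unary I 10 = {opt} \<and> (if opt < i then Q N I else unary I 9 = {})" for i and I :: rels
  have "P N (fold (\<lambda>m. fold (\<lambda>v. run N inp ?body (e(2 := m, 3 := v))) [0..<N]) [0..<N] I)"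
  proof (rule fold_invariant[where P = P])
    show "P 0 I" using I by (simp add: P_def)
    fix m J assume m: "m < N" and PJ: "P m J"
    show "P (Suc m) (fold (\<lambda>v. run N inp ?body (e(2 := m, 3 := v))) [0..<N] J)"
    proof (cases "m = opt")
      case True
      have "Q 0 J" using PJ True opt_achievable by (auto simp: P_def Q_def)
      then have "Q N (fold (\<lambda>v. run N inp ?body (e(2 := opt, 3 := v))) [0..<N] J)"
        by (rule fold_invariant[where P = Q]) (rule step)
      then show ?thesis using True by (simp add: P_def Q_def)
    next
      case False
      have "fold (\<lambda>v. run N inp ?body (e(2 := m, 3 := v))) xs J = J" for xs
      proof (induction xs)
        case (Cons v xs)
        have "run N inp ?body (e(2 := m, 3 := v)) J = J" using False PJ e by (intro skip) (simp_all add: P_def)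
        then show ?case using Cons by (simp only: fold_simps)
      qed simp
      then show ?thesis using PJ False unfolding P_def by (simp only: less_Suc_eq) auto
    qed
  qed
  then have "P N (run N inp color_prog e I)" by (simp only: color_prog_def run_PFor)
  then have "Q N (run N inp color_prog e I)" using opt_less by (simp add: P_def)
  then show "unary (run N inp color_prog e I) 10 = {opt}"
    "\<exists>f. achievable opt f \<and> (\<forall>x<n. f x = 1 \<longleftrightarrow> x \<in> unary (run N inp color_prog e I) 9)"
    using N by (auto simp: Q_def)
qed

end

section \<open>Output of the optimum and of the colouring\<close>

definition output_size_cmd :: cmd where
  "output_size_cmd = Loop (var_reg 2) (Seq (fm_cmd (Rel1 10 2))
     (Cond 3 (Seq (Op (Const 7 0)) (Op (Add 0 (var_reg 2) 7))) (Op (Const 7 0))))"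

text \<open>The colours go to the cells \<open>0\<close> to \<open>n - 1\<close>, over the adjacency
  matrix. The formulas still to be evaluated read only variables and relations, and the latter are
  stored from \<open>N * N\<close> on.\<close>

definition output_color_cmd :: cmd where
  "output_color_cmd = Loop (var_reg 2) (Seq (fm_cmd (LeS [2, 1] [0])) (Cond 3
     (Seq (fm_cmd (Rel1 9 2)) (Cond 3 (Seq (Op (Const 7 1)) (Op (Store (var_reg 2) 7)))
                                    (Seq (Op (Const 7 0)) (Op (Store (var_reg 2) 7)))))
     (Op (Const 7 0))))"

lemma wf_output_fms: "wf_fm 3 (Rel1 r 2)" "wf_fm 3 (LeS [2, 1] [0])"
  by (simp_all add: Rel1_def arity_def)

lemma writes_output:
  "writes output_size_cmd \<subseteq> insert 0 (level_regs 2)" "wf_cmd output_size_cmd"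
  "writes output_color_cmd \<subseteq> level_regs 2" "wf_cmd output_color_cmd"
proof -
  have w: "writes (fm_cmd (Rel1 r 2)) \<subseteq> level_regs 3" "writes (fm_cmd (LeS [2, 1] [0])) \<subseteq> level_regs 3" for r
    using writes_fm_cmd wf_output_fms by blast+
  have l: "level_regs 3 \<subseteq> level_regs 2" "var_reg 2 \<in> level_regs 2" "2 \<in> level_regs 2" "3 \<in> level_regs 2" "7 \<in> level_regs 3"
    "var_reg 2 \<notin> level_regs 3" "1 \<notin> level_regs 3" by (auto simp: level_regs_def var_reg_def)
  show "writes output_size_cmd \<subseteq> insert 0 (level_regs 2)" "writes output_color_cmd \<subseteq> level_regs 2"
    unfolding output_size_cmd_def output_color_cmd_def using w(1)[of 10] w(1)[of 9] w(2) l by auto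
  have v: "var_reg 2 \<noteq> 0" by (simp add: var_reg_def)
  show "wf_cmd output_size_cmd" "wf_cmd output_color_cmd"
    unfolding output_size_cmd_def output_color_cmd_def
    using w(1)[of 10] w(1)[of 9] w(2) l v wf_fm_cmd[OF wf_output_fms(1)] wf_fm_cmd[OF wf_output_fms(2)] by auto
qed

lemma env_ok_unchanged:
  "env_ok N d e R \<Longrightarrow> (\<And>r. r \<notin> level_regs d \<Longrightarrow> R' r = R r) \<Longrightarrow> env_ok N d e R'"
  using not_level_regs(1)[of d] not_level_regs(3)[of _ d] unfolding env_ok_def by metis

lemma env_ok_restrict: "env_ok N 3 (e(2 := i)) R \<Longrightarrow> env_ok N 2 e R"
proof -
  assume env: "env_ok N 3 (e(2 := i)) R"
  have "R (var_reg x) = e x \<and> e x < N" if "x < 2" for x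
  proof -
    have "x < 3" using that by simp
    then have "R (var_reg x) = (e(2 := i)) x \<and> (e(2 := i)) x < N" using env unfolding env_ok_def by blast
    then show ?thesis using that by simp
  qed
  then show ?thesis using env unfolding env_ok_def by simp
qed

lemma env_ok_update: "env_ok N d e R \<Longrightarrow> r < 10 \<Longrightarrow> r \<noteq> 1 \<Longrightarrow> env_ok N d e (R(r := x))"
  unfolding env_ok_def var_reg_def by auto

lemma exec_output_size:
  assumes env: "env_ok N 2 e R" and rep: "represents N inp I M" and N: "2 \<le> N" and I: "unary I 10 = {k}" and k: "k < N"
  shows "\<exists>R'. exec output_size_cmd (R, M) = (R', M) \<and> R' 0 = k \<and> env_ok N 2 e R'"
proof -
  let ?body = "Seq (fm_cmd (Rel1 10 2)) (Cond 3 (Seq (Op (Const 7 0)) (Op (Add 0 (var_reg 2) 7))) (Op (Const 7 0)))"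
  define Q where "Q i s \<longleftrightarrow> snd s = M \<and> env_ok N 2 e (fst s) \<and> (k < i \<longrightarrow> fst s 0 = k)" for i and s :: store
  have R1: "R 1 = N" using env by (simp add: env_ok_def)
  have "Q N (fold (loop_body (var_reg 2) N (exec ?body)) [0..<N] (R, M))"
  proof (rule fold_invariant[where P = Q])
    show "Q 0 (R, M)" using env by (simp add: Q_def)
    fix i s assume i: "i < N" and Q: "Q i s"
    let ?R = "(fst s)(var_reg 2 := i, 2 := N - i)"
    have env3: "env_ok N 3 (e(2 := i)) ?R"
      using Q i by (auto simp: Q_def env_ok_def var_reg_def)
    obtain R' where R': "exec (fm_cmd (Rel1 10 2)) (?R, M) = (R', M)" "R' 3 \<noteq> 0 \<longleftrightarrow> sat N inp I (e(2 := i)) (Rel1 10 2)"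
      using fm_cmd_correct[OF wf_output_fms(1) env3 rep N] by blast
    have "sat N inp I (e(2 := i)) (Rel1 10 2) \<longleftrightarrow> i = k" using I by (auto simp: unary_def Rel1_def)
    then have R3: "R' 3 \<noteq> 0 \<longleftrightarrow> i = k" using R'(2) by simp
    have un: "R' r = ?R r" if "r \<notin> level_regs 3" for r
      by (rule exec_unchanged[OF R'(1) writes_fm_cmd[OF wf_output_fms(1)] that])
    have vals: "R' (var_reg 2) = i" "R' 0 = fst s 0"
      using un[of "var_reg 2"] un[of 0] by (auto simp: level_regs_def var_reg_def)
    have env2: "env_ok N 2 e R'" by (rule env_ok_restrict[OF env_ok_unchanged[OF env3 un]])
    have sM: "snd s = M" using Q by (simp add: Q_def)
    show "Q (Suc i) (loop_body (var_reg 2) N (exec ?body) i s)"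
    proof (cases "i = k")
      case True
      then have "loop_body (var_reg 2) N (exec ?body) i s = (R'(7 := 0, 0 := k), M)"
        using R'(1) R3 vals sM by (simp add: loop_body_def)
      then show ?thesis using env2 by (simp add: Q_def env_ok_update)
    next
      case False
      then have "loop_body (var_reg 2) N (exec ?body) i s = (R'(7 := 0), M)"
        using R'(1) R3 sM by (simp add: loop_body_def)
      then show ?thesis using env2 Q False vals by (simp add: Q_def env_ok_update less_Suc_eq)
    qed
  qed
  moreover obtain R2 M2 where s2: "fold (loop_body (var_reg 2) N (exec ?body)) [0..<N] (R, M) = (R2, M2)" by fastforce
  ultimately have q: "M2 = M" "env_ok N 2 e R2" "R2 0 = k" using k by (auto simp: Q_def)
  have "exec output_size_cmd (R, M) = loop_end (var_reg 2) N (R2, M2)"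
    unfolding output_size_cmd_def using s2 R1 by (simp only: exec.simps(4) fst_conv)
  moreover have "env_ok N 2 e (R2(var_reg 2 := N, 2 := 0))" using q(2) by (auto simp: env_ok_def var_reg_def)
  ultimately show ?thesis using q by (simp add: loop_end_def var_reg_def)
qed

lemma exec_output_color:
  assumes env: "env_ok N 2 e R" and rep: "represents N inp I M" and N: "2 \<le> N" and e: "e 0 = n" "e 1 = 1" "n < N"
  shows "\<exists>R' M'. exec output_color_cmd (R, M) = (R', M') \<and> R' 0 = R 0 \<and>
    (\<forall>x<n. M' x = (if x \<in> unary I 9 then 1 else 0))"
proof -
  let ?store = "Cond 3 (Seq (Op (Const 7 1)) (Op (Store (var_reg 2) 7))) (Seq (Op (Const 7 0)) (Op (Store (var_reg 2) 7)))"
  let ?body = "Seq (fm_cmd (LeS [2, 1] [0])) (Cond 3 (Seq (fm_cmd (Rel1 9 2)) ?store) (Op (Const 7 0)))"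
  define Q where "Q i s \<longleftrightarrow> env_ok N 2 e (fst s) \<and> fst s 0 = R 0 \<and> (\<forall>a\<ge>n. snd s a = M a) \<and>
     (\<forall>x<n. x < i \<longrightarrow> snd s x = (if x \<in> unary I 9 then 1 else 0))" for i and s :: store
  have R1: "R 1 = N" using env by (simp add: env_ok_def)
  have "Q N (fold (loop_body (var_reg 2) N (exec ?body)) [0..<N] (R, M))"
  proof (rule fold_invariant[where P = Q])
    show "Q 0 (R, M)" using env by (simp add: Q_def)
    fix i s assume i: "i < N" and Q: "Q i s"
    obtain Rs Ms where s: "s = (Rs, Ms)" by fastforce
    \<comment> \<open>As the matrix is being overwritten, the current memory takes its place as the
      input that \<open>represents\<close> refers to.\<close>
    let ?inp = "\<lambda>a. Ms a \<noteq> 0"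
    let ?R = "Rs(var_reg 2 := i, 2 := N - i)"
    have rep': "represents N ?inp I Ms"
      unfolding represents_def
    proof (intro conjI allI impI)
      fix r ds assume ds: "digits N ds"
      have "n \<le> address N r ds" using address_ge[OF ds, of r] N e(3) le_square[of N] by linarith
      then show "I r ds \<longleftrightarrow> Ms (address N r ds) \<noteq> 0" using rep ds Q s by (simp add: represents_def Q_def)
    qed simp
    have env3: "env_ok N 3 (e(2 := i)) ?R"
      using Q i s by (auto simp: Q_def env_ok_def var_reg_def)
    obtain R' where R': "exec (fm_cmd (LeS [2, 1] [0])) (?R, Ms) = (R', Ms)"
      "R' 3 \<noteq> 0 \<longleftrightarrow> sat N ?inp I (e(2 := i)) (LeS [2, 1] [0])"
      using fm_cmd_correct[OF wf_output_fms(2) env3 rep' N] by blast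
    have R3: "R' 3 \<noteq> 0 \<longleftrightarrow> i < n" using R'(2) e by (simp add: Suc_le_eq)
    have un: "R' r = ?R r" if "r \<notin> level_regs 3" for r
      by (rule exec_unchanged[OF R'(1) writes_fm_cmd[OF wf_output_fms(2)] that])
    have env3': "env_ok N 3 (e(2 := i)) R'"
      by (rule env_ok_unchanged[OF env3 un])
    have R0: "R' 0 = R 0" using un[of 0] Q s by (simp add: level_regs_def var_reg_def Q_def)
    show "Q (Suc i) (loop_body (var_reg 2) N (exec ?body) i s)"
    proof (cases "i < n")
      case False
      then have "loop_body (var_reg 2) N (exec ?body) i s = (R'(7 := 0), Ms)"
        using R'(1) R3 s by (simp add: loop_body_def)
      moreover have "env_ok N 2 e (R'(7 := 0))"
        using env_ok_restrict[OF env3'] by (simp add: env_ok_update)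
      ultimately show ?thesis using Q s R0 False by (auto simp: Q_def)
    next
      case True
      obtain R2 where R2: "exec (fm_cmd (Rel1 9 2)) (R', Ms) = (R2, Ms)"
        "R2 3 \<noteq> 0 \<longleftrightarrow> sat N ?inp I (e(2 := i)) (Rel1 9 2)"
        using fm_cmd_correct[OF wf_output_fms(1) env3' rep' N] by blast
      have R23: "R2 3 \<noteq> 0 \<longleftrightarrow> i \<in> unary I 9" using R2(2) by (simp add: unary_def Rel1_def)
      have un2: "R2 r = R' r" if "r \<notin> level_regs 3" for r
        by (rule exec_unchanged[OF R2(1) writes_fm_cmd[OF wf_output_fms(1)] that])
      have env4: "env_ok N 3 (e(2 := i)) R2"
        by (rule env_ok_unchanged[OF env3' un2])
      have R20: "R2 0 = R 0" using un2[of 0] R0 by (simp add: level_regs_def var_reg_def)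
      define c where "c = (if i \<in> unary I 9 then 1 else 0 :: nat)"
      have "R2 (var_reg 2) = i" using env4 by (simp add: env_ok_def)
      then have "loop_body (var_reg 2) N (exec ?body) i s = (R2(7 := c), Ms(i := c))"
        using R'(1) R3 s True R2(1) R23
        by (cases "i \<in> unary I 9") (simp_all add: loop_body_def c_def del: fm_cmd.simps)
      moreover have "env_ok N 2 e (R2(7 := c))"
        using env_ok_restrict[OF env4] by (simp add: env_ok_update)
      ultimately show ?thesis using Q s R20 True by (auto simp: Q_def c_def less_Suc_eq)
    qed
  qed
  moreover obtain R2 M2 where s2: "fold (loop_body (var_reg 2) N (exec ?body)) [0..<N] (R, M) = (R2, M2)" by fastforce
  ultimately have q: "R2 0 = R 0" "\<forall>x<n. M2 x = (if x \<in> unary I 9 then 1 else 0)" using e(3) by (auto simp: Q_def)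
  have "exec output_color_cmd (R, M) = loop_end (var_reg 2) N (R2, M2)"
    unfolding output_color_cmd_def using s2 R1 by (simp only: exec.simps(4) fst_conv)
  then show ?thesis using q by (simp add: loop_end_def var_reg_def)
qed

text \<open>The final memory serves as the colouring, and it is known to agree with an optimal one
  only on the vertices.\<close>

lemma max_mono_size_cong:
  assumes "\<And>x. x \<in> V \<Longrightarrow> f x = g x" shows "max_mono_size V E f = max_mono_size V E g"
proof -
  have "{v \<in> V. f v = c} = {v \<in> V. g v = c}" for c using assms by auto
  then show ?thesis unfolding max_mono_size_def mono_components_def by simp
qed

section \<open>The complete machine program\<close>

definition main_cmd :: cmd where
  "main_cmd = Seq (prog_cmd (PSeq search_prog color_prog)) (Seq output_size_cmd output_color_cmd)"

text \<open>The register of variable 0 is 10, that of variable 1 is 12.\<close>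

definition ram_program :: "instr list" where
  "ram_program = [Const 7 2, Add 1 0 7, Const 7 0, Add 10 0 7, Const 12 1] @ assemble 5 main_cmd"

text \<open>The 5 in the time bound pays for the prelude, which establishes the loop count
  \<open>n + 2\<close> in register 1 and the values \<open>n\<close> and 1 of variables 0 and
  1.\<close>

lemma main_cmd_reaches:
  "reaches ram_program (5 + cost main_cmd (n + 2)) (graph_input n E)
    (length ram_program, exec main_cmd ((\<lambda>i. if i = 0 then n else 0)(7 := 0, 1 := n + 2, 10 := n, 12 := 1), snd (snd (graph_input n E))))"
proof -
  let ?P = ram_program
  define R where "R = (\<lambda>i :: nat. if i = 0 then n else 0 :: nat)"
  define M where "M = snd (snd (graph_input n E))"
  have g: "graph_input n E = (0, R, M)" by (simp add: graph_input_def R_def M_def)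
  have len: "5 < length ?P \<or> 5 = length ?P" by (auto simp: ram_program_def)
  then have i: "i < length ?P" if "i < 5" for i using that by auto
  have s1: "reaches ?P 1 (0, R, M) (1, R(7 := 2), M)"
    using reaches_step[of 0 ?P "Const 7 2" "(R, M)"] i by (simp add: ram_program_def)
  have s2: "reaches ?P 1 (1, R(7 := 2), M) (2, R(7 := 2, 1 := n + 2), M)"
    using reaches_step[of 1 ?P "Add 1 0 7" "(R(7 := 2), M)"] i by (simp add: ram_program_def R_def numeral_2_eq_2)
  have s3: "reaches ?P 1 (2, R(7 := 2, 1 := n + 2), M) (3, R(7 := 0, 1 := n + 2), M)"
    using reaches_step[of 2 ?P "Const 7 0" "(R(7 := 2, 1 := n + 2), M)"] i by (simp add: ram_program_def fun_upd_twist)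
  have s4: "reaches ?P 1 (3, R(7 := 0, 1 := n + 2), M) (4, R(7 := 0, 1 := n + 2, 10 := n), M)"
    using reaches_step[of 3 ?P "Add 10 0 7" "(R(7 := 0, 1 := n + 2), M)"] i by (simp add: ram_program_def R_def)
  have s5: "reaches ?P 1 (4, R(7 := 0, 1 := n + 2, 10 := n), M) (5, R(7 := 0, 1 := n + 2, 10 := n, 12 := 1), M)"
    using reaches_step[of 4 ?P "Const 12 1" "(R(7 := 0, 1 := n + 2, 10 := n), M)"] i by (simp add: ram_program_def)
  have pre: "reaches ?P (1 + 1 + 1 + 1 + 1) (0, R, M) (5, R(7 := 0, 1 := n + 2, 10 := n, 12 := 1), M)"
    by (rule reaches_trans[OF reaches_trans[OF reaches_trans[OF reaches_trans[OF s1 s2] s3] s4] s5])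
  have code: "code_at ?P 5 (assemble 5 main_cmd)"
    unfolding code_at_def ram_program_def
    by (rule exI[of _ "[Const 7 2, Add 1 0 7, Const 7 0, Add 10 0 7, Const 12 1]"], rule exI[of _ "[]"]) simp
  have l1: "1 \<notin> insert 0 (level_regs 2)" by (simp add: level_regs_def var_reg_def)
  have wf: "wf_cmd main_cmd" "1 \<notin> writes main_cmd"
    using wf_prog_cmd[OF wf_search_color] writes_prog_cmd[OF wf_search_color] writes_output l1 unfolding main_cmd_def by auto
  let ?s = "(R(7 := 0, 1 := n + 2, 10 := n, 12 := 1), M)"
  have "fst ?s 1 = n + 2" by simp
  then have "reaches ?P (cost main_cmd (n + 2)) (5, ?s) (5 + cmd_size main_cmd, exec main_cmd ?s)"
    using assemble_correct[OF wf(1) code wf(2), of ?s] by simp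
  moreover have "5 + cmd_size main_cmd = length ?P" by (simp add: ram_program_def length_assemble)
  moreover have five: "(1 + 1 + 1 + 1 + 1 :: nat) = 5" by simp
  ultimately have "reaches ?P (5 + cost main_cmd (n + 2)) (0, R, M) (length ?P, exec main_cmd ?s)"
    using reaches_trans[OF pre] unfolding five by metis
  then show ?thesis unfolding g[symmetric] unfolding R_def M_def .
qed

theorem theorem1:
  "\<exists>(P :: instr list) (p :: nat poly). \<forall>(n :: nat) (E :: nat set set).
     maximal_outerplanar {..<n} E \<longrightarrow>
     (\<exists>pc R M. halts_within P (graph_input n E) (poly p n) (pc, R, M) \<and>
        is_coloring 2 {..<n} M \<and>
        (\<forall>g. is_coloring 2 {..<n} g \<longrightarrow> max_mono_size {..<n} E M \<le> max_mono_size {..<n} E g) \<and>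
        R 0 = mcc 2 {..<n} E)"
proof -
  obtain q :: "nat poly" where q: "\<forall>n. cost main_cmd (n + 2) = poly q n" using cost_poly by blast
  show ?thesis
  proof (intro exI[of _ ram_program] exI[of _ "[:5:] + q"] allI impI)
    fix n :: nat and E :: "nat set set"
    assume "maximal_outerplanar {..<n} E"
    then have out: "outerplanar {..<n} E" by (simp add: maximal_outerplanar_def)
    define M where "M = snd (snd (graph_input n E))"
    define inp where "inp = (\<lambda>a. M a \<noteq> 0)"
    define N where "N = n + 2"
    interpret dp n N E inp
      by unfold_locales (auto simp: out N_def inp_def M_def graph_input_def)
    define R where "R = (\<lambda>i :: nat. if i = 0 then n else 0 :: nat)(7 := 0, 1 := n + 2, 10 := n, 12 := 1)"
    define e where "e = (\<lambda>x :: nat. if x = 0 then n else 1 :: nat)"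
    have e: "e 0 = n" "e 1 = 1" by (simp_all add: e_def)
    have N2: "2 \<le> N" by (simp add: N_def)
    have env: "env_ok N 2 e R" by (auto simp: env_ok_def R_def e_def N_def var_reg_def less_2_cases_iff)
    \<comment> \<open>Memory beyond the adjacency matrix is zero at the start, so all relations are
      empty.\<close>
    have rep: "represents N inp (\<lambda>_ _. False) M"
      unfolding represents_def
    proof (intro conjI allI impI)
      fix r ds assume ds: "digits N ds"
      have "n * n \<le> N * N" by (intro mult_le_mono) (simp_all add: N_def)
      then have "n * n \<le> address N r ds" using address_ge[OF ds, of r] N2 by linarith
      then show "False \<longleftrightarrow> M (address N r ds) \<noteq> 0" by (simp add: M_def graph_input_def)
    qed (simp add: inp_def)
    define J where "J = run N inp (PSeq search_prog color_prog) e (\<lambda>_ _. False)"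
    obtain R1 M1 where s1: "exec (prog_cmd (PSeq search_prog color_prog)) (R, M) = (R1, M1)" by fastforce
    have rep1: "represents N inp J M1"
      using prog_cmd_correct[OF wf_search_color env rep N2] s1 by (simp add: J_def)
    have "R1 r = R r" if "r \<notin> level_regs 2" for r
      by (rule exec_unchanged[OF s1 writes_prog_cmd[OF wf_search_color] that])
    then have env1: "env_ok N 2 e R1" by (rule env_ok_unchanged[OF env])
    have J: "unary J 10 = {opt}" "\<exists>f. achievable opt f \<and> (\<forall>x<n. f x = 1 \<longleftrightarrow> x \<in> unary J 9)"
      using run_color[OF e run_search[OF e]] by (simp_all add: J_def)
    obtain R2 where R2: "exec output_size_cmd (R1, M1) = (R2, M1)" "R2 0 = opt" "env_ok N 2 e R2"
      using exec_output_size[OF env1 rep1 N2 J(1) opt_less] by blast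
    obtain R3 M3 where R3: "exec output_color_cmd (R2, M1) = (R3, M3)" "R3 0 = R2 0"
      "\<forall>x<n. M3 x = (if x \<in> unary J 9 then 1 else 0)"
      using exec_output_color[OF R2(3) rep1 N2 e] by (auto simp: N_def)
    have ex: "exec main_cmd (R, M) = (R3, M3)" using s1 R2(1) R3(1) by (simp add: main_cmd_def)
    obtain f where f: "achievable opt f" "\<forall>x<n. f x = 1 \<longleftrightarrow> x \<in> unary J 9" using J(2) by blast
    have "f x = M3 x" if "x < n" for x
    proof -
      have "f x < 2" using f(1) that by (simp add: achievable_def is_coloring_def)
      then show ?thesis using f(2) R3(3) that by (auto simp: less_2_cases_iff)
    qed
    then have mm: "max_mono_size {..<n} E M3 = max_mono_size {..<n} E f" by (intro max_mono_size_cong) simp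
    show "\<exists>pc R M. halts_within ram_program (graph_input n E) (poly ([:5:] + q) n) (pc, R, M) \<and>
        is_coloring 2 {..<n} M \<and>
        (\<forall>g. is_coloring 2 {..<n} g \<longrightarrow> max_mono_size {..<n} E M \<le> max_mono_size {..<n} E g) \<and>
        R 0 = mcc 2 {..<n} E"
    proof (intro exI conjI allI impI)
      have "reaches ram_program (5 + cost main_cmd (n + 2)) (graph_input n E) (length ram_program, R3, M3)"
        using main_cmd_reaches[of n E] ex unfolding R_def M_def by simp
      then show "halts_within ram_program (graph_input n E) (poly ([:5:] + q) n) (length ram_program, R3, M3)"
        using q unfolding reaches_def halts_within_def halted_def by simp
      show "is_coloring 2 {..<n} M3" using R3(3) by (simp add: is_coloring_def)
      show "R3 0 = mcc 2 {..<n} E" using R3(2) R2(2) opt_eq_mcc by simp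
      fix g assume "is_coloring 2 {..<n} g"
      then have "opt \<le> max_mono_size {..<n} E g" by (intro opt_le[of _ g]) (simp add: achievable_def)
      then show "max_mono_size {..<n} E M3 \<le> max_mono_size {..<n} E g"
        using f(1) mm by (simp add: achievable_def)
    qed
  qed
qed

end
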